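(* Let $\omega\in\widehat{\mathcal{D}}$ and $1<p<\infty$. Then $P_\omega:L^p_\omega\to L^p_\omega$ is bounded.
   Context: $\mathbb{D}$ is the open unit disc of $\mathbb{C}$ and $dA(z)=\frac{dx\,dy}{\pi}$. A radial weight is a nonnegative function $\omega\in L^1([0,1))$ extended to $\mathbb{D}$ by $\omega(z)=\omega(|z|)$; it is assumed throughout that $\widehat{\omega}(z)=\int_{|z|}^1\omega(s)\,ds>0$ for all $z\in\mathbb{D}$. A radial weight $\omega$ belongs to $\widehat{\mathcal{D}}$ if there is $C\ge1$ with $\widehat{\omega}(r)\le C\widehat{\omega}\left(\frac{1+r}{2}\right)$ for all $0\le r<1$. $L^p_\omega$ is the space of measurable $f$ on $\mathbb{D}$ with $\|f\|_{L^p_\omega}^p=\int_{\mathbb{D}}|f(z)|^p\omega(z)\,dA(z)<\infty$. Write $\omega_x=\int_0^1r^x\omega(r)\,dr$ for $x\ge0$. The Bergman projection induced by $\omega$ is $P_\omega(f)(z)=\int_{\mathbb{D}}f(\zeta)\overline{B^\omega_z(\zeta)}\,\omega(\zeta)\,dA(\zeta)$, where $B^\omega_z(\zeta)=\sum_{n=0}^\infty\frac{(\overline{z}\zeta)^n}{2\omega_{2n+1}}$ is the reproducing kernel of the Hilbert space of analytic functions in $L^2_\omega$. *)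

theory Defs
  imports "HOL-Analysis.Analysis"
begin

abbreviation unit_disc :: "complex set" where
  "unit_disc \<equiv> ball 0 1"

(* dA = dx dy / pi on the unit disc; the library's Lebesgue measure on the complex plane is dx dy *)
definition disc_area :: "complex measure" where
  "disc_area = density (lebesgue_on unit_disc) (\<lambda>_. ennreal (1 / pi))"

(* A radial weight is represented by its profile on [0,1); its value at z in the disc is
   \<omega> (cmod z), so values of the profile outside [0,1) are never used. *)

definition tail_integral :: "(real \<Rightarrow> real) \<Rightarrow> real \<Rightarrow> real" where
  "tail_integral \<omega> r = (LINT s:{r..<1}|lebesgue. \<omega> s)"

definition radial_weight :: "(real \<Rightarrow> real) \<Rightarrow> bool" where
  "radial_weight \<omega> \<longleftrightarrow>
     (\<forall>r\<in>{0..<1}. 0 \<le> \<omega> r) \<and>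
     set_integrable lebesgue {0..<1} \<omega> \<and>
     (\<forall>z\<in>unit_disc. 0 < tail_integral \<omega> (cmod z))"

definition D_hat :: "(real \<Rightarrow> real) set" where
  "D_hat = {\<omega>. radial_weight \<omega> \<and>
     (\<exists>C\<ge>1. \<forall>r\<in>{0..<1}. tail_integral \<omega> r \<le> C * tail_integral \<omega> ((1 + r) / 2))}"

definition Lp_weighted :: "(real \<Rightarrow> real) \<Rightarrow> real \<Rightarrow> (complex \<Rightarrow> complex) set" where
  "Lp_weighted \<omega> p =
     {f \<in> borel_measurable (lebesgue_on unit_disc).
        integrable disc_area (\<lambda>z. cmod (f z) powr p * \<omega> (cmod z))}"

definition Lp_norm :: "(real \<Rightarrow> real) \<Rightarrow> real \<Rightarrow> (complex \<Rightarrow> complex) \<Rightarrow> real" where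
  "Lp_norm \<omega> p f = (LINT z|disc_area. cmod (f z) powr p * \<omega> (cmod z)) powr (1 / p)"

definition moment :: "(real \<Rightarrow> real) \<Rightarrow> real \<Rightarrow> real" where
  "moment \<omega> x = (LINT r:{0..<1}|lebesgue. r powr x * \<omega> r)"

definition bergman_kernel :: "(real \<Rightarrow> real) \<Rightarrow> complex \<Rightarrow> complex \<Rightarrow> complex" where
  "bergman_kernel \<omega> z \<zeta> =
     (\<Sum>n. (cnj z * \<zeta>) ^ n / complex_of_real (2 * moment \<omega> (real (2 * n + 1))))"

definition bergman_integrand ::
    "(real \<Rightarrow> real) \<Rightarrow> (complex \<Rightarrow> complex) \<Rightarrow> complex \<Rightarrow> complex \<Rightarrow> complex" where
  "bergman_integrand \<omega> f z \<zeta> =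
     f \<zeta> * cnj (bergman_kernel \<omega> z \<zeta>) * complex_of_real (\<omega> (cmod \<zeta>))"

definition bergman_projection ::
    "(real \<Rightarrow> real) \<Rightarrow> (complex \<Rightarrow> complex) \<Rightarrow> complex \<Rightarrow> complex" where
  "bergman_projection \<omega> f z = (LINT \<zeta>|disc_area. bergman_integrand \<omega> f z \<zeta>)"

definition bounded_on_Lp ::
    "(real \<Rightarrow> real) \<Rightarrow> real \<Rightarrow> ((complex \<Rightarrow> complex) \<Rightarrow> complex \<Rightarrow> complex) \<Rightarrow> bool" where
  "bounded_on_Lp \<omega> p T \<longleftrightarrow>
     (\<forall>f\<in>Lp_weighted \<omega> p. T f \<in> Lp_weighted \<omega> p) \<and>
     (\<exists>C. \<forall>f\<in>Lp_weighted \<omega> p. Lp_norm \<omega> p (T f) \<le> C * Lp_norm \<omega> p f)"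

end

(*
  Averaging over rotations reduces the projection to operators acting, for fixed z and w in the
  disc, on functions on the unit circle with kernel sum_{n >= 0} t^n e^{inx} / c_n, where t = |zw|
  and c_n is twice the moment of order 2n+1.  Two summations by parts write this kernel as
  sum_m (m+1) Delta^2(t^n/c_n)_m G_m with G_m the analytic half of the Fejer kernel.
  The operators with kernel G_m are uniformly bounded on L^p of the circle: for 1 < p <= 2 and
  nonnegative functions this is Calderon's proof of M. Riesz' theorem (the real part of the
  extension is positive, so its p-th power is holomorphic), and p > 2 follows by duality.
  The doubling property of the weight gives sum_m (m+1) |Delta^2(t^n/c_n)_m| <= A / T(t), where
  T(t) is the mass of {|z| >= t}.  Since T(|zw|) >= max (T |z|) (T |w|), what remains is a Hardy
  type operator with kernel 1 / max (T |z|) (T |w|), which a Schur test with powers of T handles.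
*)
theory Submission
  imports Defs "HOL-Complex_Analysis.Complex_Analysis"
begin

section \<open>Lebesgue measure on the disc\<close>

text \<open>Absolute values of the kernel are not enough. If all c_n are equal, the kernel is a
  multiple of 1 / (1 - t e^(ix)), whose L^1 norm on the circle has order log (1 / (1 - t)), whereas
  the bound sought on L^p of the circle has no logarithm. The cancellation has to come from the
  Riesz theorem, and positivity of the Fejer kernel does not replace it: only frequencies n \<ge> 0
  occur, so summation by parts produces just the analytic half of that kernel. Two summations are
  made because one leaves Dirichlet kernels, which have no such positivity. On the circle Re G_m
  \<ge> 1/2, so every g \<ge> 0 with nonzero integral is sent to a polynomial with positive real
  part; Calderon's argument then runs on polynomials, without boundary values. One convexity
  inequality, \<open>weighted_Jensen_powr\<close>, serves three times: for convolution with Re G_m,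
  for the sum over m, and for the Schur test.\<close>

lemma lborel_complex_eq: "lborel = distr (lborel \<Otimes>\<^sub>M lborel) borel (\<lambda>(x, y). Complex x y)"
proof (rule lborel_eqI)
  have [measurable]: "(\<lambda>(x, y). Complex x y) \<in> (borel \<Otimes>\<^sub>M borel) \<rightarrow>\<^sub>M borel"
    unfolding Complex_eq by measurable
  fix l u :: complex
  assume le: "\<And>b. b \<in> Basis \<Longrightarrow> l \<bullet> b \<le> u \<bullet> b"
  have "(\<lambda>(x, y). Complex x y) -` box l u = {Re l<..<Re u} \<times> {Im l<..<Im u}"
    by (auto simp: box_def Basis_complex_def)
  then have "emeasure (distr (lborel \<Otimes>\<^sub>M lborel) borel (\<lambda>(x, y). Complex x y)) (box l u)
     = emeasure (lborel \<Otimes>\<^sub>M lborel) ({Re l<..<Re u} \<times> {Im l<..<Im u})"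
    by (subst emeasure_distr) (auto simp: space_pair_measure)
  also have "\<dots> = ennreal (Re u - Re l) * ennreal (Im u - Im l)"
    using le[of 1] le[of \<i>] by (subst lborel.emeasure_pair_measure_Times) (auto simp: Basis_complex_def)
  also have "\<dots> = ennreal (\<Prod>b\<in>Basis. (u - l) \<bullet> b)"
    using le[of 1] le[of \<i>] by (auto simp: Basis_complex_def ennreal_mult)
  finally show "emeasure (distr (lborel \<Otimes>\<^sub>M lborel) borel (\<lambda>(x, y). Complex x y)) (box l u)
     = ennreal (\<Prod>b\<in>Basis. (u - l) \<bullet> b)" .
qed simp

lemma nn_integral_lborel_complex:
  assumes [measurable]: "f \<in> borel_measurable borel"
  shows "(\<integral>\<^sup>+z. f z \<partial>lborel) = (\<integral>\<^sup>+y. \<integral>\<^sup>+x. f (Complex x y) \<partial>lborel \<partial>lborel)"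
    and "(\<integral>\<^sup>+z. f z \<partial>lborel) = (\<integral>\<^sup>+x. \<integral>\<^sup>+y. f (Complex x y) \<partial>lborel \<partial>lborel)"
proof -
  have [measurable]: "(\<lambda>(x, y). Complex x y) \<in> (borel \<Otimes>\<^sub>M borel) \<rightarrow>\<^sub>M borel"
    unfolding Complex_eq by measurable
  have *: "(\<integral>\<^sup>+z. f z \<partial>lborel) = (\<integral>\<^sup>+w. f (case w of (x, y) \<Rightarrow> Complex x y) \<partial>(lborel \<Otimes>\<^sub>M lborel))"
    by (subst lborel_complex_eq) (simp add: nn_integral_distr)
  show "(\<integral>\<^sup>+z. f z \<partial>lborel) = (\<integral>\<^sup>+x. \<integral>\<^sup>+y. f (Complex x y) \<partial>lborel \<partial>lborel)"
    unfolding * by (subst lborel.nn_integral_fst[symmetric]) auto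
  show "(\<integral>\<^sup>+z. f z \<partial>lborel) = (\<integral>\<^sup>+y. \<integral>\<^sup>+x. f (Complex x y) \<partial>lborel \<partial>lborel)"
    unfolding * by (subst lborel_pair.nn_integral_snd[symmetric]) auto
qed

section \<open>Shears and rotations of the plane\<close>

lemma borel_measurable_Complex [measurable (raw)]:
  assumes "f \<in> borel_measurable M" "g \<in> borel_measurable M"
  shows "(\<lambda>x. Complex (f x) (g x)) \<in> borel_measurable M"
  unfolding Complex_eq using assms by measurable

lemma nn_integral_lborel_shift:
  fixes f :: "real \<Rightarrow> ennreal"
  assumes "f \<in> borel_measurable borel"
  shows "(\<integral>\<^sup>+x. f (x + a) \<partial>lborel) = (\<integral>\<^sup>+x. f x \<partial>lborel)"
  using nn_integral_real_affine[of f 1 a] assms by (simp add: add.commute)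

text \<open>On every horizontal, respectively vertical, line a shear is a translation, so
  integrating along these lines first gives invariance.\<close>

lemma nn_integral_lborel_shear:
  assumes [measurable]: "f \<in> borel_measurable borel"
  shows "(\<integral>\<^sup>+z. f (Complex (Re z + t * Im z) (Im z)) \<partial>lborel) = (\<integral>\<^sup>+z. f z \<partial>lborel)"
    and "(\<integral>\<^sup>+z. f (Complex (Re z) (Im z + t * Re z)) \<partial>lborel) = (\<integral>\<^sup>+z. f z \<partial>lborel)"
proof -
  have "(\<integral>\<^sup>+x. f (Complex (x + t * y) y) \<partial>lborel) = (\<integral>\<^sup>+x. f (Complex x y) \<partial>lborel)" for y
    by (rule nn_integral_lborel_shift) measurable
  then show "(\<integral>\<^sup>+z. f (Complex (Re z + t * Im z) (Im z)) \<partial>lborel) = (\<integral>\<^sup>+z. f z \<partial>lborel)"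
    by (subst (1 2) nn_integral_lborel_complex(1)) simp_all
  have "(\<integral>\<^sup>+y. f (Complex x (y + t * x)) \<partial>lborel) = (\<integral>\<^sup>+y. f (Complex x y) \<partial>lborel)" for x
    by (rule nn_integral_lborel_shift) measurable
  then show "(\<integral>\<^sup>+z. f (Complex (Re z) (Im z + t * Re z)) \<partial>lborel) = (\<integral>\<^sup>+z. f z \<partial>lborel)"
    by (subst (1 2) nn_integral_lborel_complex(2)) simp_all
qed

lemma nn_integral_lborel_rotate:
  fixes c :: complex
  assumes f [measurable]: "f \<in> borel_measurable borel" and c: "cmod c = 1"
  shows "(\<integral>\<^sup>+z. f (c * z) \<partial>lborel) = (\<integral>\<^sup>+z. f z \<partial>lborel)"
proof -
  have shears: "(\<integral>\<^sup>+z. g (c * z) \<partial>lborel) = (\<integral>\<^sup>+z. g z \<partial>lborel)"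
    if [measurable]: "g \<in> borel_measurable borel" and c: "cmod c = 1" "Im c \<noteq> 0" for g c
  proof -
    define b where "b = Im c"
    \<comment> \<open>For c = exp (i \<theta>) this is - tan (\<theta> / 2); the division by Im c is
      why real c are treated separately.\<close>
    define t where "t = (Re c - 1) / b"
    have sq: "(Re c)\<^sup>2 + b\<^sup>2 = 1"
      using c by (simp add: b_def cmod_def)
    have a: "1 + t * b = Re c" and d: "(Re c + 1) * t = - b"
      using c sq by (simp_all add: b_def t_def divide_simps) (simp add: power2_eq_square algebra_simps)
    \<comment> \<open>a rotation is a product of three shears\<close>
    define s1 where "s1 = (\<lambda>z. Complex (Re z + t * Im z) (Im z))"
    define s2 where "s2 = (\<lambda>z. Complex (Re z) (Im z + b * Re z))"
    have [measurable]: "s1 \<in> borel_measurable borel" "s2 \<in> borel_measurable borel"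
      unfolding s1_def s2_def by measurable
    have "s1 (s2 (s1 z)) = c * z" for z
    proof (rule complex_eqI)
      have "Re (s1 (s2 (s1 z))) = (1 + t * b) * Re z + ((1 + t * b) + 1) * t * Im z"
        by (simp add: s1_def s2_def algebra_simps)
      then show "Re (s1 (s2 (s1 z))) = Re (c * z)"
        unfolding a d by (simp add: b_def)
      have "Im (s1 (s2 (s1 z))) = b * Re z + (1 + t * b) * Im z"
        by (simp add: s1_def s2_def algebra_simps)
      then show "Im (s1 (s2 (s1 z))) = Im (c * z)"
        unfolding a by (simp add: b_def)
    qed
    then have "(\<integral>\<^sup>+z. g (c * z) \<partial>lborel) = (\<integral>\<^sup>+z. g (s1 (s2 (s1 z))) \<partial>lborel)"
      by simp
    also have "\<dots> = (\<integral>\<^sup>+z. g (s1 (s2 z)) \<partial>lborel)"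
      using nn_integral_lborel_shear(1)[of "\<lambda>z. g (s1 (s2 z))" t] by (simp add: s1_def)
    also have "\<dots> = (\<integral>\<^sup>+z. g (s1 z) \<partial>lborel)"
      using nn_integral_lborel_shear(2)[of "\<lambda>z. g (s1 z)" b] by (simp add: s2_def)
    also have "\<dots> = (\<integral>\<^sup>+z. g z \<partial>lborel)"
      using nn_integral_lborel_shear(1)[of g t] by (simp add: s1_def)
    finally show ?thesis .
  qed
  consider "Im c \<noteq> 0" | "c = 1" | "c = -1"
    using c by (cases "Im c = 0") (auto simp: cmod_eq_Re complex_eq_iff abs_if split: if_splits)
  then show ?thesis
  proof cases
    \<comment> \<open>Rotation by -1 is rotation by i done twice.\<close>
    case 3
    then show ?thesis
      using shears[of "\<lambda>z. f (\<i> * z)" \<i>] shears[of f \<i>] by simp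
  qed (use shears[of f c] c in auto)
qed

text \<open>Polar coordinates for radial functions, obtained without a change of variables: the two
  measures are compared on half-lines, and these pull back to annuli of known area.\<close>

lemma distr_disc_cmod:
  "distr (density lborel (indicator unit_disc)) borel cmod
   = density lborel (\<lambda>r. ennreal (2 * pi * r) * indicator {0..<1} r)" (is "?M = ?N")
proof (rule measure_eqI_lessThan)
  fix x :: real
  have [measurable]: "unit_disc \<in> sets borel" by simp
  have [measurable]: "cmod -` {x<..} \<in> sets borel"
    using measurable_sets_borel[of cmod borel "{x<..}"] by simp
  have "emeasure ?M {x<..} = emeasure lborel (unit_disc \<inter> cmod -` {x<..})"
    by (simp add: emeasure_distr emeasure_density indicator_inter_arith[symmetric])
  also have "\<dots> = ennreal (if x < 0 then pi else if x < 1 then pi * (1 - x\<^sup>2) else 0)"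
  proof -
    have ball: "emeasure lborel (ball (0::complex) r) = ennreal (pi * r\<^sup>2)" if "0 \<le> r" for r
      using emeasure_ball[OF that, of "0::complex"] by (simp add: unit_ball_vol_2)
    have cball: "emeasure lborel (cball (0::complex) r) = ennreal (pi * r\<^sup>2)" if "0 \<le> r" for r
      using emeasure_cball[OF that, of "0::complex"] by (simp add: unit_ball_vol_2)
    consider "x < 0" | "0 \<le> x" "x < 1" | "1 \<le> x" by linarith
    then show ?thesis
    proof cases
      case 1
      then have "unit_disc \<inter> cmod -` {x<..} = unit_disc"
        by (auto intro: less_le_trans[OF _ norm_ge_zero])
      then show ?thesis using 1 ball[of 1] by simp
    next
      case 2
      then have "unit_disc \<inter> cmod -` {x<..} = unit_disc - cball 0 x"
        by auto
      moreover have "emeasure lborel (unit_disc - cball 0 x)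
          = emeasure lborel unit_disc - emeasure lborel (cball (0::complex) x)"
        using 2 by (intro emeasure_Diff) (auto simp: cball)
      ultimately show ?thesis
        using 2 ball[of 1] cball[of x] by (simp add: ennreal_minus algebra_simps)
    next
      case 3
      then have "unit_disc \<inter> cmod -` {x<..} = {}"
        by auto
      then show ?thesis using 3 by simp
    qed
  qed
  finally have M: "emeasure ?M {x<..} = \<dots>" .
  have N: "emeasure ?N {x<..} = (\<integral>\<^sup>+r. ennreal (2 * pi * r) * indicator {max 0 x..1} r \<partial>lborel)"
  proof (subst emeasure_density, simp, simp, rule nn_integral_cong_AE)
    show "AE r in lborel. ennreal (2 * pi * r) * indicator {0..<1} r * indicator {x<..} r
        = ennreal (2 * pi * r) * indicator {max 0 x..1} r"
      using AE_lborel_singleton[of x] AE_lborel_singleton[of 1]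
      by eventually_elim (auto split: split_indicator)
  qed
  have "\<dots> = ennreal (if x < 0 then pi else if x < 1 then pi * (1 - x\<^sup>2) else 0)"
  proof (cases "x < 1")
    case True
    have "(\<integral>\<^sup>+r. ennreal (2 * pi * r) * indicator {max 0 x..1} r \<partial>lborel) = ennreal (pi * 1\<^sup>2 - pi * (max 0 x)\<^sup>2)"
      using True by (intro nn_integral_FTC_Icc) (auto intro!: derivative_eq_intros)
    then show ?thesis
      using True by (auto simp: algebra_simps max_def)
  next
    case False
    then have "(\<integral>\<^sup>+r. ennreal (2 * pi * r) * indicator {max 0 x..1} r \<partial>lborel) = 0"
      using AE_lborel_singleton[of 1]
      by (subst nn_integral_0_iff_AE) (auto split: split_indicator elim!: eventually_mono)
    then show ?thesis using False by simp
  qed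
  with M N show "emeasure ?M {x<..} = emeasure ?N {x<..}" by simp
  show "emeasure ?M {x<..} < \<infinity>"
    using M by simp
qed auto

lemma nn_integral_disc_radial:
  assumes [measurable]: "h \<in> borel_measurable borel"
  shows "(\<integral>\<^sup>+z. h (cmod z) * indicator unit_disc z \<partial>lborel)
       = (\<integral>\<^sup>+r. h r * ennreal (2 * pi * r) * indicator {0..<1} r \<partial>lborel)"
proof -
  have [measurable]: "unit_disc \<in> sets borel" by simp
  have "(\<integral>\<^sup>+z. h (cmod z) * indicator unit_disc z \<partial>lborel)
      = (\<integral>\<^sup>+r. h r \<partial>distr (density lborel (indicator unit_disc)) borel cmod)"
    by (subst nn_integral_distr, simp, simp, subst nn_integral_density) (simp_all add: mult.commute)
  also have "\<dots> = (\<integral>\<^sup>+r. h r * ennreal (2 * pi * r) * indicator {0..<1} r \<partial>lborel)"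
    unfolding distr_disc_cmod by (simp add: nn_integral_density mult_ac)
  finally show ?thesis .
qed

section \<open>Second differences of reciprocal moment sequences\<close>

lemma power_Suc_diff_le:
  fixes x :: real
  assumes "0 \<le> x"
  shows "(x + 1) ^ Suc i - x ^ Suc i \<le> real (Suc i) * (x + 1) ^ i"
proof (induction i)
  case (Suc i)
  have "(x + 1) ^ Suc (Suc i) - x ^ Suc (Suc i) = (x + 1) * ((x + 1) ^ Suc i - x ^ Suc i) + x ^ Suc i"
    by (simp add: algebra_simps)
  also have "\<dots> \<le> (x + 1) * (real (Suc i) * (x + 1) ^ i) + (x + 1) ^ Suc i"
    using assms Suc by (intro add_mono mult_left_mono power_mono) auto
  also have "\<dots> = real (Suc (Suc i)) * (x + 1) ^ Suc i"
    by (simp add: algebra_simps)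
  finally show ?case .
qed simp

text \<open>Both bounds are proved at once by induction on j: summation by parts lowers the
  exponent, and the resulting inequality has the two quantities in question as nonnegative summands
  on its left-hand side, so it yields both.\<close>

lemma sum_power_geometric_le:
  fixes t :: real
  assumes t: "0 \<le> t" "t < 1"
  shows "(1 - t) ^ Suc j * (\<Sum>n<N. (real n + 1) ^ j * t ^ n) \<le> fact j"
    and "(1 - t) ^ j * (real N ^ j * t ^ N) \<le> fact j"
proof -
  have "(1 - t) ^ Suc j * (\<Sum>n<N. (real n + 1) ^ j * t ^ n) \<le> fact j \<and>
        (1 - t) ^ j * (real N ^ j * t ^ N) \<le> fact j" for N
  proof (induction j arbitrary: N)
    case 0
    have "(1 - t) * (\<Sum>n<N. t ^ n) = 1 - t ^ N"
      by (rule one_diff_power_eq[symmetric])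
    with t show ?case by (simp add: power_le_one)
  next
    case (Suc j)
    have parts: "(1 - t) * (\<Sum>n<N. (real n + 1) ^ Suc j * t ^ n) + real N ^ Suc j * t ^ N
        = (\<Sum>n<N. ((real n + 1) ^ Suc j - real n ^ Suc j) * t ^ n)"
    proof (induction N)
      case (Suc N)
      have "(1 - t) * (\<Sum>n<Suc N. (real n + 1) ^ Suc j * t ^ n) + real (Suc N) ^ Suc j * t ^ Suc N
          = ((1 - t) * (\<Sum>n<N. (real n + 1) ^ Suc j * t ^ n) + real N ^ Suc j * t ^ N)
            + ((real N + 1) ^ Suc j - real N ^ Suc j) * t ^ N"
        by (simp add: algebra_simps)
      then show ?case
        unfolding Suc.IH by simp
    qed simp
    also have "\<dots> \<le> (\<Sum>n<N. (real (Suc j) * (real n + 1) ^ j) * t ^ n)"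
      using t by (intro sum_mono mult_right_mono power_Suc_diff_le) auto
    also have "\<dots> = real (Suc j) * (\<Sum>n<N. (real n + 1) ^ j * t ^ n)"
      by (simp only: sum_distrib_left mult.assoc)
    finally have "(1 - t) ^ Suc j * ((1 - t) * (\<Sum>n<N. (real n + 1) ^ Suc j * t ^ n) + real N ^ Suc j * t ^ N)
      \<le> (1 - t) ^ Suc j * (real (Suc j) * (\<Sum>n<N. (real n + 1) ^ j * t ^ n))"
      using t by (intro mult_left_mono) auto
    also have "\<dots> = real (Suc j) * ((1 - t) ^ Suc j * (\<Sum>n<N. (real n + 1) ^ j * t ^ n))"
      by (simp only: mult_ac)
    also have "\<dots> \<le> real (Suc j) * fact j"
      using Suc.IH by (intro mult_left_mono) auto
    finally have le: "(1 - t) ^ Suc j * ((1 - t) * (\<Sum>n<N. (real n + 1) ^ Suc j * t ^ n))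
        + (1 - t) ^ Suc j * (real N ^ Suc j * t ^ N) \<le> fact (Suc j)"
      by (simp only: distrib_left fact_Suc)
    have nonneg: "0 \<le> (1 - t) ^ Suc j * ((1 - t) * (\<Sum>n<N. (real n + 1) ^ Suc j * t ^ n))"
        "0 \<le> (1 - t) ^ Suc j * (real N ^ Suc j * t ^ N)"
      using t by (auto intro!: mult_nonneg_nonneg sum_nonneg)
    have "(1 - t) ^ Suc (Suc j) * (\<Sum>n<N. (real n + 1) ^ Suc j * t ^ n)
      = (1 - t) ^ Suc j * ((1 - t) * (\<Sum>n<N. (real n + 1) ^ Suc j * t ^ n))"
      by (simp only: power_Suc mult_ac)
    then show ?case
      using le nonneg by linarith
  qed
  then show "(1 - t) ^ Suc j * (\<Sum>n<N. (real n + 1) ^ j * t ^ n) \<le> fact j"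
    "(1 - t) ^ j * (real N ^ j * t ^ N) \<le> fact j" by blast+
qed

section \<open>Growth of degree k at the scale 1 / (1 - t)\<close>

context
  fixes t :: real and m k :: nat and Q :: "nat \<Rightarrow> real"
  assumes t: "0 \<le> t" "t < 1" and mt: "1 \<le> (real m + 1) * (1 - t)"
  defines "Q \<equiv> \<lambda>n. 1 + (2 * (real n + 1) / (real m + 1)) ^ k"
begin

text \<open>\<open>Q\<close> is the growth that doubling allows for \<open>b n / b m\<close> (see
  \<open>b_polynomial_growth\<close>). Since m + 1 \<ge> 1 / (1 - t), each power of (n + 1) / (m +
  1) is paid for by a factor 1 - t, so sums with \<open>Q\<close> obey the same bounds as sums
  without it, up to a constant.\<close>

lemma growth_sum_le:
  "(1 - t) ^ Suc j * (\<Sum>n<N. (real n + 1) ^ j * t ^ n * Q n) \<le> fact j + 2 ^ k * fact (k + j)"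
proof -
  have "(1 - t) ^ Suc j * (\<Sum>n<N. (real n + 1) ^ j * t ^ n * Q n)
     = (1 - t) ^ Suc j * (\<Sum>n<N. (real n + 1) ^ j * t ^ n)
       + 2 ^ k / (((real m + 1) * (1 - t)) ^ k)
          * ((1 - t) ^ Suc (k + j) * (\<Sum>n<N. (real n + 1) ^ (k + j) * t ^ n))"
  proof -
    have "(1 - t) ^ Suc j * ((real n + 1) ^ j * t ^ n * Q n)
      = (1 - t) ^ Suc j * ((real n + 1) ^ j * t ^ n)
        + 2 ^ k / (((real m + 1) * (1 - t)) ^ k) * ((1 - t) ^ Suc (k + j) * ((real n + 1) ^ (k + j) * t ^ n))" for n
    proof -
      have "2 ^ k / ((r * s) ^ k) * (s ^ Suc (k + j) * (x ^ (k + j) * T)) = s ^ Suc j * (x ^ j * T) * (2 * x / r) ^ k"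
        if "s \<noteq> 0" "r \<noteq> 0" for r s x T :: real
        using that by (simp add: power_add power_mult_distrib power_divide field_simps)
      from this[of "1 - t" "real m + 1" "real n + 1" "t ^ n"] t show ?thesis
        by (simp add: Q_def distrib_left mult.assoc)
    qed
    then show ?thesis
      by (simp only: sum_distrib_left sum.distrib)
  qed
  also have "\<dots> \<le> fact j + 2 ^ k * fact (k + j)"
  proof (intro add_mono mult_mono sum_power_geometric_le t)
    show "2 ^ k / ((real m + 1) * (1 - t)) ^ k \<le> 2 ^ k"
      using mt by (simp add: divide_le_eq one_le_power)
    show "0 \<le> (1 - t) ^ Suc (k + j) * (\<Sum>n<N. (real n + 1) ^ (k + j) * t ^ n)"
      using t by (intro mult_nonneg_nonneg sum_nonneg) auto
  qed simp
  finally show ?thesis .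
qed

text \<open>Rests on the second bound of \<open>sum_power_geometric_le\<close>. The base 4 comes
  from N + 1 \<le> 2 N, which is why N = 0 is separate.\<close>

lemma growth_power_le: "t ^ N * Q N \<le> 2 + 4 ^ k * fact k"
proof (cases "N = 0")
  case True
  have "(2 / (real m + 1)) ^ k \<le> 2 ^ k"
    by (intro power_mono) (auto simp: field_simps)
  also have "\<dots> \<le> 4 ^ k * fact k"
    using mult_mono[of "2 ^ k" "4 ^ k" 1 "fact k :: real"] by (simp add: power_mono)
  finally show ?thesis
    using True by (simp add: Q_def)
next
  case False
  have "t ^ N * Q N = t ^ N + (2 * (real N + 1) / (real m + 1)) ^ k * t ^ N"
    by (simp add: Q_def algebra_simps)
  also have "(2 * (real N + 1) / (real m + 1)) ^ k * t ^ N \<le> (4 * real N * (1 - t)) ^ k * t ^ N"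
  proof (intro mult_right_mono power_mono)
    have "2 * (real N + 1) / (real m + 1) \<le> 4 * real N * (1 / (real m + 1))"
      using False divide_right_mono[of "2 * (real N + 1)" "4 * real N" "real m + 1"] by simp
    also have "\<dots> \<le> 4 * real N * (1 - t)"
      using mt by (intro mult_left_mono) (auto simp: field_simps)
    finally show "2 * (real N + 1) / (real m + 1) \<le> 4 * real N * (1 - t)" .
  qed (use t in auto)
  also have "\<dots> = 4 ^ k * ((1 - t) ^ k * (real N ^ k * t ^ N))"
    by (simp add: power_mult_distrib)
  also have "\<dots> \<le> 4 ^ k * fact k"
    using t by (intro mult_left_mono sum_power_geometric_le) auto
  finally show ?thesis
    using t power_le_one[of t N] by simp
qed

text \<open>Summation by parts moves the difference from \<beta> to t^n. The factor 1 - t so gained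
  balances the sum of t^n Q n, which is at most of order 1 / (1 - t).\<close>

lemma growth_increments_le:
  assumes \<beta>: "\<And>n. 0 \<le> \<beta> n" "\<And>n. \<beta> n \<le> B * Q n" "\<And>n. \<beta> (Suc n) \<le> B * Q n"
  shows "(\<Sum>n<N. t ^ n * (\<beta> (Suc n) - \<beta> n)) \<le> B * (3 + 2 * 4 ^ k * fact k)"
proof -
  have "0 \<le> B"
  proof -
    have "0 \<le> B * Q 0" using \<beta>(1,2)[of 0] by linarith
    moreover have "0 < Q 0"
      by (simp add: Q_def add_pos_nonneg)
    ultimately show ?thesis by (simp add: zero_le_mult_iff)
  qed
  have "(\<Sum>n<N. t ^ n * (\<beta> (Suc n) - \<beta> n)) = t ^ N * \<beta> N - \<beta> 0 + (1 - t) * (\<Sum>n<N. t ^ n * \<beta> (Suc n))"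
    by (induction N) (auto simp: algebra_simps)
  also have "\<dots> \<le> t ^ N * (B * Q N) - 0 + (1 - t) * (\<Sum>n<N. t ^ n * (B * Q n))"
    using t \<beta> by (intro add_mono diff_mono mult_left_mono sum_mono) auto
  also have "\<dots> = B * (t ^ N * Q N + (1 - t) * (\<Sum>n<N. t ^ n * Q n))"
    by (simp add: algebra_simps sum_distrib_left)
  also have "\<dots> \<le> B * ((2 + 4 ^ k * fact k) + (1 + 2 ^ k * fact k))"
    using growth_power_le[of N] growth_sum_le[of 0 N] \<open>0 \<le> B\<close>
    by (intro mult_left_mono add_mono) auto
  also have "\<dots> \<le> B * (3 + 2 * 4 ^ k * fact k)"
  proof (rule mult_left_mono[OF _ \<open>0 \<le> B\<close>])
    have "(2::real) ^ k * fact k \<le> 4 ^ k * fact k"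
      by (intro mult_right_mono power_mono) auto
    then show "2 + 4 ^ k * fact k + (1 + 2 ^ k * fact k) \<le> 3 + 2 * 4 ^ k * (fact k :: real)"
      by simp
  qed
  finally show ?thesis .
qed

end

section \<open>Reciprocals of doubling convex sequences\<close>

definition diff2 :: "(nat \<Rightarrow> real) \<Rightarrow> nat \<Rightarrow> real" where
  "diff2 a n = a n - 2 * a (Suc n) + a (Suc (Suc n))"

abbreviation diff2_sum :: "(nat \<Rightarrow> real) \<Rightarrow> nat \<Rightarrow> real" where
  "diff2_sum a N \<equiv> (\<Sum>n<N. (real n + 1) * \<bar>diff2 a n\<bar>)"

text \<open>The properties of c_n, twice the moment of order 2n + 1, on which the kernel estimate
  rests. The index 2n + 1 doubles n + 1, the natural scale here, and unlike 2n it gives information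
  at n = 0.\<close>

locale doubling_convex_sequence =
  fixes c :: "nat \<Rightarrow> real" and C :: real
  assumes pos: "\<And>n. 0 < c n"
    and dec: "\<And>n. c (Suc n) \<le> c n"
    and convex: "\<And>n. c (Suc n) - c (Suc (Suc n)) \<le> c n - c (Suc n)"
    and doubling: "\<And>n. c n \<le> C * c (2 * n + 1)"
begin

definition b where "b n = 1 / c n"
definition d where "d n = c n - c (Suc n)"

lemma b_pos: "0 < b n"
  using pos by (simp add: b_def)

lemma b_nonneg: "0 \<le> b n"
  using b_pos less_imp_le by blast

lemma c_mono: "m \<le> n \<Longrightarrow> c n \<le> c m"
  by (rule lift_Suc_antimono_le[of c]) (rule dec)

lemma b_mono: "m \<le> n \<Longrightarrow> b m \<le> b n"
  using c_mono[of m n] pos[of m] pos[of n] by (simp add: b_def frac_le)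

lemma d_nonneg: "0 \<le> d n"
  using dec by (simp add: d_def)

lemma d_mono: "m \<le> n \<Longrightarrow> d n \<le> d m"
  by (rule lift_Suc_antimono_le[of d]) (use convex in \<open>simp add: d_def\<close>)

lemma C_ge_1: "1 \<le> C"
proof -
  have "1 * c 1 \<le> c 0" using dec[of 0] by simp
  also have "\<dots> \<le> C * c 1" using doubling[of 0] by simp
  finally show ?thesis using pos[of 1] by (simp only: mult_le_cancel_right_pos)
qed

lemma b_doubling: "b (2 * n + 1) \<le> C * b n"
  using doubling[of n] pos by (simp add: b_def field_simps)

lemma b_dyadic: "n + 1 \<le> 2 ^ j * (m + 1) \<Longrightarrow> b n \<le> C ^ j * b m"
proof (induction j arbitrary: n)
  case 0
  then show ?case using b_mono[of n m] by simp
next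
  case (Suc j)
  define n' where "n' = n div 2"
  have "b n \<le> b (2 * n' + 1)"
    by (rule b_mono) (simp add: n'_def)
  also have "\<dots> \<le> C * b n'" by (rule b_doubling)
  also have "\<dots> \<le> C * (C ^ j * b m)"
    using Suc C_ge_1 by (intro mult_left_mono) (auto simp: n'_def)
  finally show ?case by simp
qed

text \<open>The least j with n + 1 \<le> 2^j (m + 1) satisfies 2^j \<le> 2 (n + 1) / (m + 1); the
  factor 2 in the bound is this rounding. With C \<le> 2^k the dyadic factor C^j becomes a k-th
  power. The summand 1 covers n \<le> m.\<close>

lemma b_polynomial_growth:
  assumes k: "C \<le> 2 ^ k"
  shows "b n \<le> b m * (1 + (2 * (real n + 1) / (real m + 1)) ^ k)"
proof (cases "n \<le> m")
  case True
  have "b n \<le> b m * 1" using b_mono[OF True] by simp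
  also have "\<dots> \<le> b m * (1 + (2 * (real n + 1) / (real m + 1)) ^ k)"
    using b_pos by (intro mult_left_mono) (auto simp: less_imp_le)
  finally show ?thesis .
next
  case False
  define P where "P j \<longleftrightarrow> n + 1 \<le> 2 ^ j * (m + 1)" for j
  have "n + 1 \<le> 2 ^ (n + 1) * (m + 1)"
    using less_exp[of "n + 1"] by (metis le_add2 less_imp_le_nat mult_le_mono mult.right_neutral)
  then have "P (n + 1)" by (simp add: P_def)
  define j where "j = (LEAST j. P j)"
  have "P j" unfolding j_def by (rule LeastI) fact
  have "j \<noteq> 0" using False \<open>P j\<close> by (auto simp: P_def intro!: gr0I)
  then have "\<not> P (j - 1)"
    unfolding j_def by (intro not_less_Least) (auto simp: j_def)
  then have "2 ^ (j - 1) * (m + 1) < n + 1" by (simp add: P_def)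
  moreover have "(2::nat) ^ j = 2 * 2 ^ (j - 1)"
    using \<open>j \<noteq> 0\<close> by (simp flip: power_Suc)
  ultimately have "2 ^ j * (m + 1) \<le> 2 * (n + 1)" by simp
  then have "real (2 ^ j * (m + 1)) \<le> real (2 * (n + 1))"
    by (rule of_nat_mono)
  then have j: "2 ^ j \<le> 2 * (real n + 1) / (real m + 1)"
    by (simp add: field_simps)
  have "b n \<le> C ^ j * b m" using \<open>P j\<close> by (intro b_dyadic) (simp add: P_def)
  also have "\<dots> \<le> (2 ^ k) ^ j * b m"
    using k C_ge_1 b_pos[of m] by (intro mult_right_mono power_mono) auto
  also have "\<dots> = b m * (2 ^ j) ^ k"
    by (simp add: mult.commute flip: power_mult)
  also have "\<dots> \<le> b m * (2 * (real n + 1) / (real m + 1)) ^ k"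
    using j b_pos[of m] by (intro mult_left_mono power_mono) auto
  also have "\<dots> \<le> b m * (1 + (2 * (real n + 1) / (real m + 1)) ^ k)"
    using b_pos[of m] by (intro mult_left_mono) auto
  finally show ?thesis .
qed

text \<open>The analogue of s c'(s) = O(c(s)). As \<open>d\<close> decreases, \<open>d n\<close> is
  at most its mean over the upper half h..n, and that sum telescopes to less than
  \<open>c h\<close>, which doubling compares with \<open>c (Suc n)\<close>.\<close>

lemma d_le: "(real n + 1) * d n * b (Suc n) \<le> 2 * C"
proof -
  define h where "h = (n + 1) div 2"
  have tel: "(\<Sum>i=h..<n+1. d i) = c h - c (n + 1)"
  proof -
    have "h \<le> n + 1" by (simp add: h_def)
    then show ?thesis
      unfolding d_def using sum_Suc_diff'[of h "n + 1" c] by (simp add: sum_subtractf)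
  qed
  have "real (n + 1 - h) * d n = (\<Sum>i=h..<n+1. d n)" by simp
  also have "\<dots> \<le> (\<Sum>i=h..<n+1. d i)"
    by (intro sum_mono d_mono) simp
  also have "\<dots> \<le> c h" unfolding tel using pos[of "n + 1"] by simp
  also have "\<dots> \<le> C * c (2 * h + 1)" by (rule doubling)
  also have "\<dots> \<le> C * c (Suc n)"
    using C_ge_1 by (intro mult_left_mono c_mono) (auto simp: h_def)
  finally have "real (n + 1 - h) * d n \<le> C * c (Suc n)" .
  moreover have "(real n + 1) / 2 \<le> real (n + 1 - h)"
    by (simp add: h_def)
  then have "(real n + 1) / 2 * d n \<le> real (n + 1 - h) * d n"
    by (rule mult_right_mono[OF _ d_nonneg])
  ultimately have "(real n + 1) * d n \<le> 2 * C * c (Suc n)" by linarith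
  then show ?thesis using pos[of "Suc n"] by (simp add: b_def field_simps)
qed

lemma d_le': "(real n + 1) * d n * b n \<le> 2 * C"
proof -
  have "(real n + 1) * d n * b n \<le> (real n + 1) * d n * b (Suc n)"
    using d_nonneg b_mono[of n "Suc n"] by (intro mult_left_mono) auto
  with d_le[of n] show ?thesis by linarith
qed

lemma b_increment: "b (Suc n) - b n = d n * b n * b (Suc n)"
  using pos[of n] pos[of "Suc n"] by (simp add: b_def d_def field_simps)

text \<open>A discrete quotient rule. By convexity of \<open>c\<close> both terms of the difference
  have a fixed sign, so no absolute value is left on \<open>d n - d (Suc n)\<close>, which can then
  be summed by parts.\<close>

lemma diff2_b:
  "\<bar>diff2 b n\<bar> \<le> d (Suc n) * b (Suc n) * (b (Suc (Suc n)) - b n) + b n * b (Suc n) * (d n - d (Suc n))"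
proof -
  have "diff2 b n = (b (Suc (Suc n)) - b (Suc n)) - (b (Suc n) - b n)"
    by (simp add: diff2_def)
  also have "\<dots> = d (Suc n) * b (Suc n) * (b (Suc (Suc n)) - b n) - b n * b (Suc n) * (d n - d (Suc n))"
    unfolding b_increment by (simp add: algebra_simps)
  finally have "diff2 b n = \<dots>" .
  moreover have "0 \<le> d (Suc n) * b (Suc n) * (b (Suc (Suc n)) - b n)"
    using d_nonneg b_nonneg b_mono[of n "Suc (Suc n)"] by simp
  moreover have "0 \<le> b n * b (Suc n) * (d n - d (Suc n))"
    using b_nonneg d_mono[of n "Suc n"] by simp
  ultimately show ?thesis by linarith
qed

text \<open>The increments of \<open>d\<close> are controlled only in sum, not one by one. Summation
  by parts moves the difference to the weight, and the factor \<open>d n\<close> left over is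
  controlled by \<open>d_le'\<close>.\<close>

lemma sum_diff2_d_le:
  assumes t: "0 \<le> t" "t < 1"
  shows "(\<Sum>n<N. (real n + 1) * t ^ n * (b n * b (Suc n) * (d n - d (Suc n))))
    \<le> (\<Sum>n<N. t ^ n * (b (Suc n) - b n)) + 2 * C * (\<Sum>n<N. t ^ n * (b (Suc (Suc n)) - b n))"
proof -
  \<comment> \<open>Shifted so that \<open>G (Suc n)\<close> is the weight of the sum. The truncated
    \<open>n - 1\<close> at n = 0 is harmless since the factor \<open>real n\<close> makes
    \<open>G 0 = 0\<close>.\<close>
  define G where "G n = real n * t ^ (n - 1) * b (n - 1) * b n" for n
  have "(\<Sum>n<N. (real n + 1) * t ^ n * (b n * b (Suc n) * (d n - d (Suc n))))
     = (\<Sum>n<N. G (Suc n) * (d n - d (Suc n)))"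
    by (simp add: G_def algebra_simps)
  also have "\<dots> = (\<Sum>n<N. d n * (G (Suc n) - G n)) - G N * d N"
    by (induction N) (simp_all add: G_def algebra_simps)
  also have "\<dots> \<le> (\<Sum>n<N. d n * (G (Suc n) - G n))"
    using t d_nonneg b_nonneg by (simp add: G_def)
  also have "\<dots> \<le> (\<Sum>n<N. t ^ n * (b (Suc n) - b n)
      + (if n = 0 then 0 else 2 * C * (t ^ (n - 1) * (b (Suc n) - b (n - 1)))))"
  proof (rule sum_mono)
    fix n
    show "d n * (G (Suc n) - G n) \<le> t ^ n * (b (Suc n) - b n)
      + (if n = 0 then 0 else 2 * C * (t ^ (n - 1) * (b (Suc n) - b (n - 1))))"
    proof (cases n)
      case 0
      then show ?thesis by (simp add: G_def b_increment)
    next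
      case (Suc i)
      \<comment> \<open>Lowering \<open>G n\<close> in this way gives both terms of
        \<open>G (Suc n) - G n\<close> the same power of t, so that beside one product of
        neighbouring values only an increment of \<open>b\<close> remains.\<close>
      have "t ^ n \<le> t ^ i" using t Suc by (simp add: mult_left_le_one_le)
      then have "G n \<ge> real n * t ^ n * b i * b n"
        using b_pos by (auto simp: G_def Suc intro!: mult_right_mono mult_left_mono less_imp_le simp del: power_Suc)
      then have "G (Suc n) - G n \<le> t ^ n * (b n * b (Suc n)) + real n * b n * t ^ n * (b (Suc n) - b i)"
        by (simp add: G_def algebra_simps)
      then have "d n * (G (Suc n) - G n) \<le> d n * (t ^ n * (b n * b (Suc n)) + real n * b n * t ^ n * (b (Suc n) - b i))"
        using d_nonneg by (rule mult_left_mono)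
      also have "\<dots> = t ^ n * (b (Suc n) - b n) + (real n * d n * b n) * (t ^ n * (b (Suc n) - b i))"
        unfolding b_increment[of n] by (simp add: algebra_simps)
      also have "(real n * d n * b n) * (t ^ n * (b (Suc n) - b i)) \<le> 2 * C * (t ^ i * (b (Suc n) - b i))"
      proof (rule mult_mono)
        have "real n * d n * b n \<le> (real n + 1) * d n * b n"
          using d_nonneg[of n] b_pos[of n] by (intro mult_right_mono) auto
        then show "real n * d n * b n \<le> 2 * C" using d_le'[of n] by linarith
        have inc: "0 \<le> b (Suc n) - b i" using b_mono[of i "Suc n"] Suc by simp
        then show "0 \<le> t ^ n * (b (Suc n) - b i)" using t by simp
        show "t ^ n * (b (Suc n) - b i) \<le> t ^ i * (b (Suc n) - b i)"
          using \<open>t ^ n \<le> t ^ i\<close> inc by (rule mult_right_mono)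
      qed (use C_ge_1 in auto)
      finally show ?thesis using Suc by simp
    qed
  qed
  also have "\<dots> \<le> (\<Sum>n<N. t ^ n * (b (Suc n) - b n)) + 2 * C * (\<Sum>n<N. t ^ n * (b (Suc (Suc n)) - b n))"
  proof -
    have nonneg: "0 \<le> t ^ n * (b (Suc (Suc n)) - b n)" for n
      using t b_mono[of n "Suc (Suc n)"] by simp
    have "(\<Sum>n<N. if n = 0 then 0 else t ^ (n - 1) * (b (Suc n) - b (n - 1)))
      \<le> (\<Sum>n<N. t ^ n * (b (Suc (Suc n)) - b n))"
    proof (cases N)
      case (Suc M)
      have "(\<Sum>n<N. if n = 0 then 0 else t ^ (n - 1) * (b (Suc n) - b (n - 1)))
        = (\<Sum>n<M. t ^ n * (b (Suc (Suc n)) - b n))"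
        unfolding Suc by (subst sum.lessThan_Suc_shift) simp
      also have "\<dots> \<le> (\<Sum>n<N. t ^ n * (b (Suc (Suc n)) - b n))"
        unfolding Suc using nonneg by simp
      finally show ?thesis .
    qed simp
    then have "2 * C * (\<Sum>n<N. if n = 0 then 0 else t ^ (n - 1) * (b (Suc n) - b (n - 1)))
      \<le> 2 * C * (\<Sum>n<N. t ^ n * (b (Suc (Suc n)) - b n))"
      using C_ge_1 by (intro mult_left_mono) auto
    then show ?thesis
      by (simp add: sum.distrib sum_distrib_left if_distrib[of "(*) _"] cong: if_cong)
  qed
  finally show ?thesis .
qed

lemma diff2_product:
  "diff2 (\<lambda>n. t ^ n * b n) n
    = t ^ n * (1 - t)\<^sup>2 * b n - 2 * t ^ Suc n * (1 - t) * (b (Suc n) - b n) + t ^ Suc (Suc n) * diff2 b n"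
  by (simp add: diff2_def power2_eq_square algebra_simps)

text \<open>The three terms of the discrete Leibniz rule \<open>diff2_product\<close> are estimated
  separately: the one with (1 - t)^2 by power sums, the mixed one by \<open>d_le\<close>, and the
  one with \<open>diff2 b\<close> by increments of \<open>b\<close>. The condition on m fixes a
  scale m + 1 \<ge> 1 / (1 - t) at which \<open>c\<close> is evaluated.\<close>

proposition sum_diff2_le:
  "\<exists>A. \<forall>t m N. 0 \<le> t \<longrightarrow> t < 1 \<longrightarrow> 1 \<le> (real m + 1) * (1 - t) \<longrightarrow>
     diff2_sum (\<lambda>n. t ^ n / c n) N \<le> A / c m"
proof -
  obtain k where k: "C \<le> 2 ^ k"
    using real_arch_pow[of 2 C] by (auto intro: less_imp_le)
  define E where "E = (3 + 2 * 4 ^ k * fact k :: real)"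
  \<comment> \<open>In order: the constants of \<open>S1\<close>, of \<open>S2\<close>, and the two
    parts of \<open>S3\<close>, one for each term of \<open>diff2_b\<close>.\<close>
  define A where "A = (1 + 2 ^ k * fact (k + 1)) + 4 * C * (1 + 2 ^ k * fact k) + 2 * C * (2 * C\<^sup>2 * E)
    + (C\<^sup>2 * E + 2 * C * (2 * C\<^sup>2 * E))"
  have "diff2_sum (\<lambda>n. t ^ n / c n) N \<le> A / c m"
    if t: "0 \<le> t" "t < 1" and mt: "1 \<le> (real m + 1) * (1 - t)" for t m N
  proof -
    define Q where "Q n = 1 + (2 * (real n + 1) / (real m + 1)) ^ k" for n
    have bQ: "b n \<le> b m * Q n" for n
      unfolding Q_def by (rule b_polynomial_growth[OF k])
    \<comment> \<open>Up to two extra steps in the index cost C^2 because n + 3 \<le> 4 (n +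
      1).\<close>
    have shift: "b (n + i) \<le> b m * C\<^sup>2 * Q n" if "i \<le> 2" for n i
    proof -
      have "b (n + i) \<le> C ^ 2 * b n" using that by (intro b_dyadic) simp
      also have "\<dots> \<le> C\<^sup>2 * (b m * Q n)" using bQ by (intro mult_left_mono) auto
      finally show ?thesis by (simp add: mult_ac)
    qed
    note gs = growth_sum_le[OF t mt, of _ k N, folded Q_def]
    have inc0: "(\<Sum>n<N. t ^ n * (b (Suc n) - b n)) \<le> b m * C\<^sup>2 * E"
      unfolding E_def
      by (rule growth_increments_le[OF t mt, of _ _ k, folded Q_def])
        (use b_pos shift[of 0] shift[of 1] in \<open>auto intro: less_imp_le\<close>)
    have inc1: "(\<Sum>n<N. t ^ n * (b (Suc (Suc n)) - b (Suc n))) \<le> b m * C\<^sup>2 * E"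
      unfolding E_def
      by (rule growth_increments_le[OF t mt, of "\<lambda>n. b (Suc n)" _ k, folded Q_def])
        (use b_pos shift[of 1] shift[of 2] in \<open>auto intro: less_imp_le\<close>)
    have inc: "(\<Sum>n<N. t ^ n * (b (Suc (Suc n)) - b n)) \<le> 2 * (b m * C\<^sup>2 * E)"
    proof -
      have "(\<Sum>n<N. t ^ n * (b (Suc (Suc n)) - b n))
        = (\<Sum>n<N. t ^ n * (b (Suc (Suc n)) - b (Suc n))) + (\<Sum>n<N. t ^ n * (b (Suc n) - b n))"
        by (simp add: sum.distrib[symmetric] algebra_simps)
      with inc0 inc1 show ?thesis by simp
    qed
    have S1: "(\<Sum>n<N. (real n + 1) * (t ^ n * (1 - t)\<^sup>2 * b n)) \<le> b m * (1 + 2 ^ k * fact (k + 1))"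
    proof -
      have "(\<Sum>n<N. (real n + 1) * (t ^ n * (1 - t)\<^sup>2 * b n))
        \<le> (\<Sum>n<N. (real n + 1) * (t ^ n * (1 - t)\<^sup>2 * (b m * Q n)))"
        using t bQ by (intro sum_mono mult_left_mono) auto
      also have "\<dots> = b m * ((1 - t) ^ Suc 1 * (\<Sum>n<N. (real n + 1) ^ 1 * t ^ n * Q n))"
        by (simp add: sum_distrib_left power2_eq_square mult_ac)
      also have "\<dots> \<le> b m * (fact 1 + 2 ^ k * fact (k + 1))"
        using b_nonneg gs[of 1] by (intro mult_left_mono)
      finally show ?thesis by simp
    qed
    have S2: "(\<Sum>n<N. (real n + 1) * (2 * t ^ Suc n * (1 - t) * (b (Suc n) - b n)))
      \<le> b m * (4 * C * (1 + 2 ^ k * fact k))"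
    proof -
      have "(real n + 1) * (2 * t ^ Suc n * (1 - t) * (b (Suc n) - b n)) \<le> 4 * C * (1 - t) * (t ^ n * (b m * Q n))" for n
      proof -
        have "(real n + 1) * (b (Suc n) - b n) = ((real n + 1) * d n * b (Suc n)) * b n"
          by (simp add: b_increment)
        also have "\<dots> \<le> 2 * C * (b m * Q n)"
          using C_ge_1 by (intro mult_mono[OF d_le bQ] b_nonneg) auto
        finally have le: "(real n + 1) * (b (Suc n) - b n) \<le> 2 * C * (b m * Q n)" .
        have "2 * (1 - t) * t ^ Suc n \<le> 2 * (1 - t) * t ^ n"
          using t by (intro mult_left_mono) (auto simp: mult_left_le_one_le)
        from mult_mono[OF this le]
        have "2 * (1 - t) * t ^ Suc n * ((real n + 1) * (b (Suc n) - b n))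
            \<le> 2 * (1 - t) * t ^ n * (2 * C * (b m * Q n))"
          using t b_mono[of n "Suc n"] by simp
        then show ?thesis by (simp only: mult_ac)
      qed
      then have "(\<Sum>n<N. (real n + 1) * (2 * t ^ Suc n * (1 - t) * (b (Suc n) - b n)))
          \<le> (\<Sum>n<N. 4 * C * (1 - t) * (t ^ n * (b m * Q n)))"
        by (rule sum_mono)
      also have "\<dots> = b m * (4 * C * ((1 - t) ^ Suc 0 * (\<Sum>n<N. (real n + 1) ^ 0 * t ^ n * Q n)))"
        by (simp only: power_Suc power_0 mult_1_left mult_1_right sum_distrib_left mult_ac)
      also have "\<dots> \<le> b m * (4 * C * (fact 0 + 2 ^ k * fact (k + 0)))"
        using b_nonneg C_ge_1 by (intro mult_left_mono gs) auto
      finally show ?thesis by simp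
    qed
    have S3: "(\<Sum>n<N. (real n + 1) * (t ^ Suc (Suc n) * \<bar>diff2 b n\<bar>))
      \<le> b m * (2 * C * (2 * C\<^sup>2 * E) + (C\<^sup>2 * E + 2 * C * (2 * C\<^sup>2 * E)))"
    proof -
      have "(real n + 1) * (t ^ Suc (Suc n) * \<bar>diff2 b n\<bar>)
        \<le> 2 * C * (t ^ n * (b (Suc (Suc n)) - b n))
          + (real n + 1) * t ^ n * (b n * b (Suc n) * (d n - d (Suc n)))" for n
      proof -
        have "(real n + 1) * (t ^ Suc (Suc n) * \<bar>diff2 b n\<bar>)
          \<le> (real n + 1) * (t ^ n * (d (Suc n) * b (Suc n) * (b (Suc (Suc n)) - b n) + b n * b (Suc n) * (d n - d (Suc n))))"
          using t diff2_b by (intro mult_left_mono mult_mono power_decreasing) auto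
        also have "\<dots> = ((real n + 1) * d (Suc n) * b (Suc n)) * (t ^ n * (b (Suc (Suc n)) - b n))
          + (real n + 1) * t ^ n * (b n * b (Suc n) * (d n - d (Suc n)))"
          by (simp add: algebra_simps)
        also have "((real n + 1) * d (Suc n) * b (Suc n)) * (t ^ n * (b (Suc (Suc n)) - b n))
          \<le> 2 * C * (t ^ n * (b (Suc (Suc n)) - b n))"
        proof (rule mult_right_mono)
          have "(real n + 1) * d (Suc n) * b (Suc n) \<le> (real (Suc n) + 1) * d (Suc n) * b (Suc n)"
            using d_nonneg[of "Suc n"] b_pos[of "Suc n"] by (intro mult_right_mono) auto
          then show "(real n + 1) * d (Suc n) * b (Suc n) \<le> 2 * C" using d_le'[of "Suc n"] by linarith
          show "0 \<le> t ^ n * (b (Suc (Suc n)) - b n)" using t b_mono[of n "Suc (Suc n)"] by simp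
        qed
        finally show ?thesis by simp
      qed
      then have "(\<Sum>n<N. (real n + 1) * (t ^ Suc (Suc n) * \<bar>diff2 b n\<bar>))
        \<le> (\<Sum>n<N. 2 * C * (t ^ n * (b (Suc (Suc n)) - b n))
          + (real n + 1) * t ^ n * (b n * b (Suc n) * (d n - d (Suc n))))"
        by (rule sum_mono)
      also have "\<dots> = 2 * C * (\<Sum>n<N. t ^ n * (b (Suc (Suc n)) - b n))
        + (\<Sum>n<N. (real n + 1) * t ^ n * (b n * b (Suc n) * (d n - d (Suc n))))"
        by (simp add: sum.distrib sum_distrib_left)
      also have "\<dots> \<le> 2 * C * (2 * (b m * C\<^sup>2 * E)) + (b m * C\<^sup>2 * E + 2 * C * (2 * (b m * C\<^sup>2 * E)))"
      proof -
        have "2 * C * (\<Sum>n<N. t ^ n * (b (Suc (Suc n)) - b n)) \<le> 2 * C * (2 * (b m * C\<^sup>2 * E))"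
          using C_ge_1 inc by (intro mult_left_mono) auto
        with sum_diff2_d_le[OF t, of N] inc0 show ?thesis by linarith
      qed
      also have "\<dots> = b m * (2 * C * (2 * C\<^sup>2 * E) + (C\<^sup>2 * E + 2 * C * (2 * C\<^sup>2 * E)))"
        by (simp add: algebra_simps)
      finally show ?thesis .
    qed
    have "diff2_sum (\<lambda>n. t ^ n / c n) N
      = diff2_sum (\<lambda>n. t ^ n * b n) N"
      by (simp add: b_def)
    also have "\<dots> \<le> (\<Sum>n<N. (real n + 1) * (t ^ n * (1 - t)\<^sup>2 * b n)
        + (real n + 1) * (2 * t ^ Suc n * (1 - t) * (b (Suc n) - b n))
        + (real n + 1) * (t ^ Suc (Suc n) * \<bar>diff2 b n\<bar>))"
    proof (rule sum_mono)
      fix n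
      have "0 \<le> t ^ n * (1 - t)\<^sup>2 * b n" "0 \<le> 2 * t ^ Suc n * (1 - t) * (b (Suc n) - b n)"
        "\<bar>t ^ Suc (Suc n) * diff2 b n\<bar> = t ^ Suc (Suc n) * \<bar>diff2 b n\<bar>"
        using t b_pos[of n] b_mono[of n "Suc n"] by (auto simp: abs_mult)
      then have "\<bar>diff2 (\<lambda>n. t ^ n * b n) n\<bar> \<le> t ^ n * (1 - t)\<^sup>2 * b n
          + 2 * t ^ Suc n * (1 - t) * (b (Suc n) - b n) + t ^ Suc (Suc n) * \<bar>diff2 b n\<bar>"
        unfolding diff2_product by linarith
      then have "(real n + 1) * \<bar>diff2 (\<lambda>n. t ^ n * b n) n\<bar> \<le> (real n + 1) * (t ^ n * (1 - t)\<^sup>2 * b n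
          + 2 * t ^ Suc n * (1 - t) * (b (Suc n) - b n) + t ^ Suc (Suc n) * \<bar>diff2 b n\<bar>)"
        by (rule mult_left_mono) simp
      then show "(real n + 1) * \<bar>diff2 (\<lambda>n. t ^ n * b n) n\<bar>
        \<le> (real n + 1) * (t ^ n * (1 - t)\<^sup>2 * b n)
        + (real n + 1) * (2 * t ^ Suc n * (1 - t) * (b (Suc n) - b n))
        + (real n + 1) * (t ^ Suc (Suc n) * \<bar>diff2 b n\<bar>)"
        by (simp only: distrib_left)
    qed
    also have "\<dots> \<le> b m * (1 + 2 ^ k * fact (k + 1)) + b m * (4 * C * (1 + 2 ^ k * fact k))
       + b m * (2 * C * (2 * C\<^sup>2 * E) + (C\<^sup>2 * E + 2 * C * (2 * C\<^sup>2 * E)))"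
      using S1 S2 S3 by (simp only: sum.distrib)
    also have "\<dots> = A / c m"
      unfolding A_def b_def by (simp add: distrib_left distrib_right add_divide_distrib)
    finally show ?thesis .
  qed
  then show ?thesis by blast
qed

end

section \<open>The M. Riesz inequality on the circle\<close>

lemma powr_tangent_le:
  fixes x c p :: real
  assumes "1 < p" "0 \<le> x" "0 \<le> c"
  shows "p * (x * c powr (p - 1)) \<le> x powr p + (p - 1) * c powr p"
proof -
  define q where "q = p / (p - 1)"
  have q: "1 < q" "1 / p + 1 / q = 1" "(p - 1) * q = p" "p / q = p - 1"
    using assms by (auto simp: q_def field_simps)
  have "x * c powr (p - 1) \<le> x powr p / p + (c powr (p - 1)) powr q / q"
    using assms q by (intro Youngs_inequality) auto
  then have "p * (x * c powr (p - 1)) \<le> p * (x powr p / p + c powr p / q)"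
    using assms q by (intro mult_left_mono) (auto simp: powr_powr)
  also have "\<dots> = x powr p + (p / q) * c powr p"
    using assms by (simp add: distrib_left)
  finally show ?thesis by (simp add: q(4))
qed

text \<open>The tangent inequality at c = y / W, integrated against w; this c is the w-mean of X
  when both integral hypotheses are equalities. As W need only dominate the mass and y need only be
  dominated by the integral, estimates can be inserted directly: on the circle, over indices with
  counting measure, and on the disc.\<close>

lemma weighted_Jensen_powr:
  fixes X w :: "'a \<Rightarrow> real"
  assumes [measurable]: "X \<in> borel_measurable M" "w \<in> borel_measurable M"
    and nonneg: "\<And>x. 0 \<le> X x" "\<And>x. 0 \<le> w x" "0 \<le> W" "0 \<le> y"
    and p: "1 < p"
    and W: "(\<integral>\<^sup>+x. ennreal (w x) \<partial>M) \<le> ennreal W"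
    and y: "ennreal y \<le> (\<integral>\<^sup>+x. ennreal (X x * w x) \<partial>M)"
  shows "ennreal (y powr p) \<le> ennreal (W powr (p - 1)) * (\<integral>\<^sup>+x. ennreal (X x powr p * w x) \<partial>M)"
proof -
  define I where "I = (\<integral>\<^sup>+x. ennreal (X x powr p * w x) \<partial>M)"
  have "I < \<infinity> \<or> I = \<infinity>"
    by (metis infinity_ennreal_def top.not_eq_extremum)
  moreover have "y = 0 \<or> 0 < y" "W = 0 \<or> 0 < W"
    using nonneg(3,4) by linarith+
  ultimately consider "y = 0" | "W = 0" | "0 < W" "I = \<infinity>" | "0 < y" "0 < W" "I < \<infinity>"
    by blast
  then show ?thesis
  proof cases
    case 1
    then show ?thesis by simp
  next
    case 2
    with W have "(\<integral>\<^sup>+x. ennreal (w x) \<partial>M) = 0" by simp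
    then have "AE x in M. ennreal (w x) = 0"
      by (subst (asm) nn_integral_0_iff_AE) auto
    then have "AE x in M. ennreal (X x * w x) = 0"
      by eventually_elim (use nonneg in auto)
    then have "(\<integral>\<^sup>+x. ennreal (X x * w x) \<partial>M) = 0"
      by (subst nn_integral_0_iff_AE) auto
    with y nonneg have "y = 0" by simp
    then show ?thesis by simp
  next
    case 3
    then show ?thesis by (simp add: I_def ennreal_mult_eq_top_iff ennreal_top_mult)
  next
    case 4
    then obtain i where i: "I = ennreal i" "0 \<le> i"
      by (cases I) auto
    define c where "c = y / W"
    have c: "0 < c" using 4 by (simp add: c_def)
    have "ennreal (p * c powr (p - 1) * y) = ennreal (p * c powr (p - 1)) * ennreal y"
      using c p by (intro ennreal_mult) (use nonneg in auto)
    also have "\<dots> \<le> ennreal (p * c powr (p - 1)) * (\<integral>\<^sup>+x. ennreal (X x * w x) \<partial>M)"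
      by (intro mult_left_mono y) simp
    also have "\<dots> = (\<integral>\<^sup>+x. ennreal (p * c powr (p - 1)) * ennreal (X x * w x) \<partial>M)"
      by (rule nn_integral_cmult[symmetric]) simp
    also have "\<dots> \<le> (\<integral>\<^sup>+x. ennreal (X x powr p * w x) + ennreal ((p - 1) * c powr p) * ennreal (w x) \<partial>M)"
    proof (rule nn_integral_mono)
      fix x
      have "p * c powr (p - 1) * (X x * w x) = p * (X x * c powr (p - 1)) * w x" by simp
      also have "\<dots> \<le> (X x powr p + (p - 1) * c powr p) * w x"
        using powr_tangent_le[OF p nonneg(1) less_imp_le[OF c]] nonneg by (intro mult_right_mono) auto
      finally have "ennreal (p * c powr (p - 1) * (X x * w x))
          \<le> ennreal (X x powr p * w x + (p - 1) * c powr p * w x)"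
        by (intro ennreal_leI) (simp add: algebra_simps)
      then show "ennreal (p * c powr (p - 1)) * ennreal (X x * w x)
          \<le> ennreal (X x powr p * w x) + ennreal ((p - 1) * c powr p) * ennreal (w x)"
        using p c nonneg by (simp add: ennreal_mult' ennreal_plus)
    qed
    also have "\<dots> = I + ennreal ((p - 1) * c powr p) * (\<integral>\<^sup>+x. ennreal (w x) \<partial>M)"
      by (simp add: I_def nn_integral_add nn_integral_cmult)
    also have "\<dots> \<le> I + ennreal ((p - 1) * c powr p) * ennreal W"
      by (intro add_left_mono mult_left_mono W) simp
    also have "\<dots> = ennreal (i + (p - 1) * c powr p * W)"
      using i p nonneg by (simp add: ennreal_mult ennreal_plus)
    finally have "p * c powr (p - 1) * y \<le> i + (p - 1) * c powr p * W"
      using i p nonneg by (subst (asm) ennreal_le_iff) auto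
    moreover
    have "c powr p * W = c powr (p - 1) * y"
      using 4 c by (simp add: c_def powr_diff)
    then have "(p - 1) * c powr p * W = (p - 1) * (c powr (p - 1) * y)" by simp
    ultimately have "c powr (p - 1) * y \<le> i"
      by (simp add: algebra_simps)
    then have "W powr (p - 1) * (c powr (p - 1) * y) \<le> W powr (p - 1) * i"
      by (intro mult_left_mono) auto
    moreover have "W powr (p - 1) * (c powr (p - 1) * y) = y powr p"
      using 4 by (simp add: c_def powr_divide powr_diff)
    ultimately have "ennreal (y powr p) \<le> ennreal (W powr (p - 1) * i)"
      by (intro ennreal_leI) simp
    then show ?thesis
      using i by (simp add: I_def ennreal_mult')
  qed
qed

text \<open>Normalised arc length, as a Borel measure on the whole plane: integrands need no
  restriction to the circle, at the price that |u| = 1 holds only almost everywhere.\<close>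

definition circ :: "complex measure" where
  "circ = distr (restrict_space lborel {0..1}) borel (\<lambda>t::real. exp (2 * of_real pi * \<i> * of_real t))"

abbreviation lp_power :: "complex measure \<Rightarrow> real \<Rightarrow> (complex \<Rightarrow> complex) \<Rightarrow> ennreal" where
  "lp_power M p f \<equiv> (\<integral>\<^sup>+z. ennreal (cmod (f z) powr p) \<partial>M)"

abbreviation unit_circle :: "complex set" where
  "unit_circle \<equiv> sphere 0 1"

lemma sets_circ [simp, measurable_cong]: "sets circ = sets borel"
  by (simp add: circ_def)

lemma space_circ [simp]: "space circ = UNIV"
  by (simp add: circ_def)

lemma measurable_circle_param [measurable]:
  "(\<lambda>t::real. exp (2 * of_real pi * \<i> * of_real t :: complex)) \<in> borel_measurable (restrict_space lborel {0..1})"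
  by (intro measurable_restrict_space1) measurable

lemma emeasure_circ: "emeasure circ UNIV = 1"
  unfolding circ_def
  by (subst emeasure_distr) (auto simp: emeasure_restrict_space space_restrict_space)

lemma finite_circ: "finite_measure circ"
  by (rule finite_measureI) (simp add: emeasure_circ)

interpretation circle: finite_measure circ
  by (rule finite_circ)

interpretation circle_pair: pair_sigma_finite circ circ ..

lemma AE_circ: "AE u in circ. cmod u = 1"
  unfolding circ_def by (subst AE_distr_iff) (auto simp: norm_exp)

lemma AE_unit_circle: "AE u in circ. u \<in> unit_circle"
  using AE_circ by simp

lemma integrable_circle_continuous:
  fixes f :: "complex \<Rightarrow> 'b::euclidean_space"
  assumes f: "continuous_on unit_circle f"
  shows "integrable circ (\<lambda>u. indicator unit_circle u *\<^sub>R f u)"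
proof -
  have "compact (f ` unit_circle)"
    using f by (intro compact_continuous_image) auto
  then obtain B where B: "\<And>u. u \<in> unit_circle \<Longrightarrow> norm (f u) \<le> B"
    by (meson bounded_iff compact_imp_bounded imageI)
  have "(\<lambda>u. indicator unit_circle u *\<^sub>R f u) \<in> borel_measurable borel"
    using f by (intro borel_measurable_continuous_on_indicator) auto
  then show ?thesis
    using B by (intro circle.integrable_const_bound[where B = "max 0 B"])
      (auto intro!: AE_I2 split: split_indicator simp: le_max_iff_disj)
qed

text \<open>The mean value property, from Cauchy's formula at 0, where dz / z becomes 2 pi i dt. The
  indicator secures measurability, since nothing is known about F off the closed disc.\<close>

lemma integral_circle_holomorphic:
  assumes F: "F holomorphic_on cball 0 1"
  shows "(LINT u|circ. indicator unit_circle u *\<^sub>R F u) = F 0"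
proof -
  define e where "e = (\<lambda>t::real. exp (2 * of_real pi * \<i> * of_real t) :: complex)"
  have e: "e t \<in> unit_circle" "e t \<noteq> 0" for t by (auto simp: e_def norm_exp)
  have contF: "continuous_on unit_circle F"
    using F by (intro continuous_on_subset[OF holomorphic_on_imp_continuous_on[OF F]]) auto
  have "((\<lambda>u. F u / (u - 0)) has_contour_integral (2 * of_real pi * \<i> * F 0)) (circlepath 0 1)"
    using F by (intro Cauchy_integral_circlepath_simple) auto
  then have "((\<lambda>t. F (circlepath 0 1 t) / (circlepath 0 1 t - 0) *
      vector_derivative (circlepath 0 1) (at t within {0..1})) has_integral (2 * of_real pi * \<i> * F 0)) {0..1}"
    by (simp add: has_contour_integral_def)
  then have "((\<lambda>t. (2 * of_real pi * \<i>) * F (e t)) has_integral (2 * of_real pi * \<i> * F 0)) {0..1}"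
  proof (rule has_integral_eq[rotated])
    fix t :: real assume "t \<in> {0..1}"
    then have "vector_derivative (circlepath 0 1) (at t within {0..1}) = 2 * of_real pi * \<i> * e t"
      by (subst vector_derivative_circlepath01) (auto simp: e_def)
    moreover have "circlepath 0 1 t = e t" by (simp add: circlepath e_def)
    ultimately show "F (circlepath 0 1 t) / (circlepath 0 1 t - 0) * vector_derivative (circlepath 0 1) (at t within {0..1})
        = (2 * of_real pi * \<i>) * F (e t)"
      using e(2)[of t] by simp
  qed
  from has_integral_mult_right[OF this, of "1 / (2 * of_real pi * \<i>)"]
  have *: "((\<lambda>t. F (e t)) has_integral F 0) {0..1}" by simp
  have "continuous_on {0..1} (\<lambda>t. F (e t))"
    using e by (intro continuous_on_compose2[OF contF]) (auto simp: e_def intro!: continuous_intros)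
  then have "set_integrable lborel {0..1} (\<lambda>t. F (e t))"
    by (rule borel_integrable_atLeastAtMost')
  from set_borel_integral_eq_integral(2)[OF this] *
  have **: "(LINT t:{0..1}|lborel. F (e t)) = F 0"
    by (simp add: integral_unique)
  have [measurable]: "(\<lambda>u. indicator unit_circle u *\<^sub>R F u) \<in> borel_measurable borel"
    using contF by (intro borel_measurable_continuous_on_indicator) auto
  have "(LINT u|circ. indicator unit_circle u *\<^sub>R F u)
    = (LINT t|restrict_space lborel {0..1}. indicator unit_circle (e t) *\<^sub>R F (e t))"
    unfolding circ_def e_def by (subst integral_distr) simp_all
  also have "\<dots> = (LINT t:{0..1}|lborel. F (e t))"
    using e by (simp add: integral_restrict_space set_lebesgue_integral_def)
  finally show ?thesis using ** by simp
qed

text \<open>The analytic half of the Fejer kernel: on the unit circle the Fejer kernel is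
  \<open>2 Re (fejer m z) - 1\<close>, and its positivity is the bound \<open>Re (fejer m z) \<ge> 1/2\<close> below.\<close>

definition fejer :: "nat \<Rightarrow> complex \<Rightarrow> complex" where
  "fejer m z = (\<Sum>j\<le>m. \<Sum>n\<le>j. z ^ n) / of_nat (Suc m)"

lemma fejer_0 [simp]: "fejer m 0 = 1"
  by (simp add: fejer_def power_0_left del: of_nat_Suc)

lemma fejer_cnj: "fejer m (cnj z) = cnj (fejer m z)"
  by (simp add: fejer_def)

lemma holomorphic_fejer [holomorphic_intros]:
  "f holomorphic_on S \<Longrightarrow> (\<lambda>z. fejer m (f z)) holomorphic_on S"
  unfolding fejer_def by (intro holomorphic_intros) (simp_all del: of_nat_Suc)

lemma continuous_fejer [continuous_intros]:
  "continuous_on S f \<Longrightarrow> continuous_on S (\<lambda>z. fejer m (f z))"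
  unfolding fejer_def by (intro continuous_intros) (simp_all del: of_nat_Suc)

lemma borel_measurable_fejer [measurable]: "fejer m \<in> borel_measurable borel"
  by (intro borel_measurable_continuous_onI continuous_intros)

lemma Re_fejer_ge:
  assumes z: "cmod z = 1"
  shows "1 / 2 \<le> Re (fejer m z)"
proof -
  define D where "D j = (\<Sum>n\<le>j. z ^ n)" for j
  have D_Suc: "D (Suc j) = 1 + z * D j" for j
    unfolding D_def by (subst sum.atMost_Suc_shift) (simp add: sum_distrib_left)
  \<comment> \<open>The Fejer kernel as a square: |D_m|^2 is m + 1 times 2 Re (fejer m z) - 1. The
    induction rests on D_(m+1) = 1 + z D_m and |z| = 1.\<close>
  have "2 * Re (\<Sum>j\<le>m. D j) - real (Suc m) = (cmod (D m))\<^sup>2"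
  proof (induction m)
    case 0
    show ?case by (simp add: D_def)
  next
    case (Suc m)
    have sq: "(cmod (1 + w))\<^sup>2 = 1 + 2 * Re w + (cmod w)\<^sup>2" for w
      unfolding cmod_power2 by (simp add: power2_eq_square algebra_simps)
    have "(cmod (D (Suc m)))\<^sup>2 = 1 + 2 * Re (z * D m) + (cmod (D m))\<^sup>2"
      unfolding D_Suc sq using z by (simp add: norm_mult)
    then show ?case
      using Suc by (simp add: D_Suc)
  qed
  then have "real (Suc m) \<le> 2 * Re (\<Sum>j\<le>m. D j)"
    using zero_le_power2[of "cmod (D m)"] by linarith
  then show ?thesis
    by (simp add: fejer_def D_def field_simps Re_divide_of_nat del: of_nat_Suc)
qed

lemma cmod_fejer_le:
  assumes "cmod z \<le> 1"
  shows "cmod (fejer m z) \<le> real (Suc m)"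
proof -
  have "cmod (\<Sum>j\<le>m. \<Sum>n\<le>j. z ^ n) \<le> (\<Sum>j\<le>m. real (Suc m))"
  proof (rule sum_norm_le)
    fix j assume j: "j \<in> {..m}"
    have "cmod (\<Sum>n\<le>j. z ^ n) \<le> (\<Sum>n\<le>j. 1)"
      using assms by (intro sum_norm_le) (simp add: norm_power power_le_one)
    then show "cmod (\<Sum>n\<le>j. z ^ n) \<le> real (Suc m)"
      using j by simp
  qed
  then have "cmod (\<Sum>j\<le>m. \<Sum>n\<le>j. z ^ n) \<le> real (Suc m) * real (Suc m)" by simp
  then show ?thesis
    by (simp add: fejer_def norm_divide divide_le_eq del: of_nat_Suc)
qed

text \<open>Calderon's inequality behind M. Riesz' theorem: the exponent \<open>p > 1\<close> makes
  \<open>cos (p \<phi>)\<close> negative where \<open>cos \<phi>\<close> degenerates.\<close>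

lemma Calderon_inequality:
  assumes p: "1 < p" "p \<le> 2"
  shows "\<exists>A B. 0 < A \<and> 0 < B \<and>
    (\<forall>w. 0 < Re w \<longrightarrow> cmod w powr p \<le> A * Re w powr p - B * Re (w powr of_real p))"
proof -
  \<comment> \<open>The midpoint of pi / (2 p) and pi / 2: there cos \<phi> > 0 but cos (p \<phi>) <
    0.\<close>
  define \<phi> where "\<phi> = (pi / (2 * p) + pi / 2) / 2"
  have \<phi>_eq: "\<phi> = pi * (1 + 1 / p) / 4" and p\<phi>_eq: "p * \<phi> = pi * (1 + p) / 4"
    using p by (simp_all add: \<phi>_def field_simps)
  have "0 < 1 / p" "1 / p < 1" using p by auto
  then have \<phi>: "0 < \<phi>" "\<phi> < pi / 2"
    using mult_strict_left_mono[of "1 + 1 / p" 2 pi] unfolding \<phi>_eq by (auto simp: add_pos_pos)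
  have p\<phi>: "pi / 2 < p * \<phi>" "p * \<phi> < pi"
    using p mult_strict_left_mono[of 2 "1 + p" pi] mult_strict_left_mono[of "1 + p" 4 pi]
    unfolding p\<phi>_eq by auto
  have neg: "cos (p * \<phi>) < 0"
  proof -
    have "cos (p * \<phi>) < cos (pi / 2)"
      using p\<phi> by (intro cos_monotone_0_pi) auto
    then show ?thesis by simp
  qed
  have cphi: "0 < cos \<phi>" using \<phi> by (intro cos_gt_zero_pi) auto
  \<comment> \<open>B makes \<open>- B * cos (p * x)\<close> at least 1 from \<phi> on; A then makes
    the first term at least 1 + B below \<phi>, whatever the sign of the cosine there.\<close>
  define B where "B = - 1 / cos (p * \<phi>)"
  define A where "A = (1 + B) / cos \<phi> powr p"
  have B: "0 < B" using neg by (simp add: B_def)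
  have A: "0 < A" using B cphi by (simp add: A_def)
  have key: "1 \<le> A * cos x powr p - B * cos (p * x)" if x: "0 \<le> x" "x < pi / 2" for x
  proof (cases "x \<le> \<phi>")
    case True
    have "cos \<phi> \<le> cos x"
      using x \<phi> True by (intro cos_monotone_0_pi_le) auto
    then have "cos \<phi> powr p \<le> cos x powr p"
      using cphi p by (intro powr_mono2) auto
    then have "A * cos \<phi> powr p \<le> A * cos x powr p"
      using A by simp
    moreover have "A * cos \<phi> powr p = 1 + B" using cphi by (simp add: A_def)
    moreover have "B * cos (p * x) \<le> B * 1" using B by (intro mult_left_mono) auto
    ultimately show ?thesis by linarith
  next
    case False
    \<comment> \<open>Here p \<le> 2 enters: p x stays within [0, pi], where the cosine
      decreases.\<close>
    have "p * x \<le> 2 * (pi / 2)" using p x by (intro mult_mono) auto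
    moreover have "p * \<phi> \<le> p * x" using False p by simp
    ultimately have "cos (p * x) \<le> cos (p * \<phi>)"
      using p\<phi> by (intro cos_monotone_0_pi_le) auto
    then have "B * cos (p * x) \<le> B * cos (p * \<phi>)" using B by simp
    also have "\<dots> = - 1" using neg by (simp add: B_def)
    finally have "1 \<le> - B * cos (p * x)" by simp
    moreover have "0 \<le> A * cos x powr p" using A by simp
    ultimately show ?thesis by linarith
  qed
  have "cmod w powr p \<le> A * Re w powr p - B * Re (w powr of_real p)" if w: "0 < Re w" for w
  proof -
    define x where "x = Im (Ln w)"
    have w0: "w \<noteq> 0" using w by auto
    have x: "\<bar>x\<bar> < pi / 2" unfolding x_def by (rule Re_Ln_pos_lt_imp[OF w])
    have "w = exp (Ln w)" using w0 by simp
    then have "Re w = Re (exp (Ln w))" by simp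
    also have "\<dots> = cmod w * cos x"
      unfolding Re_exp using w0 by (simp add: x_def)
    finally have Re: "Re w = cmod w * cos x" .
    have "Re (w powr of_real p) = Re (exp (of_real p * Ln w))"
      using w0 by (simp add: powr_def)
    also have "\<dots> = cmod w powr p * cos (p * x)"
      using w0 by (simp add: Re_exp x_def powr_def)
    finally have Rp: "Re (w powr of_real p) = cmod w powr p * cos (p * x)" .
    have "cos x = cos \<bar>x\<bar>" "cos (p * x) = cos (p * \<bar>x\<bar>)" by (auto simp: abs_if)
    then have "1 \<le> A * cos x powr p - B * cos (p * x)"
      using key[of "\<bar>x\<bar>"] x by simp
    then have "cmod w powr p * 1 \<le> cmod w powr p * (A * cos x powr p - B * cos (p * x))"
      by (intro mult_left_mono) auto
    also have "\<dots> = A * Re w powr p - B * Re (w powr of_real p)"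
    proof -
      have "0 < cos x" using x by (intro cos_gt_zero_pi) auto
      then have "Re w powr p = cmod w powr p * cos x powr p"
        unfolding Re by (simp add: powr_mult)
      then show ?thesis by (simp add: Rp algebra_simps)
    qed
    finally show ?thesis by simp
  qed
  with A B show ?thesis by blast
qed

text \<open>The minimum principle for Re h: the maximum modulus principle is applied to exp (- h),
  whose modulus is exp (- Re h).\<close>

lemma Re_pos_disc:
  assumes h: "h holomorphic_on UNIV" and pos: "\<And>u. cmod u = 1 \<Longrightarrow> 0 < Re (h u)" and z: "cmod z \<le> 1"
  shows "0 < Re (h z)"
proof -
  have cont: "continuous_on S h" for S
    using h holomorphic_on_imp_continuous_on continuous_on_subset by blast
  obtain x where x: "x \<in> unit_circle" "\<And>u. u \<in> unit_circle \<Longrightarrow> Re (h x) \<le> Re (h u)"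
  proof -
    have "\<exists>x\<in>unit_circle. \<forall>u\<in>unit_circle. Re (h x) \<le> Re (h u)"
      by (rule continuous_attains_inf) (auto intro!: continuous_intros cont simp: sphere_eq_empty)
    then show ?thesis using that by blast
  qed
  have "cmod (exp (- h z)) \<le> exp (- Re (h x))"
  proof (rule maximum_modulus_frontier[where S = "cball 0 1" and f = "\<lambda>z. exp (- h z)"])
    show "(\<lambda>z. exp (- h z)) holomorphic_on interior (cball 0 1)"
      using holomorphic_on_subset[OF h] by (intro holomorphic_intros) auto
    show "continuous_on (closure (cball 0 1)) (\<lambda>z. exp (- h z))"
      by (intro continuous_intros cont)
    show "cmod (exp (- h u)) \<le> exp (- Re (h x))" if "u \<in> frontier (cball 0 1)" for u
      using that x(2)[of u] by (simp add: frontier_def)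
  qed (use z in auto)
  then have "Re (h x) \<le> Re (h z)" by simp
  then show ?thesis using pos[of x] x(1) by simp
qed

text \<open>Calderon's inequality is integrated over the circle. As Re h > 0 on the closed disc, h^p
  is holomorphic there, so the mean of Re (h^p) is its value at 0. That value is positive because
  h(0) is a positive real, and it enters with the sign that lets it be dropped.\<close>

lemma Riesz_positive_real_part:
  assumes p: "1 < p" "p \<le> 2"
  shows "\<exists>A>0. \<forall>h. h holomorphic_on UNIV \<longrightarrow> (\<forall>u. cmod u = 1 \<longrightarrow> 0 < Re (h u)) \<longrightarrow> Im (h 0) = 0 \<longrightarrow>
    lp_power circ p h
      \<le> ennreal A * (\<integral>\<^sup>+u. ennreal (Re (h u) powr p) \<partial>circ)"
proof -
  obtain A B where AB: "0 < A" "0 < B"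
    and ineq: "\<And>w. 0 < Re w \<Longrightarrow> cmod w powr p \<le> A * Re w powr p - B * Re (w powr of_real p)"
    using Calderon_inequality[OF p] by blast
  have "lp_power circ p h
      \<le> ennreal A * (\<integral>\<^sup>+u. ennreal (Re (h u) powr p) \<partial>circ)"
    if h: "h holomorphic_on UNIV" and pos: "\<forall>u. cmod u = 1 \<longrightarrow> 0 < Re (h u)" and Im0: "Im (h 0) = 0" for h
  proof -
    have posD: "0 < Re (h z)" if "cmod z \<le> 1" for z
      using Re_pos_disc[OF h _ that] pos by blast
    have cont: "continuous_on S h" for S
      using h holomorphic_on_imp_continuous_on continuous_on_subset by blast
    have holF: "(\<lambda>z. h z powr of_real p) holomorphic_on cball 0 1"
    proof (intro holomorphic_intros)
      show "h holomorphic_on cball 0 1" using h holomorphic_on_subset by blast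
      show "h z \<notin> \<real>\<^sub>\<le>\<^sub>0" if "z \<in> cball 0 1" for z
        using posD[of z] that by (auto simp: complex_nonpos_Reals_iff)
    qed
    define ind where "ind = (indicator unit_circle :: complex \<Rightarrow> real)"
    have intF: "integrable circ (\<lambda>u. ind u *\<^sub>R (h u powr of_real p))"
      unfolding ind_def
      by (intro integrable_circle_continuous continuous_on_subset[OF holomorphic_on_imp_continuous_on[OF holF]]) auto
    have int1: "integrable circ (\<lambda>u. ind u *\<^sub>R (cmod (h u) powr p))"
      unfolding ind_def using posD
      by (intro integrable_circle_continuous continuous_on_powr continuous_intros cont) (metis (no_types) dist_0_norm eq_refl less_irrefl mem_sphere norm_zero order_refl zero_complex.sel(1) norm_eq_zero)
    have int2: "integrable circ (\<lambda>u. ind u *\<^sub>R (Re (h u) powr p))"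
      unfolding ind_def using posD
      by (intro integrable_circle_continuous continuous_on_powr continuous_intros cont) (metis less_irrefl dist_0_norm mem_sphere order_refl)
    have F0: "(LINT u|circ. ind u * Re (h u powr of_real p)) = Re (h 0) powr p"
    proof -
      have "(LINT u|circ. ind u * Re (h u powr of_real p))
        = Re (LINT u|circ. ind u *\<^sub>R (h u powr of_real p))"
        using intF by (subst integral_Re[symmetric]) auto
      also have "\<dots> = Re (h 0 powr of_real p)"
        unfolding ind_def by (subst integral_circle_holomorphic[OF holF]) simp
      also have "h 0 = of_real (Re (h 0))" using Im0 by (simp add: complex_eq_iff)
      then have "Re (h 0 powr of_real p) = Re (h 0) powr p"
        using posD[of 0] by (metis Re_complex_of_real less_imp_le norm_zero powr_of_real zero_le_one)
      finally show ?thesis .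
    qed
    have to_nn: "(\<integral>\<^sup>+u. ennreal (f u) \<partial>circ) = ennreal (LINT u|circ. ind u *\<^sub>R f u)"
      if "integrable circ (\<lambda>u. ind u *\<^sub>R f u)" "\<And>u. 0 \<le> f u" for f :: "complex \<Rightarrow> real"
    proof -
      have "(\<integral>\<^sup>+u. ennreal (f u) \<partial>circ) = (\<integral>\<^sup>+u. ennreal (ind u *\<^sub>R f u) \<partial>circ)"
        using AE_unit_circle by (intro nn_integral_cong_AE) (auto elim!: eventually_mono simp: ind_def)
      then show ?thesis
        using that by (simp add: nn_integral_eq_integral ind_def)
    qed
    have "(LINT u|circ. ind u *\<^sub>R (cmod (h u) powr p))
      \<le> (LINT u|circ. A * (ind u *\<^sub>R (Re (h u) powr p)) - B * (ind u * Re (h u powr of_real p)))"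
    proof (rule integral_mono[OF int1])
      show "integrable circ (\<lambda>u. A * (ind u *\<^sub>R (Re (h u) powr p)) - B * (ind u * Re (h u powr of_real p)))"
        using int2 integrable_Re[OF intF] by (intro Bochner_Integration.integrable_diff integrable_mult_right) auto
      show "ind u *\<^sub>R (cmod (h u) powr p) \<le> A * (ind u *\<^sub>R (Re (h u) powr p)) - B * (ind u * Re (h u powr of_real p))" for u
        using ineq[of "h u"] pos by (auto simp: ind_def split: split_indicator)
    qed
    also have "\<dots> = A * (LINT u|circ. ind u *\<^sub>R (Re (h u) powr p)) - B * Re (h 0) powr p"
      using int2 integrable_Re[OF intF] F0 by (subst Bochner_Integration.integral_diff) auto
    also have "\<dots> \<le> A * (LINT u|circ. ind u *\<^sub>R (Re (h u) powr p))"
      using AB by simp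
    finally show ?thesis
      using AB unfolding to_nn[OF int1 powr_ge_zero] to_nn[OF int2 powr_ge_zero]
      by (simp only: ennreal_leI flip: ennreal_mult'[OF less_imp_le])
  qed
  with AB(1) show ?thesis by blast
qed

section \<open>Convolution with the analytic half of the Fejer kernel\<close>

lemma borel_measurable_cnj [measurable (raw)]:
  "f \<in> borel_measurable M \<Longrightarrow> (\<lambda>x. cnj (f x)) \<in> borel_measurable M"
  by (rule measurable_compose[where g = cnj]) (auto intro!: borel_measurable_continuous_onI continuous_intros)

text \<open>Convolution with \<open>fejer m\<close>, composed with a rotation by \<eta>. In the
  application \<eta> is the phase of z * cnj x, which remains after |z x| has gone into the
  coefficients.\<close>

definition fejer_op :: "nat \<Rightarrow> complex \<Rightarrow> (complex \<Rightarrow> complex) \<Rightarrow> complex \<Rightarrow> complex" where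
  "fejer_op m \<eta> g v = (LINT u|circ. g u * fejer m (v * cnj u * \<eta>))"

lemma integrable_mult_circle:
  fixes g k :: "complex \<Rightarrow> complex"
  assumes g: "integrable circ g" and k: "k \<in> borel_measurable borel"
    and B: "\<And>u. cmod u = 1 \<Longrightarrow> cmod (k u) \<le> B"
  shows "integrable circ (\<lambda>u. g u * k u)"
proof -
  have [measurable]: "g \<in> borel_measurable borel" "k \<in> borel_measurable borel"
    using borel_measurable_integrable[OF g] k by simp_all
  show ?thesis
  proof (rule Bochner_Integration.integrable_bound)
    show "integrable circ (\<lambda>u. B * cmod (g u))" using g by auto
    show "AE u in circ. cmod (g u * k u) \<le> norm (B * cmod (g u))"
      using AE_circ
    proof eventually_elim
      case (elim u)
      have "cmod (g u * k u) \<le> cmod (g u) * B"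
        unfolding norm_mult using B[OF elim] by (intro mult_left_mono) auto
      also have "\<dots> \<le> norm (B * cmod (g u))" by (simp add: mult.commute)
      finally show ?case .
    qed
  qed simp
qed

lemma integrable_fejer_op:
  assumes "integrable circ g" "cmod \<eta> = 1" "cmod v \<le> 1"
  shows "integrable circ (\<lambda>u. g u * fejer m (v * cnj u * \<eta>))"
proof (rule integrable_mult_circle[OF assms(1)])
  show "cmod (fejer m (v * cnj u * \<eta>)) \<le> real (Suc m)" if "cmod u = 1" for u
    using assms that by (intro cmod_fejer_le) (simp add: norm_mult)
qed measurable

definition circle_coeff :: "(complex \<Rightarrow> complex) \<Rightarrow> nat \<Rightarrow> complex" where
  "circle_coeff g n = (LINT u|circ. g u * cnj u ^ n)"

lemma integrable_circle_coeff:
  assumes "integrable circ g"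
  shows "integrable circ (\<lambda>u. g u * cnj u ^ n)"
  by (rule integrable_mult_circle[OF assms, where B = 1]) (simp_all add: norm_power)

text \<open>Shows a polynomial in v built from Fourier coefficients of g: hence the holomorphic
  extension into the disc, and later the link with summation by parts.\<close>

lemma fejer_op_eq:
  assumes g: "integrable circ g"
  shows "fejer_op m \<eta> g v = (\<Sum>j\<le>m. \<Sum>n\<le>j. (v * \<eta>) ^ n * circle_coeff g n) / of_nat (Suc m)"
proof -
  have "fejer_op m \<eta> g v
      = (LINT u|circ. (\<Sum>j\<le>m. \<Sum>n\<le>j. (v * \<eta>) ^ n / of_nat (Suc m) * (g u * cnj u ^ n)))"
    unfolding fejer_op_def fejer_def
    by (intro Bochner_Integration.integral_cong refl)
      (simp add: sum_distrib_left sum_divide_distrib power_mult_distrib mult_ac del: of_nat_Suc)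
  also have "\<dots> = (\<Sum>j\<le>m. \<Sum>n\<le>j. (v * \<eta>) ^ n / of_nat (Suc m) * circle_coeff g n)"
    unfolding circle_coeff_def
    by (simp only: Bochner_Integration.integral_sum Bochner_Integration.integrable_sum integrable_mult_right
        integrable_circle_coeff[OF g] integral_mult_right_zero)
  finally show ?thesis
    by (simp add: sum_divide_distrib)
qed

lemma holomorphic_fejer_op:
  assumes g: "integrable circ g"
  shows "fejer_op m \<eta> g holomorphic_on S"
proof -
  have "(\<lambda>v. (\<Sum>j\<le>m. \<Sum>n\<le>j. (v * \<eta>) ^ n * circle_coeff g n) / of_nat (Suc m)) holomorphic_on S"
    by (intro holomorphic_intros) (simp_all del: of_nat_Suc)
  then show ?thesis by (simp add: fejer_op_eq[OF g, abs_def])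
qed

lemma borel_measurable_fejer_op [measurable]:
  assumes "integrable circ g"
  shows "fejer_op m \<eta> g \<in> borel_measurable borel"
  using holomorphic_on_imp_continuous_on[OF holomorphic_fejer_op[OF assms]]
  by (intro borel_measurable_continuous_onI)

text \<open>Together with the lower bound 1/2 this makes Re (fejer m) a probability density; the
  total mass is the value \<open>fejer m 0 = 1\<close>, by the mean value property.\<close>

lemma integral_fejer:
  assumes "cmod a = 1"
  shows "(\<integral>\<^sup>+u. ennreal (Re (fejer m (u * a))) \<partial>circ) = 1"
proof -
  have hol: "(\<lambda>u. fejer m (u * a)) holomorphic_on cball 0 1"
    by (intro holomorphic_intros)
  have cont: "continuous_on unit_circle (\<lambda>u. fejer m (u * a))"
    by (intro continuous_intros)
  note int = integrable_circle_continuous[OF cont]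
  have "(\<integral>\<^sup>+u. ennreal (Re (fejer m (u * a))) \<partial>circ)
    = (\<integral>\<^sup>+u. ennreal (Re (indicator unit_circle u *\<^sub>R fejer m (u * a))) \<partial>circ)"
    using AE_unit_circle by (intro nn_integral_cong_AE) (auto elim!: eventually_mono)
  also have "\<dots> = ennreal (LINT u|circ. Re (indicator unit_circle u *\<^sub>R fejer m (u * a)))"
  proof (rule nn_integral_eq_integral[OF integrable_Re[OF int]], rule AE_I2)
    show "0 \<le> Re (indicator unit_circle u *\<^sub>R fejer m (u * a))" for u
      using Re_fejer_ge[of "u * a" m] assms by (auto simp: norm_mult split: split_indicator)
  qed
  also have "(LINT u|circ. Re (indicator unit_circle u *\<^sub>R fejer m (u * a))) = 1"
    by (subst integral_Re[OF int]) (simp add: integral_circle_holomorphic[OF hol])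
  finally show ?thesis by simp
qed

text \<open>Exchanges the roles of u and v, so that the real part of the kernel has mass 1 in either
  variable.\<close>

lemma Re_fejer_reflect: "Re (fejer m (v * cnj u * \<eta>)) = Re (fejer m (u * cnj (v * \<eta>)))"
proof -
  have "v * cnj u * \<eta> = cnj (u * cnj (v * \<eta>))" by simp
  then show ?thesis by (simp only: fejer_cnj cnj.sel)
qed

text \<open>For g \<ge> 0 the real part of the image h is the convolution of g with a probability
  density that is at least 1/2, hence positive on the circle unless g vanishes, and h(0) is the
  integral of g, a real number. So \<open>Riesz_positive_real_part\<close> bounds h by Re h, and
  Jensen bounds Re h by g.\<close>

lemma fejer_op_nonneg_bound:
  assumes p: "1 < p" "p \<le> 2"
  shows "\<exists>A>0. \<forall>m \<eta> g. cmod \<eta> = 1 \<longrightarrow> integrable circ g \<longrightarrow> (\<forall>u. 0 \<le> g u) \<longrightarrow>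
    lp_power circ p (fejer_op m \<eta> (\<lambda>u. of_real (g u)))
      \<le> ennreal A * (\<integral>\<^sup>+u. ennreal (g u powr p) \<partial>circ)"
proof -
  obtain A where A: "0 < A" and Riesz: "\<And>h. h holomorphic_on UNIV \<Longrightarrow> (\<forall>u. cmod u = 1 \<longrightarrow> 0 < Re (h u)) \<Longrightarrow>
    Im (h 0) = 0 \<Longrightarrow> lp_power circ p h
      \<le> ennreal A * (\<integral>\<^sup>+u. ennreal (Re (h u) powr p) \<partial>circ)"
    using Riesz_positive_real_part[OF p] by blast
  have "lp_power circ p (fejer_op m \<eta> (\<lambda>u. of_real (g u)))
      \<le> ennreal A * (\<integral>\<^sup>+u. ennreal (g u powr p) \<partial>circ)"
    if \<eta>: "cmod \<eta> = 1" and g: "integrable circ g" and g0: "\<forall>u. 0 \<le> g u" for m \<eta> g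
  proof -
    define h where "h = fejer_op m \<eta> (\<lambda>u. of_real (g u))"
    have gc: "integrable circ (\<lambda>u. complex_of_real (g u))" using g by simp
    have [measurable]: "g \<in> borel_measurable borel" using borel_measurable_integrable[OF g] by simp
    have [measurable]: "h \<in> borel_measurable borel" unfolding h_def by (rule borel_measurable_fejer_op[OF gc])
    \<comment> \<open>The maximum with 0 changes nothing on the circle; it makes the weight
      nonnegative everywhere, as \<open>weighted_Jensen_powr\<close> asks.\<close>
    define w where "w v u = max 0 (Re (fejer m (v * cnj u * \<eta>)))" for v u
    have [measurable]: "(\<lambda>(v, u). w v u) \<in> borel_measurable (borel \<Otimes>\<^sub>M borel)"
      unfolding w_def by measurable
    have w_eq: "w v u = Re (fejer m (v * cnj u * \<eta>))" and w_ge: "1 / 2 \<le> w v u"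
      if "cmod v = 1" "cmod u = 1" for v u
      using Re_fejer_ge[of "v * cnj u * \<eta>" m] that \<eta> by (auto simp: w_def norm_mult)
    have wv: "(\<integral>\<^sup>+u. ennreal (w v u) \<partial>circ) = 1" if v: "cmod v = 1" for v
    proof -
      have "(\<integral>\<^sup>+u. ennreal (w v u) \<partial>circ) = (\<integral>\<^sup>+u. ennreal (Re (fejer m (u * cnj (v * \<eta>)))) \<partial>circ)"
        using AE_circ
        by (intro nn_integral_cong_AE) (auto elim!: eventually_mono simp: w_eq[OF v] Re_fejer_reflect simp del: complex_cnj_mult)
      also have "\<dots> = 1" using v \<eta> by (intro integral_fejer) (simp add: norm_mult)
      finally show ?thesis .
    qed
    have wu: "(\<integral>\<^sup>+v. ennreal (w v u) \<partial>circ) = 1" if u: "cmod u = 1" for u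
    proof -
      have "(\<integral>\<^sup>+v. ennreal (w v u) \<partial>circ) = (\<integral>\<^sup>+v. ennreal (Re (fejer m (v * (cnj u * \<eta>)))) \<partial>circ)"
        using AE_circ
        by (intro nn_integral_cong_AE) (auto elim!: eventually_mono simp: w_eq u mult.assoc)
      also have "\<dots> = 1" using u \<eta> by (intro integral_fejer) (simp add: norm_mult)
      finally show ?thesis .
    qed
    have int_w: "integrable circ (\<lambda>u. g u * w v u)" and Re_h: "Re (h v) = (LINT u|circ. g u * w v u)"
      if v: "cmod v = 1" for v
    proof -
      note int = integrable_fejer_op[OF gc \<eta>, of v m]
      have AE: "AE u in circ. g u * w v u = Re (complex_of_real (g u) * fejer m (v * cnj u * \<eta>))"
        using AE_circ by eventually_elim (simp add: w_eq[OF v])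
      show "integrable circ (\<lambda>u. g u * w v u)"
        using integrable_Re[OF int] AE v by (subst integrable_cong_AE[OF _ _ AE]) auto
      show "Re (h v) = (LINT u|circ. g u * w v u)"
        unfolding h_def fejer_op_def using v int AE
        by (subst integral_Re[symmetric]) (auto intro!: integral_cong_AE elim!: eventually_mono)
    qed
    \<comment> \<open>Positivity of Re h needs a nonzero integral of g; if the integral is zero,
      then g = 0 almost everywhere and h = 0.\<close>
    show ?thesis
    proof (cases "(LINT u|circ. g u) = 0")
      case True
      then have "AE u in circ. g u = 0"
        using integral_nonneg_eq_0_iff_AE[OF g] g0 by auto
      then have "h v = 0" for v
        unfolding h_def fejer_op_def by (intro integral_eq_zero_AE) (auto elim!: eventually_mono)
      then show ?thesis using p by (simp add: h_def)
    next
      case False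
      then have pos: "0 < (LINT u|circ. g u)"
        using g0 by (simp add: less_le Bochner_Integration.integral_nonneg)
      have Re_pos: "0 < Re (h v)" if v: "cmod v = 1" for v
      proof -
        have "(LINT u|circ. g u * (1 / 2)) \<le> (LINT u|circ. g u * w v u)"
        proof (rule integral_mono_AE)
          show "AE u in circ. g u * (1 / 2) \<le> g u * w v u"
            using AE_circ by eventually_elim (intro mult_left_mono w_ge[OF v], use g0 in auto)
        qed (use g int_w[OF v] in auto)
        then show ?thesis using pos Re_h[OF v] by simp
      qed
      have "lp_power circ p h
        \<le> ennreal A * (\<integral>\<^sup>+v. ennreal (Re (h v) powr p) \<partial>circ)"
      proof (rule Riesz)
        show "h holomorphic_on UNIV" unfolding h_def by (rule holomorphic_fejer_op[OF gc])
        show "Im (h 0) = 0" by (simp add: h_def fejer_op_def)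
      qed (use Re_pos in auto)
      also have "(\<integral>\<^sup>+v. ennreal (Re (h v) powr p) \<partial>circ)
        \<le> (\<integral>\<^sup>+v. (\<integral>\<^sup>+u. ennreal (g u powr p * w v u) \<partial>circ) \<partial>circ)"
      proof (rule nn_integral_mono_AE)
        show "AE v in circ. ennreal (Re (h v) powr p) \<le> (\<integral>\<^sup>+u. ennreal (g u powr p * w v u) \<partial>circ)"
          using AE_circ
        proof eventually_elim
          case (elim v)
          have "ennreal (Re (h v) powr p) \<le> ennreal (1 powr (p - 1)) * (\<integral>\<^sup>+u. ennreal (g u powr p * w v u) \<partial>circ)"
          proof (rule weighted_Jensen_powr)
            show "ennreal (Re (h v)) \<le> (\<integral>\<^sup>+u. ennreal (g u * w v u) \<partial>circ)"
              unfolding Re_h[OF elim] using g0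
              by (subst nn_integral_eq_integral[OF int_w[OF elim]]) (auto simp: w_def)
          qed (use p g0 wv[OF elim] Re_pos[OF elim] in \<open>auto simp: w_def\<close>)
          then show ?case by simp
        qed
      qed
      also have "\<dots> = (\<integral>\<^sup>+u. (\<integral>\<^sup>+v. ennreal (g u powr p * w v u) \<partial>circ) \<partial>circ)"
        by (rule circle_pair.Fubini'[symmetric]) measurable
      also have "\<dots> = (\<integral>\<^sup>+u. ennreal (g u powr p) \<partial>circ)"
      proof (rule nn_integral_cong_AE)
        show "AE u in circ. (\<integral>\<^sup>+v. ennreal (g u powr p * w v u) \<partial>circ) = ennreal (g u powr p)"
          using AE_circ
        proof eventually_elim
          case (elim u)
          have "(\<integral>\<^sup>+v. ennreal (g u powr p * w v u) \<partial>circ)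
            = ennreal (g u powr p) * (\<integral>\<^sup>+v. ennreal (w v u) \<partial>circ)"
            by (simp add: ennreal_mult' nn_integral_cmult)
          then show ?case by (simp add: wu[OF elim])
        qed
      qed
      finally show ?thesis by (simp add: h_def mult_left_mono)
    qed
  qed
  with A show ?thesis by blast
qed

section \<open>Complex functions, and exponents p \<ge> 2 by duality\<close>

lemma powr_add4_le:
  fixes a b c d p :: real
  assumes "0 \<le> a" "0 \<le> b" "0 \<le> c" "0 \<le> d" "0 < p"
  shows "(a + b + c + d) powr p \<le> 4 powr p * (a powr p + b powr p + c powr p + d powr p)"
proof -
  define M where "M = max (max a b) (max c d)"
  have M: "0 \<le> M" "a + b + c + d \<le> 4 * M" using assms by (auto simp: M_def)
  have "(a + b + c + d) powr p \<le> (4 * M) powr p"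
    using assms M by (intro powr_mono2) auto
  also have "\<dots> = 4 powr p * M powr p" using M by (simp add: powr_mult)
  also have "M powr p \<le> a powr p + b powr p + c powr p + d powr p"
    unfolding M_def using powr_ge_zero[of a p] powr_ge_zero[of b p] powr_ge_zero[of c p] powr_ge_zero[of d p]
    by (auto simp: max_def simp del: powr_ge_zero)
  finally show ?thesis by simp
qed

abbreviation fejer_bounded :: "real \<Rightarrow> real \<Rightarrow> bool" where
  "fejer_bounded p A \<equiv> 0 < A \<and> (\<forall>m \<eta> g. cmod \<eta> = 1 \<longrightarrow> integrable circ g \<longrightarrow>
    lp_power circ p (fejer_op m \<eta> g) \<le> ennreal A * lp_power circ p g)"

text \<open>g is split into the positive and negative parts of its real and imaginary parts; each of
  the four is nonnegative and dominated by |g|.\<close>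

lemma fejer_op_bound_le_2:
  assumes p: "1 < p" "p \<le> 2"
  shows "\<exists>A. fejer_bounded p A"
proof -
  obtain A where A: "0 < A" and bound: "\<And>m \<eta> g. cmod \<eta> = 1 \<Longrightarrow> integrable circ g \<Longrightarrow> (\<forall>u. 0 \<le> g u) \<Longrightarrow>
    lp_power circ p (fejer_op m \<eta> (\<lambda>u. of_real (g u)))
      \<le> ennreal A * (\<integral>\<^sup>+u. ennreal (g u powr p) \<partial>circ)"
    using fejer_op_nonneg_bound[OF p] by blast
  have "lp_power circ p (fejer_op m \<eta> g)
      \<le> ennreal (4 powr p * (4 * A)) * lp_power circ p g"
    if \<eta>: "cmod \<eta> = 1" and g: "integrable circ g" for m \<eta> g
  proof -
    define I where "I = lp_power circ p g"
    define part where "part s u = (if s = 0 then max 0 (Re (g u)) else if s = 1 then max 0 (- Re (g u))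
      else if s = 2 then max 0 (Im (g u)) else max 0 (- Im (g u)))" for s :: nat and u
    define T where "T s v = fejer_op m \<eta> (\<lambda>u. complex_of_real (part s u)) v" for s v
    have part_int: "integrable circ (part s)" for s
      unfolding part_def using g by (cases "s = 0"; cases "s = 1"; cases "s = 2") (auto intro!: integrable_max)
    have part0: "0 \<le> part s u" for s u by (simp add: part_def)
    have part_le: "part s u \<le> cmod (g u)" for s u
      using abs_Re_le_cmod[of "g u"] abs_Im_le_cmod[of "g u"] by (auto simp: part_def)
    have T_int: "integrable circ (\<lambda>u. complex_of_real (part s u))" for s
      using part_int by simp
    have [measurable]: "T s \<in> borel_measurable borel" for s
      unfolding T_def[abs_def] by (rule borel_measurable_fejer_op[OF T_int])
    have Tle: "lp_power circ p (T s) \<le> ennreal A * I" for s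
    proof -
      have "lp_power circ p (T s)
        \<le> ennreal A * (\<integral>\<^sup>+u. ennreal (part s u powr p) \<partial>circ)"
        unfolding T_def using part0 by (intro bound \<eta> part_int) auto
      also have "\<dots> \<le> ennreal A * I"
        unfolding I_def using p part0 part_le
        by (intro mult_left_mono nn_integral_mono ennreal_leI powr_mono2) auto
      finally show ?thesis .
    qed
    have lin: "fejer_op m \<eta> g v = T 0 v - T 1 v + \<i> * (T 2 v - T 3 v)" if v: "cmod v = 1" for v
    proof -
      have g_eq: "g u = of_real (part 0 u) - of_real (part 1 u) + \<i> * (of_real (part 2 u) - of_real (part 3 u))" for u
        by (auto simp: part_def complex_eq_iff max_def)
      note int = integrable_fejer_op[OF T_int \<eta>, of v _ m]
      define F where "F = (\<lambda>s u. complex_of_real (part s u) * fejer m (v * cnj u * \<eta>))"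
      have F: "integrable circ (F s)" for s
        unfolding F_def using int v by simp
      have "fejer_op m \<eta> g v = (LINT u|circ. F 0 u - F 1 u + \<i> * (F 2 u - F 3 u))"
        unfolding fejer_op_def F_def
        by (intro Bochner_Integration.integral_cong refl, subst g_eq) (simp add: algebra_simps)
      also have "\<dots> = integral\<^sup>L circ (F 0) - integral\<^sup>L circ (F 1)
          + \<i> * (integral\<^sup>L circ (F 2) - integral\<^sup>L circ (F 3))"
        using F by simp
      finally show ?thesis by (simp add: T_def fejer_op_def F_def)
    qed
    have "lp_power circ p (fejer_op m \<eta> g)
      \<le> (\<integral>\<^sup>+v. ennreal (4 powr p) * (ennreal (cmod (T 0 v) powr p) + ennreal (cmod (T 1 v) powr p)
        + ennreal (cmod (T 2 v) powr p) + ennreal (cmod (T 3 v) powr p)) \<partial>circ)"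
    proof (rule nn_integral_mono_AE)
      show "AE v in circ. ennreal (cmod (fejer_op m \<eta> g v) powr p)
        \<le> ennreal (4 powr p) * (ennreal (cmod (T 0 v) powr p) + ennreal (cmod (T 1 v) powr p)
        + ennreal (cmod (T 2 v) powr p) + ennreal (cmod (T 3 v) powr p))"
        using AE_circ
      proof eventually_elim
        case (elim v)
        have "cmod (fejer_op m \<eta> g v) \<le> cmod (T 0 v - T 1 v) + cmod (\<i> * (T 2 v - T 3 v))"
          unfolding lin[OF elim] by (rule norm_triangle_ineq)
        also have "\<dots> \<le> cmod (T 0 v) + cmod (T 1 v) + cmod (T 2 v) + cmod (T 3 v)"
          using norm_triangle_ineq4[of "T 0 v" "T 1 v"] norm_triangle_ineq4[of "T 2 v" "T 3 v"]
          by (simp add: norm_mult)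
        finally have "cmod (fejer_op m \<eta> g v) powr p \<le> (cmod (T 0 v) + cmod (T 1 v) + cmod (T 2 v) + cmod (T 3 v)) powr p"
          using p by (intro powr_mono2) auto
        also have "\<dots> \<le> 4 powr p * (cmod (T 0 v) powr p + cmod (T 1 v) powr p + cmod (T 2 v) powr p + cmod (T 3 v) powr p)"
          using p by (intro powr_add4_le) auto
        finally show ?case
          by (simp add: ennreal_leI flip: ennreal_plus ennreal_mult')
      qed
    qed
    also have "\<dots> = ennreal (4 powr p) * (lp_power circ p (T 0)
      + lp_power circ p (T 1)
      + lp_power circ p (T 2)
      + lp_power circ p (T 3))"
      by (simp add: nn_integral_cmult nn_integral_add)
    also have "\<dots> \<le> ennreal (4 powr p) * (ennreal A * I + ennreal A * I + ennreal A * I + ennreal A * I)"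
      by (intro mult_left_mono add_mono Tle) simp
    also have "ennreal A * I + ennreal A * I + ennreal A * I + ennreal A * I = ennreal (4 * A) * I"
    proof -
      have "ennreal (4 * A) = ennreal A + ennreal A + ennreal A + ennreal A"
        using A by (simp flip: ennreal_plus)
      then show ?thesis by (simp add: distrib_right)
    qed
    finally show ?thesis
      using A by (simp add: I_def ennreal_mult' mult.assoc)
  qed
  moreover have "0 < 4 powr p * (4 * A)" using A by simp
  ultimately show ?thesis by blast
qed

text \<open>Conjugating the kernel exchanges u and v and conjugates \<eta>, so the adjoint is an
  operator of the same family. Fubini applies because the kernel and f are bounded and g is
  integrable.\<close>

lemma fejer_op_adjoint:
  assumes \<eta>: "cmod \<eta> = 1" and g: "integrable circ g"
    and [measurable]: "f \<in> borel_measurable borel" and B: "\<And>v. cmod (f v) \<le> B"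
  shows "(LINT v|circ. fejer_op m \<eta> g v * cnj (f v))
    = (LINT u|circ. g u * cnj (fejer_op m (cnj \<eta>) f u))"
proof -
  have [measurable]: "g \<in> borel_measurable borel" using borel_measurable_integrable[OF g] by simp
  define F where "F u v = g u * fejer m (v * cnj u * \<eta>) * cnj (f v)" for u v
  have [measurable]: "case_prod F \<in> borel_measurable (borel \<Otimes>\<^sub>M borel)"
    unfolding F_def by measurable
  have B0: "0 \<le> B" using B[of 0] norm_ge_zero order_trans by blast
  have F_le: "cmod (F u v) \<le> cmod (g u) * (real (Suc m) * B)" if "cmod u = 1" "cmod v = 1" for u v
  proof -
    have "cmod (fejer m (v * cnj u * \<eta>)) \<le> real (Suc m)"
      using that \<eta> by (intro cmod_fejer_le) (simp add: norm_mult)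
    then show ?thesis
      unfolding F_def norm_mult mult.assoc using B B0 by (intro mult_left_mono mult_mono) auto
  qed
  have fin: "(\<integral>\<^sup>+u. (\<integral>\<^sup>+v. ennreal (cmod (F u v)) \<partial>circ) \<partial>circ) < \<infinity>"
  proof -
    have "(\<integral>\<^sup>+u. (\<integral>\<^sup>+v. ennreal (cmod (F u v)) \<partial>circ) \<partial>circ)
      \<le> (\<integral>\<^sup>+u. (\<integral>\<^sup>+v. ennreal (cmod (g u) * (real (Suc m) * B)) \<partial>circ) \<partial>circ)"
    proof (rule nn_integral_mono_AE)
      show "AE u in circ. (\<integral>\<^sup>+v. ennreal (cmod (F u v)) \<partial>circ)
          \<le> (\<integral>\<^sup>+v. ennreal (cmod (g u) * (real (Suc m) * B)) \<partial>circ)"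
        using AE_circ
      proof eventually_elim
        case (elim u)
        then show ?case
          by (intro nn_integral_mono_AE eventually_mono[OF AE_circ] ennreal_leI F_le)
      qed
    qed
    also have "\<dots> = (\<integral>\<^sup>+u. ennreal (cmod (g u)) \<partial>circ) * ennreal (real (Suc m) * B)"
      by (simp add: emeasure_circ ennreal_mult'' B0 nn_integral_multc del: of_nat_Suc)
    also have "\<dots> < \<infinity>"
      using g by (simp add: integrable_iff_bounded ennreal_mult_less_top)
    finally show ?thesis .
  qed
  have int: "integrable (circ \<Otimes>\<^sub>M circ) (case_prod F)"
  proof (rule integrableI_bounded)
    have "(\<integral>\<^sup>+w. ennreal (norm (case_prod F w)) \<partial>(circ \<Otimes>\<^sub>M circ))
      = (\<integral>\<^sup>+u. (\<integral>\<^sup>+v. ennreal (cmod (F u v)) \<partial>circ) \<partial>circ)"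
      by (subst circle.nn_integral_fst[symmetric]) simp_all
    with fin show "(\<integral>\<^sup>+w. ennreal (norm (case_prod F w)) \<partial>(circ \<Otimes>\<^sub>M circ)) < \<infinity>"
      by simp
  qed measurable
  have "(LINT v|circ. fejer_op m \<eta> g v * cnj (f v)) = (LINT v|circ. LINT u|circ. F u v)"
    unfolding fejer_op_def F_def by (simp add: mult.assoc flip: integral_mult_left_zero)
  also have "\<dots> = (LINT u|circ. LINT v|circ. F u v)"
    by (rule circle_pair.Fubini_integral[OF int])
  also have "\<dots> = (LINT u|circ. g u * cnj (fejer_op m (cnj \<eta>) f u))"
  proof (rule Bochner_Integration.integral_cong[OF refl])
    fix u
    have "cnj (fejer_op m (cnj \<eta>) f u) = (LINT v|circ. cnj (f v) * fejer m (v * cnj u * \<eta>))"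
      unfolding fejer_op_def by (subst Bochner_Integration.integral_cnj[symmetric]) (simp add: mult_ac flip: fejer_cnj)
    then show "(LINT v|circ. F u v) = g u * cnj (fejer_op m (cnj \<eta>) f u)"
      unfolding F_def by (simp add: mult_ac flip: integral_mult_right_zero)
  qed
  finally show ?thesis .
qed

text \<open>The image h is tested against f = |h|^(p-1) sgn h, for which both h * cnj f and |f|^q
  equal |h|^p on the circle; the operator is moved to f, where the bound for q \<le> 2 holds. The
  integral H of |h|^p is finite since h is continuous, so a part of it can be absorbed.\<close>

lemma fejer_op_bound_ge_2:
  assumes p: "2 \<le> p"
  shows "\<exists>A. fejer_bounded p A"
proof -
  define q where "q = p / (p - 1)"
  have q: "1 < q" "q \<le> 2" "1 / p + 1 / q = 1" "(p - 1) * q = p"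
    using p by (auto simp: q_def field_simps)
  obtain A where "fejer_bounded q A"
    using fejer_op_bound_le_2[OF q(1,2)] by blast
  note A = this[THEN conjunct1] and bound = this[THEN conjunct2, rule_format]
  \<comment> \<open>Chosen so that Young's inequality returns H / 2, which the left-hand side
    absorbs.\<close>
  define \<delta> where "\<delta> = (1 / (2 * A)) powr (1 / q)"
  have \<delta>: "0 < \<delta>" "\<delta> powr q * A = 1 / 2"
    using A q by (simp_all add: \<delta>_def powr_powr)
  have "lp_power circ p (fejer_op m \<eta> g)
      \<le> ennreal (2 * (1 / \<delta>) powr p) * lp_power circ p g"
    if \<eta>: "cmod \<eta> = 1" and g: "integrable circ g" for m \<eta> g
  proof (cases "lp_power circ p g = \<infinity>")
    case True
    then show ?thesis using \<delta> by (simp add: ennreal_mult_top)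
  next
    case False
    have [measurable]: "g \<in> borel_measurable borel" using borel_measurable_integrable[OF g] by simp
    have int_gp: "integrable circ (\<lambda>u. cmod (g u) powr p)"
      using False by (intro integrableI_bounded) (auto simp: less_top)
    define I where "I = (LINT u|circ. cmod (g u) powr p)"
    define h where "h = fejer_op m \<eta> g"
    have [measurable]: "h \<in> borel_measurable borel" unfolding h_def by (rule borel_measurable_fejer_op[OF g])
    have hcont: "continuous_on unit_circle h"
      unfolding h_def by (rule holomorphic_on_imp_continuous_on[OF holomorphic_fejer_op[OF g]])
    then obtain M where "\<forall>v\<in>unit_circle. cmod (h v) \<le> M"
      using compact_imp_bounded[OF compact_continuous_image[OF hcont]] by (auto simp: bounded_iff)
    then have M: "\<And>v. cmod v = 1 \<Longrightarrow> cmod (h v) \<le> M" by simp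
    \<comment> \<open>Zero off the circle so that f is bounded on the whole plane, as
      \<open>fejer_op_adjoint\<close> asks.\<close>
    define f where "f v = (if cmod v = 1 then of_real (cmod (h v) powr (p - 1)) * sgn (h v) else 0)" for v
    have [measurable]: "f \<in> borel_measurable borel"
      unfolding f_def sgn_div_norm by measurable
    have f_le: "cmod (f v) \<le> M powr (p - 1)" for v
      using M[of v] p by (auto simp: f_def norm_mult norm_sgn intro!: powr_mono2)
    have cmod_f: "cmod (f v) powr q = cmod (h v) powr p" if "cmod v = 1" for v
      using that q by (auto simp: f_def norm_mult norm_sgn powr_powr)
    have hf: "h v * cnj (f v) = of_real (cmod (h v) powr p)" if "cmod v = 1" for v
    proof (cases "h v = 0")
      case False
      have "h v * cnj (f v) = of_real (cmod (h v) powr (p - 1)) * (h v * cnj (h v)) / of_real (cmod (h v))"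
        using that by (simp add: f_def sgn_div_norm scaleR_conv_of_real divide_inverse)
      also have "\<dots> = of_real (cmod (h v) powr (p - 1) * (cmod (h v))\<^sup>2 / cmod (h v))"
        by (simp add: complex_norm_square[symmetric])
      also have "cmod (h v) powr (p - 1) * (cmod (h v))\<^sup>2 / cmod (h v) = cmod (h v) powr p"
        using False by (simp add: powr_diff power2_eq_square)
      finally show ?thesis .
    qed (use p in \<open>simp add: f_def\<close>)
    have f_int: "integrable circ f"
      using f_le by (intro circle.integrable_const_bound[where B = "M powr (p - 1)"]) auto
    define T where "T = fejer_op m (cnj \<eta>) f"
    have [measurable]: "T \<in> borel_measurable borel" unfolding T_def by (rule borel_measurable_fejer_op[OF f_int])
    have int_hp: "integrable circ (\<lambda>v. cmod (h v) powr p)"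
    proof (rule circle.integrable_const_bound[where B = "M powr p"])
      show "AE v in circ. norm (cmod (h v) powr p) \<le> M powr p"
        using AE_circ by eventually_elim (use M p in \<open>auto intro!: powr_mono2\<close>)
    qed measurable
    define H where "H = (LINT v|circ. cmod (h v) powr p)"
    have "lp_power circ q T
      \<le> ennreal A * lp_power circ q f"
      unfolding T_def using \<eta> by (intro bound f_int) simp
    also have "lp_power circ q f = lp_power circ p h"
      using AE_circ by (intro nn_integral_cong_AE) (auto elim!: eventually_mono simp: cmod_f)
    also have "\<dots> = ennreal H"
      unfolding H_def by (intro nn_integral_eq_integral int_hp) simp
    finally have Tq: "lp_power circ q T \<le> ennreal (A * H)"
      using A by (simp add: ennreal_mult')
    have H0: "0 \<le> H" "0 \<le> I" by (simp_all add: H_def I_def)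
    have int_Tq: "integrable circ (\<lambda>u. cmod (T u) powr q)"
      using le_less_trans[OF Tq] by (intro integrableI_bounded) auto
    have Tq': "(LINT u|circ. cmod (T u) powr q) \<le> A * H"
      using Tq A H0 by (subst (asm) nn_integral_eq_integral[OF int_Tq]) (auto simp: ennreal_le_iff)
    have young: "cmod (g u) * cmod (T u) \<le> (1 / \<delta>) powr p * cmod (g u) powr p + \<delta> powr q * cmod (T u) powr q" for u
    proof -
      have "(cmod (g u) / \<delta>) * (\<delta> * cmod (T u)) \<le> (cmod (g u) / \<delta>) powr p / p + (\<delta> * cmod (T u)) powr q / q"
        using \<delta> p q by (intro Youngs_inequality) auto
      also have "\<dots> \<le> (cmod (g u) / \<delta>) powr p + (\<delta> * cmod (T u)) powr q"
      proof (rule add_mono)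
        have "x / r \<le> x" if "0 \<le> x" "1 < r" for x r :: real
          using that divide_left_mono[of 1 r x] by simp
        then show "(cmod (g u) / \<delta>) powr p / p \<le> (cmod (g u) / \<delta>) powr p"
          "(\<delta> * cmod (T u)) powr q / q \<le> (\<delta> * cmod (T u)) powr q"
          using p q by simp_all
      qed
      also have "(cmod (g u) / \<delta>) * (\<delta> * cmod (T u)) = cmod (g u) * cmod (T u)"
        using \<delta> by simp
      also have "(cmod (g u) / \<delta>) powr p + (\<delta> * cmod (T u)) powr q
          = (1 / \<delta>) powr p * cmod (g u) powr p + \<delta> powr q * cmod (T u) powr q"
        using \<delta> by (simp add: powr_mult powr_divide)
      finally show ?thesis .
    qed
    have "complex_of_real H = (LINT v|circ. h v * cnj (f v))"
      unfolding H_def integral_complex_of_real[symmetric]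
      using AE_circ by (intro integral_cong_AE) (auto elim!: eventually_mono simp: hf)
    also have "\<dots> = (LINT u|circ. g u * cnj (T u))"
      unfolding h_def T_def by (rule fejer_op_adjoint[OF \<eta> g _ f_le]) measurable
    finally have "H = cmod (LINT u|circ. g u * cnj (T u))"
      using H0 by (metis abs_of_nonneg norm_of_real)
    also have "\<dots> \<le> (LINT u|circ. cmod (g u * cnj (T u)))"
      by (rule integral_norm_bound)
    also have "\<dots> \<le> (LINT u|circ. (1 / \<delta>) powr p * cmod (g u) powr p + \<delta> powr q * cmod (T u) powr q)"
      using young int_gp int_Tq
      by (intro integral_mono' Bochner_Integration.integrable_add integrable_mult_right)
        (auto simp: norm_mult)
    also have "\<dots> = (1 / \<delta>) powr p * I + \<delta> powr q * (LINT u|circ. cmod (T u) powr q)"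
      using int_gp int_Tq by (simp add: I_def)
    also have "\<dots> \<le> (1 / \<delta>) powr p * I + \<delta> powr q * (A * H)"
      by (intro add_left_mono mult_left_mono Tq') simp
    also have "\<dots> = (1 / \<delta>) powr p * I + H / 2"
      using \<delta>(2) by (simp flip: mult.assoc)
    finally have "H \<le> 2 * (1 / \<delta>) powr p * I" by simp
    then have "ennreal H \<le> ennreal (2 * (1 / \<delta>) powr p) * ennreal I"
      by (simp add: ennreal_leI flip: ennreal_mult')
    moreover have "lp_power circ p (fejer_op m \<eta> g) = ennreal H"
      using nn_integral_eq_integral[OF int_hp] by (simp add: H_def h_def)
    moreover have "lp_power circ p g = ennreal I"
      using nn_integral_eq_integral[OF int_gp] by (simp add: I_def)
    ultimately show ?thesis by simp
  qed
  moreover have "0 < 2 * (1 / \<delta>) powr p" using \<delta> by simp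
  ultimately show ?thesis by blast
qed

lemma fejer_op_bound:
  assumes "1 < p"
  shows "\<exists>A. fejer_bounded p A"
proof (cases "p \<le> 2")
  case True
  with assms show ?thesis by (rule fejer_op_bound_le_2)
next
  case False
  then show ?thesis by (intro fejer_op_bound_ge_2) simp
qed

section \<open>Kernels with summable second differences\<close>

text \<open>The boundary terms contain simple and double partial sums of e, of size at most (N +
  1)^2 M; the quadratic weight in the hypothesis makes them tend to 0.\<close>

lemma second_summation_by_parts:
  fixes a :: "nat \<Rightarrow> real" and e :: "nat \<Rightarrow> complex"
  assumes sum_a: "summable (\<lambda>n. (real n + 1)\<^sup>2 * \<bar>a n\<bar>)" and M: "\<And>n. cmod (e n) \<le> M"
  shows "(\<lambda>m. of_real (diff2 a m) * (\<Sum>j\<le>m. \<Sum>n\<le>j. e n)) sums (\<Sum>n. of_real (a n) * e n)"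
proof -
  define E where "E N = (\<Sum>n<N. e n)" for N
  define S where "S N = (\<Sum>j<N. \<Sum>n\<le>j. e n)" for N
  have M0: "0 \<le> M" using M[of 0] norm_ge_zero order_trans by blast
  have parts: "(\<Sum>m<N. of_real (diff2 a m) * (\<Sum>j\<le>m. \<Sum>n\<le>j. e n))
    = (\<Sum>n<N. of_real (a n) * e n) - (of_real (a N) * E N + of_real (a N - a (Suc N)) * S N)" for N
  proof (induction N)
    case (Suc N)
    have SN: "(\<Sum>j\<le>N. \<Sum>n\<le>j. e n) = S N + E N + e N"
      by (simp add: S_def E_def flip: lessThan_Suc_atMost)
    have "S (Suc N) = S N + E N + e N" "E (Suc N) = E N + e N"
      by (simp_all add: S_def E_def flip: lessThan_Suc_atMost)
    with Suc.IH SN show ?case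
      by (simp add: diff2_def algebra_simps)
  qed (simp add: E_def S_def)
  have E_le: "cmod (E N) \<le> (real N + 1) * M" for N
  proof -
    have "cmod (E N) \<le> (\<Sum>n<N. M)" unfolding E_def by (rule sum_norm_le) (rule M)
    also have "\<dots> \<le> (real N + 1) * M" using M0 by (simp add: mult_right_mono)
    finally show ?thesis .
  qed
  have S_le: "cmod (S N) \<le> (real N + 1)\<^sup>2 * M" for N
  proof -
    have "cmod (S N) \<le> (\<Sum>j<N. (real N + 1) * M)"
      unfolding S_def
    proof (rule sum_norm_le)
      fix j assume "j \<in> {..<N}"
      have "cmod (\<Sum>n\<le>j. e n) = cmod (E (Suc j))" by (simp add: E_def lessThan_Suc_atMost)
      also have "\<dots> \<le> (real (Suc j) + 1) * M" by (rule E_le)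
      also have "\<dots> \<le> (real N + 1) * M" using M0 \<open>j \<in> {..<N}\<close> by (intro mult_right_mono) auto
      finally show "cmod (\<Sum>n\<le>j. e n) \<le> (real N + 1) * M" .
    qed
    also have "\<dots> \<le> (real N + 1)\<^sup>2 * M"
      using M0 by (simp add: power2_eq_square mult_right_mono flip: mult.assoc)
    finally show ?thesis .
  qed
  have lim: "(\<lambda>n. (real n + 1)\<^sup>2 * \<bar>a n\<bar>) \<longlonglongrightarrow> 0"
    using sum_a by (rule summable_LIMSEQ_zero)
  have "(\<lambda>N. of_real (a N) * E N + of_real (a N - a (Suc N)) * S N) \<longlonglongrightarrow> 0"
  proof (rule Lim_null_comparison)
    show "(\<lambda>N. M * (2 * ((real N + 1)\<^sup>2 * \<bar>a N\<bar>) + (real (Suc N) + 1)\<^sup>2 * \<bar>a (Suc N)\<bar>)) \<longlonglongrightarrow> 0"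
      using tendsto_mult_left[OF tendsto_add[OF tendsto_mult_left[OF lim, of 2] LIMSEQ_Suc[OF lim]], of M] by simp
    show "\<forall>\<^sub>F N in sequentially. cmod (of_real (a N) * E N + of_real (a N - a (Suc N)) * S N)
      \<le> M * (2 * ((real N + 1)\<^sup>2 * \<bar>a N\<bar>) + (real (Suc N) + 1)\<^sup>2 * \<bar>a (Suc N)\<bar>)"
    proof (rule always_eventually, rule allI)
      fix N
      have sq: "(real N + 1) * M \<le> (real N + 1)\<^sup>2 * M" "(real N + 1)\<^sup>2 * M \<le> (real (Suc N) + 1)\<^sup>2 * M"
        using M0 by (auto intro!: mult_right_mono self_le_power power_mono)
      have "cmod (of_real (a N) * E N + of_real (a N - a (Suc N)) * S N)
        \<le> \<bar>a N\<bar> * cmod (E N) + \<bar>a N - a (Suc N)\<bar> * cmod (S N)"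
        by (rule order_trans[OF norm_triangle_ineq]) (simp only: norm_mult norm_of_real order_refl)
      also have "\<dots> \<le> \<bar>a N\<bar> * ((real N + 1)\<^sup>2 * M) + (\<bar>a N\<bar> + \<bar>a (Suc N)\<bar>) * ((real N + 1)\<^sup>2 * M)"
        using E_le[of N] S_le[of N] sq M0 by (intro add_mono mult_mono) auto
      also have "\<dots> \<le> \<bar>a N\<bar> * ((real N + 1)\<^sup>2 * M) + (\<bar>a N\<bar> * ((real N + 1)\<^sup>2 * M) + \<bar>a (Suc N)\<bar> * ((real (Suc N) + 1)\<^sup>2 * M))"
        using sq(2) by (simp only: distrib_right) (intro add_mono mult_left_mono order_refl, auto)
      also have "\<dots> = M * (2 * ((real N + 1)\<^sup>2 * \<bar>a N\<bar>) + (real (Suc N) + 1)\<^sup>2 * \<bar>a (Suc N)\<bar>)"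
        by (simp add: algebra_simps)
      finally show "cmod (of_real (a N) * E N + of_real (a N - a (Suc N)) * S N)
        \<le> M * (2 * ((real N + 1)\<^sup>2 * \<bar>a N\<bar>) + (real (Suc N) + 1)\<^sup>2 * \<bar>a (Suc N)\<bar>)" .
    qed
  qed
  moreover have "(\<lambda>N. \<Sum>n<N. of_real (a n) * e n) \<longlonglongrightarrow> (\<Sum>n. of_real (a n) * e n)"
  proof (rule summable_LIMSEQ, rule summable_comparison_test')
    show "summable (\<lambda>n. M * ((real n + 1)\<^sup>2 * \<bar>a n\<bar>))" by (rule summable_mult[OF sum_a])
    show "norm (of_real (a n) * e n) \<le> M * ((real n + 1)\<^sup>2 * \<bar>a n\<bar>)" for n
    proof -
      have "norm (of_real (a n) * e n) \<le> \<bar>a n\<bar> * M" unfolding norm_mult using M by (simp add: mult_left_mono)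
      also have "\<dots> \<le> (real n + 1)\<^sup>2 * (\<bar>a n\<bar> * M)"
        using M0 mult_right_mono[of 1 "(real n + 1)\<^sup>2" "\<bar>a n\<bar> * M"] by simp
      finally show ?thesis by (simp add: mult_ac)
    qed
  qed
  ultimately show ?thesis
    unfolding sums_def parts using tendsto_diff by fastforce
qed

abbreviation circ_conv :: "(nat \<Rightarrow> real) \<Rightarrow> complex \<Rightarrow> (complex \<Rightarrow> complex) \<Rightarrow> complex \<Rightarrow> complex" where
  "circ_conv a \<eta> g v \<equiv> (LINT u|circ. g u * (\<Sum>n. of_real (a n) * (v * cnj u * \<eta>) ^ n))"

text \<open>The operator is a combination of the \<open>fejer_op m\<close> with coefficients of
  total modulus at most W. Jensen's inequality over m takes the place of Minkowski's: it gives
  W^(p-1), and summing the coefficients gives the last factor W.\<close>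

lemma circle_kernel_bound:
  assumes p: "1 < p"
  shows "\<exists>A>0. \<forall>a \<eta> g W. cmod \<eta> = 1 \<longrightarrow> integrable circ g \<longrightarrow>
    summable (\<lambda>n. (real n + 1)\<^sup>2 * \<bar>a n\<bar>) \<longrightarrow> (\<forall>N. diff2_sum a N \<le> W) \<longrightarrow>
    lp_power circ p (circ_conv a \<eta> g)
      \<le> ennreal (A * W powr p) * lp_power circ p g"
proof -
  obtain A where "fejer_bounded p A"
    using fejer_op_bound[OF p] by blast
  note A = this[THEN conjunct1] and bound = this[THEN conjunct2, rule_format]
  have "lp_power circ p (circ_conv a \<eta> g)
      \<le> ennreal (A * W powr p) * lp_power circ p g"
    if \<eta>: "cmod \<eta> = 1" and g: "integrable circ g"
      and sum_a: "summable (\<lambda>n. (real n + 1)\<^sup>2 * \<bar>a n\<bar>)"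
      and W: "\<forall>N. diff2_sum a N \<le> W" for a \<eta> g W
  proof -
    define I where "I = lp_power circ p g"
    define lam where "lam m = (real m + 1) * \<bar>diff2 a m\<bar>" for m
    have lam0: "0 \<le> lam m" for m by (simp add: lam_def)
    have W0: "0 \<le> W" using W[rule_format, of 0] by simp
    have lam_summable: "summable lam"
      using W lam0 by (intro summableI_nonneg_bounded[where x = W]) (auto simp: lam_def)
    have lam_sum: "(\<Sum>m. ennreal (lam m)) \<le> ennreal W"
    proof -
      have "suminf lam \<le> W" using W by (intro suminf_le_const lam_summable) (auto simp: lam_def)
      then show ?thesis
        using suminf_ennreal2[OF lam0 lam_summable] by (simp add: ennreal_leI)
    qed
    have meas [measurable]: "fejer_op m \<eta> g \<in> borel_measurable borel" for m
      by (rule borel_measurable_fejer_op[OF g])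
    define X where "X v = circ_conv a \<eta> g v" for v
    have abs_a: "summable (\<lambda>n. \<bar>a n\<bar>)"
    proof (rule summable_comparison_test'[OF sum_a])
      show "norm \<bar>a n\<bar> \<le> (real n + 1)\<^sup>2 * \<bar>a n\<bar>" for n
        using mult_right_mono[of 1 "(real n + 1)\<^sup>2" "\<bar>a n\<bar>"] by simp
    qed
    \<comment> \<open>Termwise integration turns the kernel series into one in the Fourier
      coefficients of g. These are bounded by the L^1 norm of g, which is what summation by parts
      needs.\<close>
    have X_sums: "(\<lambda>m. of_real (diff2 a m * (real m + 1)) * fejer_op m \<eta> g v) sums X v"
      if v: "cmod v = 1" for v
    proof -
      define e where "e n = (v * \<eta>) ^ n * circle_coeff g n" for n
      have e_le: "cmod (e n) \<le> (LINT u|circ. cmod (g u))" for n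
      proof -
        have "cmod (e n) = cmod (LINT u|circ. g u * cnj u ^ n)"
          using v \<eta> by (simp add: e_def norm_mult norm_power circle_coeff_def)
        also have "\<dots> \<le> (LINT u|circ. cmod (g u * cnj u ^ n))"
          by (rule integral_norm_bound)
        also have "\<dots> = (LINT u|circ. cmod (g u))"
          using borel_measurable_integrable[OF g] AE_circ
          by (intro integral_cong_AE) (auto elim!: eventually_mono simp: norm_mult norm_power)
        finally show ?thesis .
      qed
      define F where "F = (\<lambda>n u. of_real (a n) * ((v * \<eta>) ^ n * (g u * cnj u ^ n)))"
      have F_int: "integrable circ (F n)" for n
        unfolding F_def by (intro integrable_mult_right integrable_circle_coeff[OF g])
      have F_norm: "AE u in circ. \<forall>n. norm (F n u) = \<bar>a n\<bar> * cmod (g u)"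
        using AE_circ by eventually_elim (use v \<eta> in \<open>simp add: F_def norm_mult norm_power\<close>)
      have "X v = (LINT u|circ. (\<Sum>n. F n u))"
      proof -
        have "g u * (\<Sum>n. of_real (a n) * (v * cnj u * \<eta>) ^ n) = (\<Sum>n. F n u)" if u: "cmod u = 1" for u
        proof -
          have "summable (\<lambda>n. of_real (a n) * (v * cnj u * \<eta>) ^ n)"
            using u v \<eta> by (intro summable_norm_cancel[OF summable_cong[THEN iffD1, OF _ abs_a]])
              (auto simp: norm_mult norm_power intro!: always_eventually)
          from suminf_mult[OF this, of "g u"] show ?thesis
            by (simp add: F_def power_mult_distrib mult_ac)
        qed
        moreover have "(\<lambda>u. \<Sum>n. F n u) \<in> borel_measurable circ"
          "(\<lambda>u. g u * (\<Sum>n. of_real (a n) * (v * cnj u * \<eta>) ^ n)) \<in> borel_measurable circ"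
          using borel_measurable_integrable[OF g] borel_measurable_integrable[OF F_int] by measurable
        ultimately show ?thesis
          unfolding X_def using AE_circ
          by (intro integral_cong_AE) (auto elim!: eventually_mono)
      qed
      also have "\<dots> = (\<Sum>n. integral\<^sup>L circ (F n))"
      proof (rule integral_suminf[OF F_int])
        show "AE u in circ. summable (\<lambda>n. norm (F n u))"
          using F_norm by eventually_elim (simp add: summable_mult2 abs_a)
        have "(LINT u|circ. norm (F n u)) = \<bar>a n\<bar> * (LINT u|circ. cmod (g u))" for n
        proof -
          have "(LINT u|circ. norm (F n u)) = (LINT u|circ. \<bar>a n\<bar> * cmod (g u))"
            using borel_measurable_integrable[OF g] borel_measurable_integrable[OF F_int[of n]] F_norm
            by (intro integral_cong_AE) (auto elim!: eventually_mono)
          then show ?thesis by simp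
        qed
        then show "summable (\<lambda>n. LINT u|circ. norm (F n u))"
          by (simp add: summable_mult2 abs_a)
      qed
      also have "\<dots> = (\<Sum>n. of_real (a n) * e n)"
        by (simp add: F_def e_def circle_coeff_def)
      finally have X: "X v = \<dots>" .
      have "of_real (diff2 a m) * (\<Sum>j\<le>m. \<Sum>n\<le>j. e n)
         = of_real (diff2 a m * (real m + 1)) * fejer_op m \<eta> g v" for m
      proof -
        have "of_real (real m + 1) * fejer_op m \<eta> g v = (\<Sum>j\<le>m. \<Sum>n\<le>j. e n)"
          unfolding fejer_op_eq[OF g] e_def using of_nat_neq_0[of m, where 'a = complex] by (simp add: add.commute)
        then show ?thesis by (simp only: of_real_mult mult.assoc)
      qed
      with second_summation_by_parts[of a e, OF sum_a e_le] show ?thesis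
        by (simp add: X)
    qed
    have X_le: "ennreal (cmod (X v) powr p)
        \<le> ennreal (W powr (p - 1)) * (\<Sum>m. ennreal (cmod (fejer_op m \<eta> g v) powr p * lam m))"
      if v: "cmod v = 1" for v
    proof -
      have "ennreal (cmod (X v) powr p) \<le> ennreal (W powr (p - 1)) *
        (\<integral>\<^sup>+m. ennreal (cmod (fejer_op m \<eta> g v) powr p * lam m) \<partial>count_space UNIV)"
      proof (rule weighted_Jensen_powr)
        show "(\<integral>\<^sup>+m. ennreal (lam m) \<partial>count_space UNIV) \<le> ennreal W"
          by (simp add: nn_integral_count_space_nat lam_sum)
        let ?P = "\<lambda>N. cmod (\<Sum>m<N. of_real (diff2 a m * (real m + 1)) * fejer_op m \<eta> g v)"
        have "(\<lambda>N. ennreal (?P N))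
            \<longlonglongrightarrow> ennreal (cmod (X v))"
          using X_sums[OF v] by (intro tendsto_intros) (simp add: sums_def)
        then show "ennreal (cmod (X v)) \<le> (\<integral>\<^sup>+m. ennreal (cmod (fejer_op m \<eta> g v) * lam m) \<partial>count_space UNIV)"
        proof (rule LIMSEQ_le_const2, intro exI[of _ 0] allI impI)
          fix N
          have "?P N
            \<le> (\<Sum>m<N. cmod (fejer_op m \<eta> g v) * lam m)"
            by (rule sum_norm_le) (simp only: norm_mult norm_of_real, simp add: lam_def abs_mult)
          then have "ennreal (?P N)
            \<le> (\<Sum>m<N. ennreal (cmod (fejer_op m \<eta> g v) * lam m))"
            by (simp add: sum_ennreal lam0 ennreal_leI)
          also have "\<dots> \<le> (\<Sum>m. ennreal (cmod (fejer_op m \<eta> g v) * lam m))"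
            by (intro sum_le_suminf) auto
          finally show "ennreal (?P N)
            \<le> (\<integral>\<^sup>+m. ennreal (cmod (fejer_op m \<eta> g v) * lam m) \<partial>count_space UNIV)"
            by (simp add: nn_integral_count_space_nat)
        qed
      qed (use p W0 lam0 in auto)
      then show ?thesis by (simp add: nn_integral_count_space_nat)
    qed
    have "lp_power circ p X
      \<le> (\<integral>\<^sup>+v. ennreal (W powr (p - 1)) * (\<Sum>m. ennreal (cmod (fejer_op m \<eta> g v) powr p * lam m)) \<partial>circ)"
      by (intro nn_integral_mono_AE eventually_mono[OF AE_circ] X_le)
    also have "\<dots> = ennreal (W powr (p - 1)) * (\<Sum>m. (\<integral>\<^sup>+v. ennreal (cmod (fejer_op m \<eta> g v) powr p * lam m) \<partial>circ))"
      by (simp add: nn_integral_cmult nn_integral_suminf)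
    also have "\<dots> = ennreal (W powr (p - 1)) * (\<Sum>m. ennreal (lam m) * lp_power circ p (fejer_op m \<eta> g))"
      by (simp add: ennreal_mult'' lam0 nn_integral_cmult mult.commute)
    also have "\<dots> \<le> ennreal (W powr (p - 1)) * (\<Sum>m. ennreal (lam m) * (ennreal A * I))"
      unfolding I_def by (intro mult_left_mono suminf_le bound \<eta> g) auto
    also have "\<dots> = ennreal (W powr (p - 1)) * ((\<Sum>m. ennreal (lam m)) * (ennreal A * I))"
      by (simp add: ennreal_suminf_multc)
    also have "\<dots> \<le> ennreal (W powr (p - 1)) * (ennreal W * (ennreal A * I))"
      by (intro mult_left_mono mult_right_mono lam_sum) auto
    also have "\<dots> = ennreal (A * W powr p) * I"
    proof -
      have "W powr (p - 1) * W = W powr p"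
        using p W0 by (cases "W = 0") (auto simp: powr_diff)
      then have "ennreal (A * W powr p) = ennreal (W powr (p - 1)) * (ennreal W * ennreal A)"
        using W0 A by (simp flip: ennreal_mult' add: mult_ac)
      then show ?thesis by (simp add: mult.assoc)
    qed
    finally show ?thesis by (simp add: X_def I_def)
  qed
  with A show ?thesis by blast
qed

section \<open>Radial measures with the doubling property\<close>

lemma nn_integral_layer_cake:
  fixes X :: "'a \<Rightarrow> real"
  assumes M: "sigma_finite_measure M" and [measurable]: "X \<in> borel_measurable M" and X: "\<And>x. 0 \<le> X x"
  shows "(\<integral>\<^sup>+x. ennreal (X x) \<partial>M)
    = (\<integral>\<^sup>+y. emeasure M {x \<in> space M. y \<le> X x} * indicator {0<..} y \<partial>lborel)"
proof -
  interpret sigma_finite_measure M by (rule M)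
  interpret pair_sigma_finite M lborel ..
  have "(\<integral>\<^sup>+x. ennreal (X x) \<partial>M) = (\<integral>\<^sup>+x. \<integral>\<^sup>+y. indicator {0<..X x} y \<partial>lborel \<partial>M)"
    using X by simp
  also have "\<dots> = (\<integral>\<^sup>+x. \<integral>\<^sup>+y. indicator {x \<in> space M. y \<le> X x} x * indicator {0<..} y \<partial>lborel \<partial>M)"
    by (intro nn_integral_cong) (auto split: split_indicator)
  also have "\<dots> = (\<integral>\<^sup>+y. \<integral>\<^sup>+x. indicator {x \<in> space M. y \<le> X x} x * indicator {0<..} y \<partial>M \<partial>lborel)"
  proof (rule Fubini'[symmetric])
    have "(\<lambda>(x, y). indicator {w \<in> space (M \<Otimes>\<^sub>M lborel). snd w \<le> X (fst w)} (x, y) * indicator {0<..} y :: ennreal)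
        \<in> borel_measurable (M \<Otimes>\<^sub>M lborel)"
      by measurable
    then show "(\<lambda>(x, y). indicator {x \<in> space M. y \<le> X x} x * indicator {0<..} y :: ennreal)
        \<in> borel_measurable (M \<Otimes>\<^sub>M lborel)"
      by (rule measurable_cong[THEN iffD1, rotated]) (auto simp: space_pair_measure split: split_indicator)
  qed
  also have "\<dots> = (\<integral>\<^sup>+y. emeasure M {x \<in> space M. y \<le> X x} * indicator {0<..} y \<partial>lborel)"
    by (simp add: nn_integral_multc)
  finally show ?thesis .
qed

text \<open>Superlevel sets are compared at every level and the layer cake formula does the rest.
  The two measures may live on different spaces, so a measure on the disc can be compared with
  Lebesgue measure on a half-line.\<close>

lemma nn_integral_dominated_distribution:
  fixes X :: "'a \<Rightarrow> real" and Y :: "'b \<Rightarrow> real"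
  assumes M: "sigma_finite_measure M" and X: "X \<in> borel_measurable M" "\<And>x. 0 \<le> X x"
    and N: "sigma_finite_measure N" and Y [measurable]: "Y \<in> borel_measurable N" "\<And>x. 0 \<le> Y x"
    and le: "\<And>y. 0 < y \<Longrightarrow> emeasure M {x \<in> space M. y \<le> X x} \<le> K * emeasure N {x \<in> space N. y \<le> Y x}"
  shows "(\<integral>\<^sup>+x. ennreal (X x) \<partial>M) \<le> K * (\<integral>\<^sup>+x. ennreal (Y x) \<partial>N)"
proof -
  have "(\<integral>\<^sup>+x. ennreal (X x) \<partial>M) \<le> (\<integral>\<^sup>+y. K * (emeasure N {x \<in> space N. y \<le> Y x} * indicator {0<..} y) \<partial>lborel)"
    unfolding nn_integral_layer_cake[OF M X]
    by (intro nn_integral_mono) (use le in \<open>auto split: split_indicator simp: mult.assoc[symmetric]\<close>)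
  also have "\<dots> = K * (\<integral>\<^sup>+x. ennreal (Y x) \<partial>N)"
  proof -
    interpret sigma_finite_measure N by (rule N)
    have "(\<lambda>y. emeasure N (Pair y -` {w \<in> space (lborel \<Otimes>\<^sub>M N). fst w \<le> Y (snd w)})) \<in> borel_measurable lborel"
      by (rule measurable_emeasure_Pair) measurable
    also have "(\<lambda>y. emeasure N (Pair y -` {w \<in> space (lborel \<Otimes>\<^sub>M N). fst w \<le> Y (snd w)}))
      = (\<lambda>y. emeasure N {x \<in> space N. y \<le> Y x})"
      by (intro ext arg_cong[where f = "emeasure N"]) (auto simp: space_pair_measure)
    finally have [measurable]: "(\<lambda>y. emeasure N {x \<in> space N. y \<le> Y x}) \<in> borel_measurable lborel" .
    show ?thesis
      unfolding nn_integral_layer_cake[OF N Y] by (intro nn_integral_cmult) measurable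
  qed
  finally show ?thesis .
qed

text \<open>Powers u^(-a) with 0 < a < 1 are eigenfunctions of the Hardy kernel 1 / max u v on the
  half-line: the part below v gives 1 / (1 - a), the part above v gives 1 / a.\<close>

lemma nn_integral_hardy_weight:
  fixes a v :: real
  assumes a: "0 < a" "a < 1" and v: "0 < v"
  shows "(\<integral>\<^sup>+u. ennreal (indicator {0<..} u * (u powr - a / max u v)) \<partial>lborel)
    \<le> ennreal ((1 / (1 - a) + 1 / a) * v powr - a)"
proof -
  have "(\<integral>\<^sup>+u. ennreal (indicator {0<..} u * (u powr - a / max u v)) \<partial>lborel)
    \<le> (\<integral>\<^sup>+u. ennreal (u powr - a / v) * indicator {0..v} u + ennreal (u powr (- a - 1)) * indicator {v..} u \<partial>lborel)"
  proof (rule nn_integral_mono)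
    fix u :: real
    show "ennreal (indicator {0<..} u * (u powr - a / max u v))
      \<le> ennreal (u powr - a / v) * indicator {0..v} u + ennreal (u powr (- a - 1)) * indicator {v..} u"
    proof -
      consider "u \<le> 0" | "0 < u" "u \<le> v" | "v < u" by linarith
      then show ?thesis
      proof cases
        case 1
        then show ?thesis by simp
      next
        case 2
        then show ?thesis by (simp add: max_def)
      next
        case 3
        then have "u powr - a / max u v = u powr (- a - 1)"
          using v by (simp add: powr_diff)
        then show ?thesis using 3 by (auto split: split_indicator)
      qed
    qed
  qed
  also have "\<dots> = (\<integral>\<^sup>+u. ennreal (u powr - a / v) * indicator {0..v} u \<partial>lborel)
      + (\<integral>\<^sup>+u. ennreal (u powr (- a - 1)) * indicator {v..} u \<partial>lborel)"
    by (rule nn_integral_add) measurable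
  also have "(\<integral>\<^sup>+u. ennreal (u powr - a / v) * indicator {0..v} u \<partial>lborel) = ennreal ((v powr (- a + 1) / (- a + 1)) / v)"
    using a v has_integral_divide[OF has_integral_powr_from_0[of "- a" v], of v]
    by (intro nn_integral_has_integral_lebesgue') auto
  also have "(\<integral>\<^sup>+u. ennreal (u powr (- a - 1)) * indicator {v..} u \<partial>lborel)
      = ennreal (- (v powr (- a - 1 + 1)) / (- a - 1 + 1))"
    using a v by (intro nn_integral_has_integral_lebesgue' has_integral_powr_to_inf) auto
  also have "ennreal ((v powr (- a + 1) / (- a + 1)) / v) + ennreal (- (v powr (- a - 1 + 1)) / (- a - 1 + 1))
      = ennreal ((1 / (1 - a) + 1 / a) * v powr - a)"
  proof -
    have "(v powr (- a + 1) / (- a + 1)) / v = v powr - a / (1 - a)"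
      using v powr_add[of v "- a" 1] by simp
    then show ?thesis
      using a by (simp add: distrib_right flip: ennreal_plus)
  qed
  finally show ?thesis .
qed

text \<open>The weight enters the estimates only through the measure \<omega> dA. Doubling is stated
  for the mass of {|z| \<ge> r}, which differs from \<open>tail_integral\<close> by the polar factor
  2 s in the integrand.\<close>

locale radial_disc_measure = finite_measure \<nu> for \<nu> :: "complex measure" +
  fixes C :: real
  assumes sets_eq [simp, measurable_cong]: "sets \<nu> = sets borel"
    and AE_disc: "AE z in \<nu>. cmod z < 1"
    and rotate: "\<And>f c. f \<in> borel_measurable borel \<Longrightarrow> cmod c = 1 \<Longrightarrow>
      (\<integral>\<^sup>+z. f (c * z) \<partial>\<nu>) = (\<integral>\<^sup>+z. f z \<partial>\<nu>)"
    and tail_pos: "\<And>r. 0 \<le> r \<Longrightarrow> r < 1 \<Longrightarrow> 0 < measure \<nu> {z. r \<le> cmod z}"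
    and tail_doubling: "\<And>r. 0 \<le> r \<Longrightarrow> r < 1 \<Longrightarrow>
      measure \<nu> {z. r \<le> cmod z} \<le> C * measure \<nu> {z. (1 + r) / 2 \<le> cmod z}"
begin

definition tail :: "real \<Rightarrow> real" where "tail r = measure \<nu> {z. r \<le> cmod z}"

text \<open>The kernel's denominators as even moments of the measure; \<open>moment_eq\<close>
  identifies them with twice the moments of order 2n + 1, the odd order coming from polar
  coordinates.\<close>

definition c :: "nat \<Rightarrow> real" where "c n = (LINT z|\<nu>. cmod z ^ (2 * n))"

lemma space_eq [simp]: "space \<nu> = UNIV"
  using sets_eq_imp_space_eq[OF sets_eq] by simp

lemma tail_antimono: "r \<le> s \<Longrightarrow> tail s \<le> tail r"
  unfolding tail_def by (rule finite_measure_mono) auto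

lemma tail_nonneg [simp]: "0 \<le> tail r"
  by (simp add: tail_def)

lemma borel_measurable_tail [measurable]: "tail \<in> borel_measurable borel"
proof -
  have "(\<lambda>r. - tail r) \<in> borel_measurable borel"
    by (rule borel_measurable_mono) (simp add: mono_def tail_antimono)
  then show ?thesis using borel_measurable_uminus by fastforce
qed

lemma tail_1: "1 \<le> r \<Longrightarrow> tail r = 0"
proof -
  assume r: "1 \<le> r"
  have "AE z in \<nu>. z \<notin> {z. r \<le> cmod z}" using AE_disc by eventually_elim (use r in auto)
  then have "{z. r \<le> cmod z} \<in> null_sets \<nu>" by (subst AE_iff_null_sets) auto
  then show ?thesis unfolding tail_def by (rule measure_eq_0_null_sets)
qed

lemma C_ge_1: "1 \<le> C"
proof -
  have "tail (1 / 2) * 1 \<le> tail 0" using tail_antimono[of 0 "1 / 2"] by simp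
  also have "\<dots> \<le> tail (1 / 2) * C" using tail_doubling[of 0] by (simp add: tail_def mult.commute)
  finally show ?thesis using tail_pos[of "1 / 2"] by (subst (asm) mult_le_cancel_left_pos) (auto simp: tail_def)
qed

lemma integrable_bounded:
  fixes f :: "complex \<Rightarrow> 'b::{banach, second_countable_topology}"
  assumes "f \<in> borel_measurable borel" "\<And>z. cmod z < 1 \<Longrightarrow> norm (f z) \<le> B"
  shows "integrable \<nu> f"
  using assms AE_disc by (intro integrable_const_bound[where B = B]) (auto elim!: eventually_mono)

lemma integrable_power: "integrable \<nu> (\<lambda>z. cmod z ^ k)"
  by (rule integrable_bounded[where B = 1]) (auto simp: power_le_one)

lemma c_ge:
  assumes r: "0 \<le> r"
  shows "r ^ (2 * n) * tail r \<le> c n"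
proof -
  have "r ^ (2 * n) * tail r = (LINT z|\<nu>. r ^ (2 * n) * indicator {z. r \<le> cmod z} z)"
    by (simp add: tail_def)
  also have "\<dots> \<le> c n"
    unfolding c_def using r
    by (intro integral_mono integrable_power integrable_mult_right integrable_real_indicator)
      (auto split: split_indicator intro: power_mono simp: emeasure_finite less_top[symmetric])
  finally show ?thesis .
qed

lemma c_pos: "0 < c n"
proof -
  have "0 < (1 / 2) ^ (2 * n) * tail (1 / 2)"
    using tail_pos[of "1 / 2"] by (simp add: tail_def)
  also have "\<dots> \<le> c n" by (rule c_ge) simp
  finally show ?thesis .
qed

lemma c_dec: "c (Suc n) \<le> c n"
  unfolding c_def using AE_disc
  by (intro integral_mono_AE integrable_power) (auto elim!: eventually_mono intro!: power_decreasing simp del: power_Suc mult_Suc_right)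

lemma c_convex: "c (Suc n) - c (Suc (Suc n)) \<le> c n - c (Suc n)"
proof -
  have "0 \<le> (LINT z|\<nu>. cmod z ^ (2 * n) * (1 - (cmod z)\<^sup>2)\<^sup>2)"
    by simp
  also have "\<dots> = (LINT z|\<nu>. cmod z ^ (2 * n) - 2 * cmod z ^ (2 * Suc n) + cmod z ^ (2 * Suc (Suc n)))"
    by (intro Bochner_Integration.integral_cong refl) (simp add: power2_eq_square algebra_simps)
  also have "\<dots> = c n - 2 * c (Suc n) + c (Suc (Suc n))"
    unfolding c_def by (simp only: Bochner_Integration.integral_diff Bochner_Integration.integral_add
        Bochner_Integration.integrable_diff integrable_power integrable_mult_right integral_mult_right_zero)
  finally show ?thesis by simp
qed

text \<open>The doubling condition says that the law of \<open>\<bar>z\<bar>\<close> is dominated by that of \<open>2\<bar>z\<bar> - 1\<close>,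
  and \<open>2 s - 1 \<le> s\<^sup>2\<close>.\<close>

lemma c_le_c_double: "c n \<le> C * c (2 * n)"
proof (cases "n = 0")
  case True
  then show ?thesis using C_ge_1 c_pos[of 0] mult_right_mono[of 1 C "c 0"] by simp
next
  case n: False
  have "ennreal (c n) = (\<integral>\<^sup>+z. ennreal (cmod z ^ (2 * n)) \<partial>\<nu>)"
    unfolding c_def by (intro nn_integral_eq_integral[symmetric] integrable_power) simp
  also have "\<dots> \<le> ennreal C * (\<integral>\<^sup>+z. ennreal (cmod z ^ (2 * (2 * n))) \<partial>\<nu>)"
  proof (rule nn_integral_dominated_distribution[OF sigma_finite_measure_axioms _ _ sigma_finite_measure_axioms])
    fix y :: real assume y: "0 < y"
    define r where "r = root (2 * n) y"
    have r: "0 < r" "r ^ (2 * n) = y" using y n by (auto simp: r_def)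
    have "{z \<in> space \<nu>. y \<le> cmod z ^ (2 * n)} = {z. r \<le> cmod z}"
      using r n by (auto simp flip: r(2) simp: power_mono_iff)
    then have eq: "emeasure \<nu> {z \<in> space \<nu>. y \<le> cmod z ^ (2 * n)} = ennreal (tail r)"
      by (simp add: tail_def emeasure_eq_measure)
    show "emeasure \<nu> {z \<in> space \<nu>. y \<le> cmod z ^ (2 * n)} \<le> ennreal C * emeasure \<nu> {z \<in> space \<nu>. y \<le> cmod z ^ (2 * (2 * n))}"
    proof (cases "r < 1")
      case True
      have "tail r \<le> C * tail ((1 + r) / 2)" using tail_doubling[of r] r True by (simp add: tail_def)
      also have "\<dots> \<le> C * measure \<nu> {z \<in> space \<nu>. y \<le> cmod z ^ (2 * (2 * n))}"
        unfolding tail_def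
      proof (intro mult_left_mono finite_measure_mono)
        have "y \<le> cmod z ^ (2 * (2 * n))" if "(1 + r) / 2 \<le> cmod z" for z
        proof -
          have "r \<le> ((1 + r) / 2)\<^sup>2" using zero_le_power2[of "1 - r"] by (simp add: power2_eq_square field_simps)
          also have "\<dots> \<le> (cmod z)\<^sup>2" using that r by (intro power_mono) auto
          finally have "r ^ (2 * n) \<le> ((cmod z)\<^sup>2) ^ (2 * n)" using r by (intro power_mono) auto
          then show ?thesis by (simp add: r flip: power_mult)
        qed
        then show "{z. (1 + r) / 2 \<le> cmod z} \<subseteq> {z \<in> space \<nu>. y \<le> cmod z ^ (2 * (2 * n))}" by auto
      qed (use C_ge_1 in auto)
      finally show ?thesis
        using C_ge_1 unfolding eq by (simp add: emeasure_eq_measure ennreal_leI flip: ennreal_mult')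
    next
      case False
      then show ?thesis unfolding eq by (simp add: tail_1)
    qed
  qed auto
  also have "\<dots> = ennreal (C * c (2 * n))"
    unfolding c_def using C_ge_1
    by (subst nn_integral_eq_integral[OF integrable_power]) (auto simp: ennreal_mult')
  finally show ?thesis
    using C_ge_1 c_pos[of "2 * n"] by (subst (asm) ennreal_le_iff) auto
qed

text \<open>Two uses of \<open>c_le_c_double\<close> reach the index 4n, which is at least 2n + 1
  for n \<ge> 1: hence \<open>C * C\<close>. The case n = 0 is paid for by the ratio
  \<open>c 0 / c 1\<close>.\<close>

sublocale c: doubling_convex_sequence c "max (C * C) (c 0 / c 1)"
proof
  fix n
  show "c n \<le> max (C * C) (c 0 / c 1) * c (2 * n + 1)"
  proof (cases "n = 0")
    case True
    have "c 0 = c 0 / c 1 * c 1" using c_pos[of 1] by simp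
    also have "\<dots> \<le> max (C * C) (c 0 / c 1) * c 1" using c_pos[of 1] by (intro mult_right_mono) auto
    finally show ?thesis using True by simp
  next
    case False
    have "c n \<le> C * c (2 * n)" by (rule c_le_c_double)
    also have "\<dots> \<le> C * (C * c (2 * (2 * n)))" using C_ge_1 by (intro mult_left_mono c_le_c_double) auto
    also have "\<dots> \<le> C * (C * c (2 * n + 1))"
      using C_ge_1 False lift_Suc_antimono_le[of c "2 * n + 1" "2 * (2 * n)", OF c_dec]
      by (intro mult_left_mono) auto
    also have "\<dots> \<le> max (C * C) (c 0 / c 1) * c (2 * n + 1)"
      unfolding mult.assoc[symmetric] using c_pos[of "2 * n + 1"] by (intro mult_right_mono) auto
    finally show ?thesis .
  qed
qed (rule c_pos c_dec c_convex)+

text \<open>By \<open>c_ge\<close>, c_n is at least a multiple of r^(2n) for any r < 1; choosing t <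
  r^2 < 1 leaves a geometric series with a quadratic factor.\<close>

lemma kernel_coeff_summable:
  assumes t: "0 \<le> t" "t < 1"
  shows "summable (\<lambda>n. (real n + 1)\<^sup>2 * \<bar>t ^ n / c n\<bar>)"
proof -
  define r where "r = sqrt ((1 + t) / 2)"
  define \<rho> where "\<rho> = t / r\<^sup>2"
  have r: "0 < r" "r < 1" "r\<^sup>2 = (1 + t) / 2" using t by (auto simp: r_def)
  have \<rho>: "0 \<le> \<rho>" "\<rho> < 1" using t by (auto simp: \<rho>_def r)
  have "summable (\<lambda>n. (real n + 1)\<^sup>2 * \<rho> ^ n)"
  proof (rule summableI_nonneg_bounded[where x = "2 / (1 - \<rho>) ^ Suc 2"])
    show "(\<Sum>n<N. (real n + 1)\<^sup>2 * \<rho> ^ n) \<le> 2 / (1 - \<rho>) ^ Suc 2" for N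
      using sum_power_geometric_le(1)[OF \<rho>, of 2 N] \<rho> by (simp add: field_simps del: power_Suc)
  qed (use \<rho> in auto)
  then have *: "summable (\<lambda>n. ((real n + 1)\<^sup>2 * \<rho> ^ n) / tail r)" by (rule summable_divide)
  show ?thesis
  proof (rule summable_comparison_test'[OF *])
    fix n
    have Tr: "0 < tail r" using tail_pos[of r] r by (simp add: tail_def)
    have "t ^ n / c n \<le> t ^ n / (r ^ (2 * n) * tail r)"
      using c_ge[of r n] c_pos[of n] r t Tr by (intro divide_left_mono) (auto intro!: mult_pos_pos)
    also have "\<dots> = \<rho> ^ n / tail r" by (simp add: \<rho>_def power_divide power_mult)
    finally have "(real n + 1)\<^sup>2 * (t ^ n / c n) \<le> (real n + 1)\<^sup>2 * (\<rho> ^ n / tail r)"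
      by (intro mult_left_mono) auto
    then show "norm ((real n + 1)\<^sup>2 * \<bar>t ^ n / c n\<bar>) \<le> ((real n + 1)\<^sup>2 * \<rho> ^ n) / tail r"
      using c_pos[of n] t by (simp add: abs_mult)
  qed
qed

text \<open>\<open>sum_diff2_le\<close> is evaluated at an m of order 1 / (1 - s), where s is
  essentially t. There s^(2m) is bounded below, so c_m is at least a multiple of the tail.\<close>

lemma kernel_diff2_le:
  "\<exists>A\<ge>0. \<forall>t N. 0 \<le> t \<longrightarrow> t < 1 \<longrightarrow>
     diff2_sum (\<lambda>n. t ^ n / c n) N \<le> A / tail t"
proof -
  obtain A where A: "\<And>t m N. 0 \<le> t \<Longrightarrow> t < 1 \<Longrightarrow> 1 \<le> (real m + 1) * (1 - t) \<Longrightarrow>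
     diff2_sum (\<lambda>n. t ^ n / c n) N \<le> A / c m"
    using c.sum_diff2_le by blast
  have A0: "0 \<le> A"
    using A[of 0 0 0] c_pos[of 0] by (simp add: zero_le_divide_iff)
  have "diff2_sum (\<lambda>n. t ^ n / c n) N \<le> (A * exp 4 * C) / tail t"
    if t: "0 \<le> t" "t < 1" for t N
  proof -
    \<comment> \<open>Staying above 1/2 makes - ln s comparable with 1 - s; passing from the tail at
      t to the tail at s costs one factor C.\<close>
    define s where "s = max t (1 / 2)"
    have s: "1 / 2 \<le> s" "s < 1" "t \<le> s" using t by (auto simp: s_def)
    define m where "m = nat \<lfloor>1 / (1 - s)\<rfloor>"
    have "real m \<le> 1 / (1 - s)" "1 / (1 - s) < real m + 1" using s by (auto simp: m_def)
    then have m: "real m * (1 - s) \<le> 1" "1 \<le> (real m + 1) * (1 - s)"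
      using s by (auto simp: field_simps)
    have "(real m + 1) * (1 - s) \<le> (real m + 1) * (1 - t)" using s by (intro mult_left_mono) auto
    then have le: "diff2_sum (\<lambda>n. t ^ n / c n) N \<le> A / c m"
      using m by (intro A t) linarith
    have Tt: "0 < tail t" using tail_pos[of t] t by (simp add: tail_def)
    have T_ts: "tail t \<le> C * tail s"
    proof (cases "1 / 2 \<le> t")
      case True
      then have "s = t" by (simp add: s_def)
      then show ?thesis using C_ge_1 mult_right_mono[of 1 C "tail t"] by simp
    next
      case False
      have "tail t \<le> tail 0" using t by (intro tail_antimono)
      also have "\<dots> \<le> C * tail (1 / 2)" using tail_doubling[of 0] by (simp add: tail_def)
      finally show ?thesis using False by (simp add: s_def max_def)
    qed
    \<comment> \<open>The exponent 4 results from - ln s \<le> 2 (1 - s) and m (1 - s) \<le>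
      1.\<close>
    have "exp (- 4) \<le> s ^ (2 * m)"
    proof -
      have "1 / s - 1 \<le> 2 * (1 - s)"
        using s mult_right_mono[of 1 "2 * s" "1 - s"] by (simp add: field_simps)
      moreover have "ln (1 / s) \<le> 1 / s - 1" using s by (intro ln_le_minus_one) auto
      ultimately have "- ln s \<le> 2 * (1 - s)" using s by (simp add: ln_div)
      then have "real (2 * m) * (- ln s) \<le> real (2 * m) * (2 * (1 - s))" by (intro mult_left_mono) auto
      also have "\<dots> \<le> 4" using m(1) by (simp add: algebra_simps)
      finally have "exp (- 4) \<le> exp (real (2 * m) * ln s)" by simp
      also have "\<dots> = s ^ (2 * m)" using s by (simp only: exp_of_nat_mult) simp
      finally show ?thesis .
    qed
    then have "exp (- 4) * tail s \<le> c m"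
      using c_ge[of s m] s mult_right_mono[of "exp (- 4)" "s ^ (2 * m)" "tail s"] by simp
    then have "C * (exp (- 4) * tail s) \<le> C * c m"
      using C_ge_1 by (intro mult_left_mono) auto
    moreover have "exp (- 4) * tail t \<le> exp (- 4) * (C * tail s)"
      using T_ts by (intro mult_left_mono) auto
    ultimately have "exp (- 4) * tail t \<le> C * c m"
      by (simp only: mult.left_commute)
    then have "tail t \<le> exp 4 * C * c m"
      by (simp add: exp_minus field_simps)
    then have "A / c m \<le> A * exp 4 * C / tail t"
      using A0 c_pos[of m] Tt mult_left_mono[of "tail t" "exp 4 * C * c m" A] by (simp add: field_simps)
    with le show ?thesis by linarith
  qed
  moreover have "0 \<le> A * exp 4 * C" using A0 C_ge_1 by simp
  ultimately show ?thesis by blast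
qed

text \<open>The probability integral transform, as an inequality since circles may carry mass. The
  radii with tail at most x form an interval ending at 1; if its infimum belongs to it, the claim is
  the tail bound there, and otherwise the infimum is approached from above.\<close>

lemma tail_distribution_le:
  assumes x: "0 < x"
  shows "measure \<nu> {z. cmod z < 1 \<and> tail (cmod z) \<le> x} \<le> x"
proof -
  define R where "R = {r. 0 \<le> r \<and> r < 1 \<and> tail r \<le> x}"
  show ?thesis
  proof (cases "R = {}")
    case True
    then have "{z. cmod z < 1 \<and> tail (cmod z) \<le> x} = {}" by (auto simp: R_def)
    then show ?thesis using x by (simp only: measure_empty)
  next
    case False
    define r0 where "r0 = Inf R"
    have bdd: "bdd_below R" by (auto simp: R_def intro!: bdd_belowI[of _ 0])
    have lower: "r0 \<le> r" if "r \<in> R" for r unfolding r0_def using bdd that by (rule cInf_lower[rotated])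
    have above: "tail r \<le> x" if r: "r0 < r" for r
    proof -
      obtain s where "s \<in> R" "s < r" using cInf_lessD[OF False r[unfolded r0_def]] by blast
      then show ?thesis using tail_antimono[of s r] by (auto simp: R_def)
    qed
    show ?thesis
    proof (cases "r0 \<in> R")
      case True
      have "measure \<nu> {z. cmod z < 1 \<and> tail (cmod z) \<le> x} \<le> tail r0"
        unfolding tail_def[of r0] using lower by (intro finite_measure_mono) (auto simp: R_def)
      then show ?thesis using True by (simp add: R_def)
    next
      case r0: False
      define D where "D n = {z::complex. r0 + 1 / real (Suc n) \<le> cmod z}" for n
      have "incseq D"
        unfolding D_def by (intro incseq_SucI) (auto intro: order_trans[rotated] simp: frac_le)
      moreover have "range D \<subseteq> sets \<nu>" by (auto simp: D_def)
      ultimately have lim: "(\<lambda>n. measure \<nu> (D n)) \<longlonglongrightarrow> measure \<nu> (\<Union>n. D n)"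
        by (intro finite_Lim_measure_incseq)
      have "measure \<nu> (D n) \<le> x" for n
        using above[of "r0 + 1 / real (Suc n)"] by (simp add: D_def tail_def)
      then have "measure \<nu> (\<Union>n. D n) \<le> x" using lim by (intro LIMSEQ_le_const2[OF lim]) auto
      moreover have "{z. cmod z < 1 \<and> tail (cmod z) \<le> x} \<subseteq> (\<Union>n. D n)"
      proof
        fix z assume "z \<in> {z. cmod z < 1 \<and> tail (cmod z) \<le> x}"
        then have "cmod z \<in> R" by (simp add: R_def)
        then have "0 < cmod z - r0" using lower[of "cmod z"] r0 by (cases "cmod z = r0") auto
        then obtain n where "inverse (real (Suc n)) < cmod z - r0" using reals_Archimedean by blast
        then have "z \<in> D n" by (simp add: D_def inverse_eq_divide)
        then show "z \<in> (\<Union>n. D n)" by blast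
      qed
      then have "measure \<nu> {z. cmod z < 1 \<and> tail (cmod z) \<le> x} \<le> measure \<nu> (\<Union>n. D n)"
        by (intro finite_measure_mono) (auto simp: D_def)
      ultimately show ?thesis by linarith
    qed
  qed
qed

text \<open>In effect the substitution u = tail |z| in the Hardy integral. As the integrand
  decreases in u, its superlevel sets are intervals starting at 0, and on these
  \<open>tail_distribution_le\<close> compares \<nu> with Lebesgue measure.\<close>

lemma Schur_test_weight:
  assumes a: "0 < a" "a < 1" and v: "0 < v"
  shows "(\<integral>\<^sup>+z. ennreal (tail (cmod z) powr - a / max (tail (cmod z)) v) \<partial>\<nu>)
    \<le> ennreal ((1 / (1 - a) + 1 / a) * v powr - a)"
proof -
  define g where "g u = u powr - a / max u v" for u
  define X where "X z = (if cmod z < 1 then g (tail (cmod z)) else 0)" for z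
  define Y where "Y u = indicator {0<..} u * g u" for u :: real
  have g_antimono: "g u \<le> g s" if "0 < s" "s \<le> u" for s u
    unfolding g_def using that a v by (intro frac_le powr_mono2') auto
  have [measurable]: "g \<in> borel_measurable borel" unfolding g_def by measurable
  have g0: "0 \<le> g u" for u using v by (simp add: g_def)
  have "(\<integral>\<^sup>+z. ennreal (tail (cmod z) powr - a / max (tail (cmod z)) v) \<partial>\<nu>) = (\<integral>\<^sup>+z. ennreal (X z) \<partial>\<nu>)"
    using AE_disc by (intro nn_integral_cong_AE) (auto elim!: eventually_mono simp: X_def g_def)
  also have "\<dots> \<le> 1 * (\<integral>\<^sup>+u. ennreal (Y u) \<partial>lborel)"
  proof (rule nn_integral_dominated_distribution[OF sigma_finite_measure_axioms _ _ sigma_finite_lborel])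
    show "X \<in> borel_measurable \<nu>" unfolding X_def by measurable
    show "Y \<in> borel_measurable lborel" unfolding Y_def by measurable
    fix y :: real assume y: "0 < y"
    define U where "U = {u. 0 < u \<and> y \<le> g u}"
    have Y_eq: "{u \<in> space lborel. y \<le> Y u} = U"
      using y by (auto simp: U_def Y_def split: split_indicator)
    have X_sub: "{z \<in> space \<nu>. y \<le> X z} \<subseteq> {z. cmod z < 1 \<and> tail (cmod z) \<in> U}"
      using y tail_pos by (auto simp: X_def U_def tail_def split: if_splits)
    have [measurable]: "U \<in> sets borel" unfolding U_def by measurable
    show "emeasure \<nu> {z \<in> space \<nu>. y \<le> X z} \<le> 1 * emeasure lborel {u \<in> space lborel. y \<le> Y u}"
    proof (cases "U = {}")
      case True
      then have "{z \<in> space \<nu>. y \<le> X z} = {}" using X_sub by auto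
      then show ?thesis by simp
    next
      case ne: False
      have Icc: "{0<..u} \<subseteq> U" if "u \<in> U" for u
        using that g_antimono by (force simp: U_def)
      show ?thesis
      proof (cases "bdd_above U")
        case True
        define s where "s = Sup U"
        obtain u where "u \<in> U" using ne by blast
        then have s0: "0 < s" using cSup_upper[OF _ True, of u] by (simp add: s_def U_def)
        have "{0<..<s} \<subseteq> U"
          using Icc less_cSupD[OF ne] by (force simp: s_def)
        then have "ennreal s \<le> emeasure lborel U"
          using s0 emeasure_mono[of "{0<..<s}" U lborel] by simp
        moreover have "emeasure \<nu> {z \<in> space \<nu>. y \<le> X z} \<le> emeasure \<nu> {z. cmod z < 1 \<and> tail (cmod z) \<le> s}"
          using X_sub cSup_upper[OF _ True] by (intro emeasure_mono) (auto simp: s_def)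
        moreover have "\<dots> \<le> ennreal s"
          unfolding emeasure_eq_measure by (intro ennreal_leI tail_distribution_le s0)
        ultimately show ?thesis unfolding Y_eq mult_1 by (meson order_trans)
      next
        \<comment> \<open>For unbounded \<open>U\<close> it suffices that \<open>U\<close> contains
          the interval from 0 to \<open>tail 0\<close>, whose length is the total mass.\<close>
        case False
        have "ennreal (tail 0) \<le> emeasure lborel U"
        proof -
          obtain u where "u \<in> U" "tail 0 \<le> u"
            using False by (meson bdd_above.I linear)
          then have "{0<..tail 0} \<subseteq> U" using Icc by force
          then show ?thesis using emeasure_mono[of "{0<..tail 0}" U lborel] by simp
        qed
        moreover have "emeasure \<nu> {z \<in> space \<nu>. y \<le> X z} \<le> ennreal (tail 0)"
          unfolding tail_def emeasure_eq_measure by (intro ennreal_leI finite_measure_mono) auto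
        ultimately show ?thesis unfolding Y_eq mult_1 by (meson order_trans)
      qed
    qed
  qed (use g0 in \<open>auto simp: X_def Y_def\<close>)
  also have "\<dots> \<le> ennreal ((1 / (1 - a) + 1 / a) * v powr - a)"
    using nn_integral_hardy_weight[OF a v] by (simp add: Y_def g_def)
  finally show ?thesis .
qed

end

section \<open>The projection of a radial measure\<close>

context radial_disc_measure
begin

text \<open>The conjugate of the Bergman kernel as a function of z * cnj x alone; this dependence is
  what lets rotations act by convolution on circles.\<close>

definition kernel :: "complex \<Rightarrow> complex" where
  "kernel w = (\<Sum>n. w ^ n / of_real (c n))"

definition projection :: "(complex \<Rightarrow> complex) \<Rightarrow> complex \<Rightarrow> complex" where
  "projection f z = (LINT x|\<nu>. f x * kernel (z * cnj x))"

lemma borel_measurable_kernel [measurable]: "kernel \<in> borel_measurable borel"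
  unfolding kernel_def by measurable

lemma cmod_kernel_le:
  assumes t: "cmod w \<le> t" "t < 1"
  shows "cmod (kernel w) \<le> (\<Sum>n. t ^ n / c n)"
proof -
  have t0: "0 \<le> t" using t norm_ge_zero order_trans by blast
  have sum: "summable (\<lambda>n. t ^ n / c n)"
  proof (rule summable_comparison_test'[OF kernel_coeff_summable[OF t0 t(2)]])
    show "norm (t ^ n / c n) \<le> (real n + 1)\<^sup>2 * \<bar>t ^ n / c n\<bar>" for n
      using mult_right_mono[of 1 "(real n + 1)\<^sup>2" "\<bar>t ^ n / c n\<bar>"] by simp
  qed
  show ?thesis
    unfolding kernel_def
  proof (rule norm_suminf_le[OF _ sum])
    show "norm (w ^ n / of_real (c n)) \<le> t ^ n / c n" for n
      using t c_pos[of n] by (simp add: norm_divide norm_power divide_right_mono power_mono)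
  qed
qed

lemma integrable_projection:
  assumes f: "integrable \<nu> f" and z: "cmod z < 1"
  shows "integrable \<nu> (\<lambda>x. f x * kernel (z * cnj x))"
proof -
  have [measurable]: "f \<in> borel_measurable borel" using borel_measurable_integrable[OF f] by simp
  define B where "B = (\<Sum>n. cmod z ^ n / c n)"
  show ?thesis
  proof (rule Bochner_Integration.integrable_bound)
    show "integrable \<nu> (\<lambda>x. B * cmod (f x))" using f by auto
    show "AE x in \<nu>. cmod (f x * kernel (z * cnj x)) \<le> norm (B * cmod (f x))"
      using AE_disc
    proof eventually_elim
      case (elim x)
      have "cmod (z * cnj x) \<le> cmod z" using elim by (simp add: norm_mult mult_left_le)
      then have "cmod (kernel (z * cnj x)) \<le> B" unfolding B_def by (rule cmod_kernel_le[OF _ z])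
      then have "cmod (f x * kernel (z * cnj x)) \<le> cmod (f x) * B"
        unfolding norm_mult by (intro mult_left_mono) auto
      also have "\<dots> \<le> norm (B * cmod (f x))" by (simp add: mult.commute)
      finally show ?case .
    qed
  qed measurable
qed

section \<open>Averaging over rotations\<close>

lemma distr_rotate: "cmod u = 1 \<Longrightarrow> distr \<nu> borel (\<lambda>z. u * z) = \<nu>"
proof (rule measure_eqI)
  assume u: "cmod u = 1"
  fix A assume "A \<in> sets (distr \<nu> borel (\<lambda>z. u * z))"
  then have A [measurable]: "A \<in> sets borel" by simp
  have "emeasure (distr \<nu> borel (\<lambda>z. u * z)) A = (\<integral>\<^sup>+z. indicator A z \<partial>distr \<nu> borel (\<lambda>z. u * z))"
    by simp
  also have "\<dots> = (\<integral>\<^sup>+z. indicator A (u * z) \<partial>\<nu>)"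
    by (rule nn_integral_distr) simp_all
  also have "\<dots> = emeasure \<nu> A"
    by (subst rotate[OF _ u]) simp_all
  finally show "emeasure (distr \<nu> borel (\<lambda>z. u * z)) A = emeasure \<nu> A" .
qed simp

lemma integral_rotate:
  fixes F :: "complex \<Rightarrow> complex"
  assumes [measurable]: "F \<in> borel_measurable borel" and u: "cmod u = 1"
  shows "(LINT z|\<nu>. F (u * z)) = (LINT z|\<nu>. F z)"
proof -
  have "(LINT z|\<nu>. F z) = (LINT z|distr \<nu> borel (\<lambda>z. u * z). F z)"
    using u by (simp add: distr_rotate)
  then show ?thesis by (simp add: integral_distr)
qed

text \<open>Stands in for polar coordinates: instead of disintegrating \<nu> over circles, an
  average over rotations is inserted into the integral, in either order.\<close>

lemma nn_integral_circle_average: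
  fixes F :: "complex \<Rightarrow> ennreal"
  assumes [measurable]: "F \<in> borel_measurable borel"
  shows "(\<integral>\<^sup>+u. (\<integral>\<^sup>+z. F (u * z) \<partial>\<nu>) \<partial>circ) = (\<integral>\<^sup>+z. F z \<partial>\<nu>)"
    and "(\<integral>\<^sup>+z. (\<integral>\<^sup>+u. F (u * z) \<partial>circ) \<partial>\<nu>) = (\<integral>\<^sup>+z. F z \<partial>\<nu>)"
proof -
  interpret cn: pair_sigma_finite circ \<nu> ..
  have "(\<integral>\<^sup>+u. (\<integral>\<^sup>+z. F (u * z) \<partial>\<nu>) \<partial>circ) = (\<integral>\<^sup>+u. (\<integral>\<^sup>+z. F z \<partial>\<nu>) \<partial>circ)"
    using AE_circ by (intro nn_integral_cong_AE) (auto elim!: eventually_mono simp: rotate)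
  also have "\<dots> = (\<integral>\<^sup>+z. F z \<partial>\<nu>)" by (simp add: emeasure_circ)
  finally show *: "(\<integral>\<^sup>+u. (\<integral>\<^sup>+z. F (u * z) \<partial>\<nu>) \<partial>circ) = (\<integral>\<^sup>+z. F z \<partial>\<nu>)" .
  show "(\<integral>\<^sup>+z. (\<integral>\<^sup>+u. F (u * z) \<partial>circ) \<partial>\<nu>) = (\<integral>\<^sup>+z. F z \<partial>\<nu>)"
    by (subst *[symmetric], rule cn.Fubini') measurable
qed

text \<open>The share of the circle through x in the projection at v * z: an operator in v acting on
  the restriction of f to that circle.\<close>

definition circle_part :: "(complex \<Rightarrow> complex) \<Rightarrow> complex \<Rightarrow> complex \<Rightarrow> complex \<Rightarrow> complex" where
  "circle_part f z x v = (LINT u|circ. f (u * x) * kernel (v * cnj u * (z * cnj x)))"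

text \<open>For each unimodular u, replacing x by u * x leaves \<nu> unchanged; then average in u
  and exchange the integrals. For fixed |z| < 1 the kernel is bounded by \<open>B\<close>, which
  justifies Fubini.\<close>

lemma projection_eq_circle_part:
  assumes f: "integrable \<nu> f" and z: "cmod z < 1" and v: "cmod v = 1"
  shows "projection f (v * z) = (LINT x|\<nu>. circle_part f z x v)"
    and "integrable \<nu> (\<lambda>x. circle_part f z x v)"
proof -
  have [measurable]: "f \<in> borel_measurable borel" using borel_measurable_integrable[OF f] by simp
  interpret cn: pair_sigma_finite circ \<nu> ..
  define F where "F u x = f (u * x) * kernel (v * cnj u * (z * cnj x))" for u x
  have [measurable]: "case_prod F \<in> borel_measurable (borel \<Otimes>\<^sub>M borel)"
    unfolding F_def by measurable
  define B where "B = (\<Sum>n. cmod z ^ n / c n)"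
  have B0: "0 \<le> B" using cmod_kernel_le[of z "cmod z"] z norm_ge_zero order_trans unfolding B_def by blast
  have F_le: "cmod (F u x) \<le> B * cmod (f (u * x))" if "cmod u = 1" "cmod x < 1" for u x
  proof -
    have "cmod (v * cnj u * (z * cnj x)) \<le> cmod z" using that v by (simp add: norm_mult mult_left_le)
    then have "cmod (kernel (v * cnj u * (z * cnj x))) \<le> B" unfolding B_def by (rule cmod_kernel_le[OF _ z])
    then show ?thesis
      unfolding F_def norm_mult mult.commute[of B] by (rule mult_left_mono) simp
  qed
  have int: "integrable (circ \<Otimes>\<^sub>M \<nu>) (case_prod F)"
  proof (rule integrableI_bounded)
    have "(\<integral>\<^sup>+w. ennreal (norm (case_prod F w)) \<partial>(circ \<Otimes>\<^sub>M \<nu>))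
      = (\<integral>\<^sup>+u. (\<integral>\<^sup>+x. ennreal (cmod (F u x)) \<partial>\<nu>) \<partial>circ)"
      by (subst nn_integral_fst[symmetric]) simp_all
    also have "\<dots> \<le> (\<integral>\<^sup>+u. (\<integral>\<^sup>+x. ennreal B * ennreal (cmod (f (u * x))) \<partial>\<nu>) \<partial>circ)"
    proof (rule nn_integral_mono_AE)
      show "AE u in circ. (\<integral>\<^sup>+x. ennreal (cmod (F u x)) \<partial>\<nu>)
          \<le> (\<integral>\<^sup>+x. ennreal B * ennreal (cmod (f (u * x))) \<partial>\<nu>)"
        using AE_circ
      proof eventually_elim
        case (elim u)
        then show ?case
          unfolding ennreal_mult'[OF B0, symmetric]
          by (intro nn_integral_mono_AE eventually_mono[OF AE_disc] ennreal_leI F_le)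
      qed
    qed
    also have "\<dots> = ennreal B * (\<integral>\<^sup>+x. ennreal (cmod (f x)) \<partial>\<nu>)"
      using nn_integral_circle_average(1)[of "\<lambda>x. ennreal B * ennreal (cmod (f x))"]
      by (simp add: nn_integral_cmult)
    also have "\<dots> < \<infinity>"
      using f by (simp add: integrable_iff_bounded ennreal_mult_less_top)
    finally show "(\<integral>\<^sup>+w. ennreal (norm (case_prod F w)) \<partial>(circ \<Otimes>\<^sub>M \<nu>)) < \<infinity>" .
  qed measurable
  have "projection f (v * z) = (LINT u|circ. projection f (v * z))"
    by (simp add: measure_def emeasure_circ)
  also have "\<dots> = (LINT u|circ. LINT x|\<nu>. F u x)"
  proof (rule integral_cong_AE)
    show "AE u in circ. projection f (v * z) = (LINT x|\<nu>. F u x)"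
      using AE_circ
    proof eventually_elim
      case (elim u)
      have "F u x = f (u * x) * kernel (v * z * cnj (u * x))" for x
        by (simp add: F_def mult_ac)
      then show ?case
        unfolding projection_def using elim
        by (simp add: integral_rotate[where F = "\<lambda>x. f x * kernel (v * z * cnj x)"] del: complex_cnj_mult)
    qed
  qed measurable
  also have "\<dots> = (LINT x|\<nu>. LINT u|circ. F u x)"
    by (rule cn.Fubini_integral[OF int, symmetric])
  finally show "projection f (v * z) = (LINT x|\<nu>. circle_part f z x v)"
    by (simp add: circle_part_def F_def)
  show "integrable \<nu> (\<lambda>x. circle_part f z x v)"
    using cn.integrable_snd[OF int] by (simp add: circle_part_def F_def)
qed

lemma circle_part_bound:
  assumes p: "1 < p"
  shows "\<exists>A\<ge>0. \<forall>f z x. cmod z < 1 \<longrightarrow> cmod x < 1 \<longrightarrow> integrable circ (\<lambda>u. f (u * x)) \<longrightarrow>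
    lp_power circ p (\<lambda>v. circle_part f z x v)
      \<le> ennreal (A / max (tail (cmod x)) (tail (cmod z)) powr p)
         * lp_power circ p (\<lambda>u. f (u * x))"
proof -
  obtain A where A: "0 < A" and bound: "\<And>a \<eta> g W. cmod \<eta> = 1 \<Longrightarrow> integrable circ g \<Longrightarrow>
    summable (\<lambda>n. (real n + 1)\<^sup>2 * \<bar>a n\<bar>) \<Longrightarrow> (\<forall>N. diff2_sum a N \<le> W) \<Longrightarrow>
    lp_power circ p (circ_conv a \<eta> g)
      \<le> ennreal (A * W powr p) * lp_power circ p g"
    using circle_kernel_bound[OF p] by blast
  obtain A' where A': "0 \<le> A'" and second: "\<And>t N. 0 \<le> t \<Longrightarrow> t < 1 \<Longrightarrow>
     diff2_sum (\<lambda>n. t ^ n / c n) N \<le> A' / tail t"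
    using kernel_diff2_le by blast
  have "lp_power circ p (\<lambda>v. circle_part f z x v)
      \<le> ennreal (A * A' powr p / max (tail (cmod x)) (tail (cmod z)) powr p)
         * lp_power circ p (\<lambda>u. f (u * x))"
    if z: "cmod z < 1" and x: "cmod x < 1" and g: "integrable circ (\<lambda>u. f (u * x))" for f z x
  proof -
    define t where "t = cmod z * cmod x"
    have t: "0 \<le> t" "t < 1" "t \<le> cmod z" "t \<le> cmod x"
      using z x mult_strict_mono[of "cmod z" 1 "cmod x" 1]
      by (auto simp: t_def mult_left_le mult_left_le_one_le)
    \<comment> \<open>The phase of z * cnj x; for t = 0 any unimodular number serves.\<close>
    obtain \<eta> where \<eta>: "cmod \<eta> = 1" "z * cnj x = of_real t * \<eta>"
    proof (cases "t = 0")
      case True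
      then have "z * cnj x = 0" by (auto simp: t_def)
      then show ?thesis using that[of 1] True by simp
    next
      case False
      then show ?thesis
        using that[of "z * cnj x / of_real t"] by (simp add: t_def norm_divide norm_mult)
    qed
    define W where "W = A' / tail t"
    define M where "M = max (tail (cmod x)) (tail (cmod z))"
    have M: "0 < M" using tail_pos[of "cmod z"] z by (simp add: M_def tail_def less_max_iff_disj)
    have "M \<le> tail t" unfolding M_def using t tail_antimono by simp
    then have W: "0 \<le> W" "W \<le> A' / M" using A' M by (auto simp: W_def divide_left_mono)
    have kernel_eq: "kernel (v * cnj u * (z * cnj x)) = (\<Sum>n. of_real (t ^ n / c n) * (v * cnj u * \<eta>) ^ n)" for v u
      unfolding kernel_def \<eta>(2) by (simp add: power_mult_distrib mult_ac)
    have "lp_power circ p (\<lambda>v. circle_part f z x v)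
      \<le> ennreal (A * W powr p) * lp_power circ p (\<lambda>u. f (u * x))"
      unfolding circle_part_def kernel_eq
      by (rule bound[OF \<eta>(1) g kernel_coeff_summable[OF t(1,2)]]) (simp add: second[OF t(1,2)] W_def)
    also have "\<dots> \<le> ennreal (A * A' powr p / M powr p) * lp_power circ p (\<lambda>u. f (u * x))"
    proof (intro mult_right_mono ennreal_leI)
      have "W powr p \<le> (A' / M) powr p" using W p by (intro powr_mono2) auto
      then show "A * W powr p \<le> A * A' powr p / M powr p"
        using A A' M mult_left_mono[of "W powr p" "(A' / M) powr p" A] by (simp add: powr_divide)
    qed simp
    finally show ?thesis by (simp add: M_def)
  qed
  moreover have "0 \<le> A * A' powr p" using A by simp
  ultimately show ?thesis by blast
qed

lemma integrable_of_powr: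
  assumes [measurable]: "f \<in> borel_measurable borel" and p: "1 < p"
    and fin: "lp_power \<nu> p f < \<infinity>"
  shows "integrable \<nu> f"
proof (rule integrableI_bounded)
  have "cmod (f z) \<le> 1 + cmod (f z) powr p" for z
  proof (cases "cmod (f z) \<le> 1")
    case False
    then have "cmod (f z) powr 1 \<le> cmod (f z) powr p" using p by (intro powr_mono) auto
    then show ?thesis using False by simp
  qed (use powr_ge_zero[of "cmod (f z)" p] in linarith)
  then have "(\<integral>\<^sup>+z. ennreal (norm (f z)) \<partial>\<nu>) \<le> (\<integral>\<^sup>+z. 1 + ennreal (cmod (f z) powr p) \<partial>\<nu>)"
    by (intro nn_integral_mono) (simp add: ennreal_leI flip: ennreal_plus ennreal_1)
  also have "\<dots> = emeasure \<nu> UNIV + lp_power \<nu> p f"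
    by (subst nn_integral_add) auto
  also have "\<dots> < \<infinity>" using fin by (simp add: emeasure_eq_measure)
  finally show "(\<integral>\<^sup>+z. ennreal (norm (f z)) \<partial>\<nu>) < \<infinity>" .
qed simp

text \<open>A Schur test whose two halves are separated by the circle bound: Jensen in x for fixed v
  and z, then cancellation in v, then the second weight in z. Absolute values are taken only of
  \<open>circle_part\<close>, after the integration over its circle.\<close>

theorem projection_bounded:
  assumes p: "1 < p"
  shows "\<exists>A. \<forall>f. f \<in> borel_measurable borel \<longrightarrow> integrable \<nu> f \<longrightarrow>
    lp_power \<nu> p (projection f)
      \<le> ennreal A * lp_power \<nu> p f"
proof -
  obtain A where A: "0 \<le> A" and part: "\<And>f z x. cmod z < 1 \<Longrightarrow> cmod x < 1 \<Longrightarrow>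
    integrable circ (\<lambda>u. f (u * x)) \<Longrightarrow>
    lp_power circ p (\<lambda>v. circle_part f z x v)
      \<le> ennreal (A / max (tail (cmod x)) (tail (cmod z)) powr p)
         * lp_power circ p (\<lambda>u. f (u * x))"
    using circle_part_bound[OF p] by blast
  \<comment> \<open>Jensen raises the first weight's integral to the power p - 1, which turns the
    exponent a into b = a (p - 1) = 1 - 1 / p. The choice a = 1 / p puts both into (0, 1), as
    \<open>Schur_test_weight\<close> requires.\<close>
  define a where "a = 1 / p"
  define b where "b = a * (p - 1)"
  have a: "0 < a" "a < 1" using p by (auto simp: a_def)
  have b: "0 < b" "b < 1" using p by (auto simp: b_def a_def field_simps)
  define Ka where "Ka = 1 / (1 - a) + 1 / a"
  define Kb where "Kb = 1 / (1 - b) + 1 / b"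
  have Ka: "0 < Ka" using a by (simp add: Ka_def add_pos_pos)
  have Kb: "0 < Kb" using b by (simp add: Kb_def add_pos_pos)
  define A2 where "A2 = Ka powr (p - 1) * A"
  have A2: "0 \<le> A2" using A by (simp add: A2_def)
  have "lp_power \<nu> p (projection f)
      \<le> ennreal (A2 * Kb) * lp_power \<nu> p f"
    if [measurable]: "f \<in> borel_measurable borel" and f: "integrable \<nu> f" for f
  proof -
    interpret cn: pair_sigma_finite circ \<nu> ..
    interpret nn: pair_sigma_finite \<nu> \<nu> ..
    define \<Phi> where "\<Phi> x = lp_power circ p (\<lambda>u. f (u * x))" for x
    have [measurable]: "\<Phi> \<in> borel_measurable borel" unfolding \<Phi>_def by measurable
    have [measurable]: "projection f \<in> borel_measurable borel" unfolding projection_def by measurable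
    \<comment> \<open>Tonelli makes f integrable on almost every circle, the hypothesis of the
      circle bound.\<close>
    have circle_int: "AE x in \<nu>. integrable circ (\<lambda>u. f (u * x))"
    proof -
      have "(\<integral>\<^sup>+x. (\<integral>\<^sup>+u. ennreal (cmod (f (u * x))) \<partial>circ) \<partial>\<nu>) \<noteq> \<infinity>"
        using nn_integral_circle_average(2)[of "\<lambda>x. ennreal (cmod (f x))"] f
        by (simp add: integrable_iff_bounded)
      then have "AE x in \<nu>. (\<integral>\<^sup>+u. ennreal (cmod (f (u * x))) \<partial>circ) \<noteq> \<infinity>"
        by (intro nn_integral_PInf_AE) measurable
      then show ?thesis
        by eventually_elim (auto intro!: integrableI_bounded simp: less_top)
    qed
    \<comment> \<open>What remains after the integration in v. Integrating in z is again a case of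
      \<open>Schur_test_weight\<close>, now with exponent b, and the positive power of the tail at x
      cancels its result.\<close>
    let ?k = "\<lambda>z x. ennreal (A2 * (tail (cmod z) powr - b / max (tail (cmod z)) (tail (cmod x)))) * (ennreal (tail (cmod x) powr b) * \<Phi> x)"
    have z_bound: "lp_power circ p (\<lambda>v. projection f (v * z))
      \<le> (\<integral>\<^sup>+x. ?k z x \<partial>\<nu>)"
      if z: "cmod z < 1" for z
    proof -
      define \<tau> where "\<tau> = tail (cmod z)"
      have \<tau>: "0 < \<tau>" using tail_pos[of "cmod z"] z by (simp add: \<tau>_def tail_def)
      define w where "w x = tail (cmod x) powr - a / max (tail (cmod x)) \<tau>" for x
      have [measurable]: "w \<in> borel_measurable borel" unfolding w_def by measurable
      have w0: "0 \<le> w x" for x using \<tau> by (simp add: w_def)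
      define X where "X v x = cmod (circle_part f z x v)" for v x
      have [measurable]: "(\<lambda>(v, x). X v x) \<in> borel_measurable (borel \<Otimes>\<^sub>M borel)"
        unfolding X_def circle_part_def by measurable
      have [measurable]: "X v \<in> borel_measurable borel" and X0: "0 \<le> X v x" for v x
        unfolding X_def circle_part_def by measurable
      define W where "W = Ka * \<tau> powr - a"
      have W: "(\<integral>\<^sup>+x. ennreal (w x) \<partial>\<nu>) \<le> ennreal W"
        unfolding w_def W_def Ka_def by (rule Schur_test_weight[OF a \<tau>])
      have W0: "0 \<le> W" using Ka by (simp add: W_def)
      have W_eq: "W powr (p - 1) * A = A2 * \<tau> powr - b"
        using Ka by (simp add: W_def A2_def b_def powr_mult powr_powr)
      have "lp_power circ p (\<lambda>v. projection f (v * z))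
        \<le> (\<integral>\<^sup>+v. ennreal (W powr (p - 1)) * (\<integral>\<^sup>+x. ennreal ((X v x / w x) powr p * w x) \<partial>\<nu>) \<partial>circ)"
      proof (rule nn_integral_mono_AE)
        show "AE v in circ. ennreal (cmod (projection f (v * z)) powr p)
          \<le> ennreal (W powr (p - 1)) * (\<integral>\<^sup>+x. ennreal ((X v x / w x) powr p * w x) \<partial>\<nu>)"
          using AE_circ
        proof eventually_elim
          case (elim v)
          note proj = projection_eq_circle_part[OF f z elim]
          show ?case
          proof (rule weighted_Jensen_powr)
            have "ennreal (cmod (projection f (v * z))) \<le> (\<integral>\<^sup>+x. ennreal (X v x) \<partial>\<nu>)"
              unfolding proj(1) X_def by (rule integral_norm_bound_ennreal[OF proj(2)])
            also have "\<dots> = (\<integral>\<^sup>+x. ennreal (X v x / w x * w x) \<partial>\<nu>)"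
            proof (rule nn_integral_cong_AE)
              show "AE x in \<nu>. ennreal (X v x) = ennreal (X v x / w x * w x)"
                using AE_disc
              proof eventually_elim
                case (elim x)
                then have "0 < w x" using tail_pos[of "cmod x"] \<tau> by (simp add: w_def tail_def less_max_iff_disj)
                then show ?case by simp
              qed
            qed
            finally show "ennreal (cmod (projection f (v * z))) \<le> (\<integral>\<^sup>+x. ennreal (X v x / w x * w x) \<partial>\<nu>)" .
          qed (use w0 W0 W X0 p in auto)
        qed
      qed
      also have "\<dots> = ennreal (W powr (p - 1)) * (\<integral>\<^sup>+v. (\<integral>\<^sup>+x. ennreal ((X v x / w x) powr p * w x) \<partial>\<nu>) \<partial>circ)"
        by (rule nn_integral_cmult) measurable
      also have "(\<integral>\<^sup>+v. (\<integral>\<^sup>+x. ennreal ((X v x / w x) powr p * w x) \<partial>\<nu>) \<partial>circ)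
        = (\<integral>\<^sup>+x. (\<integral>\<^sup>+v. ennreal ((X v x / w x) powr p * w x) \<partial>circ) \<partial>\<nu>)"
        by (rule cn.Fubini'[symmetric]) measurable
      also have "\<dots> \<le> (\<integral>\<^sup>+x. ennreal (A / max \<tau> (tail (cmod x))) * (ennreal (tail (cmod x) powr b) * \<Phi> x) \<partial>\<nu>)"
      proof (rule nn_integral_mono_AE)
        show "AE x in \<nu>. (\<integral>\<^sup>+v. ennreal ((X v x / w x) powr p * w x) \<partial>circ)
          \<le> ennreal (A / max \<tau> (tail (cmod x))) * (ennreal (tail (cmod x) powr b) * \<Phi> x)"
          using AE_disc circle_int
        proof eventually_elim
          case (elim x)
          define s where "s = tail (cmod x)"
          define M where "M = max s \<tau>"
          have s: "0 < s" using tail_pos[of "cmod x"] elim by (simp add: s_def tail_def)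
          have M: "0 < M" using s by (simp add: M_def less_max_iff_disj)
          have w: "w x = s powr - a / M" by (simp add: w_def s_def M_def)
          have w_pos: "0 < w x" unfolding w using s M by simp
          \<comment> \<open>Combined with the M^(-p) of the circle bound this leaves a single 1 / M,
            so the next integral is of Hardy type once more.\<close>
          have w_powr: "w x powr (1 - p) = s powr b * M powr (p - 1)"
          proof -
            have "w x powr (1 - p) = (s powr - a) powr (1 - p) / M powr (1 - p)"
              unfolding w using M by (simp add: powr_divide)
            also have "(s powr - a) powr (1 - p) = s powr b"
              unfolding powr_powr by (simp add: b_def algebra_simps)
            also have "s powr b / M powr (1 - p) = s powr b * M powr (p - 1)"
              using powr_minus[of M "1 - p"] by (simp add: divide_inverse)
            finally show ?thesis .
          qed
          have X_w: "(X v x / w x) powr p * w x = w x powr (1 - p) * X v x powr p" for v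
            using w_pos by (simp add: powr_divide powr_diff X_def)
          have "(\<integral>\<^sup>+v. ennreal ((X v x / w x) powr p * w x) \<partial>circ)
            = ennreal (w x powr (1 - p)) * (\<integral>\<^sup>+v. ennreal (X v x powr p) \<partial>circ)"
            unfolding X_w by (simp add: ennreal_mult' nn_integral_cmult)
          also have "\<dots> \<le> ennreal (w x powr (1 - p)) * (ennreal (A / M powr p) * \<Phi> x)"
            unfolding X_def \<Phi>_def M_def s_def \<tau>_def by (intro mult_left_mono part z elim) simp
          also have "\<dots> = ennreal (w x powr (1 - p) * (A / M powr p)) * \<Phi> x"
            by (simp only: ennreal_mult'[OF powr_ge_zero] mult.assoc)
          also have "w x powr (1 - p) * (A / M powr p) = A / M * s powr b"
            unfolding w_powr using M by (simp add: powr_diff field_simps)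
          also have "ennreal (A / M * s powr b) = ennreal (A / M) * ennreal (s powr b)"
            by (rule ennreal_mult'') simp
          finally show ?case by (simp add: M_def s_def max.commute mult.assoc)
        qed
      qed
      finally have "lp_power circ p (\<lambda>v. projection f (v * z))
        \<le> ennreal (W powr (p - 1)) * (\<integral>\<^sup>+x. ennreal (A / max \<tau> (tail (cmod x))) * (ennreal (tail (cmod x) powr b) * \<Phi> x) \<partial>\<nu>)"
        by (simp add: mult_left_mono)
      also have "\<dots> = (\<integral>\<^sup>+x. ennreal (W powr (p - 1)) * (ennreal (A / max \<tau> (tail (cmod x))) * (ennreal (tail (cmod x) powr b) * \<Phi> x)) \<partial>\<nu>)"
        by (rule nn_integral_cmult[symmetric]) measurable
      also have "\<dots> = (\<integral>\<^sup>+x. ennreal (A2 * (\<tau> powr - b / max \<tau> (tail (cmod x)))) * (ennreal (tail (cmod x) powr b) * \<Phi> x) \<partial>\<nu>)"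
      proof (rule nn_integral_cong)
        fix x
        have "ennreal (W powr (p - 1)) * ennreal (A / max \<tau> (tail (cmod x))) = ennreal (W powr (p - 1) * A / max \<tau> (tail (cmod x)))"
          by (simp flip: ennreal_mult')
        also have "\<dots> = ennreal (A2 * (\<tau> powr - b / max \<tau> (tail (cmod x))))"
          unfolding W_eq by simp
        finally show "ennreal (W powr (p - 1)) * (ennreal (A / max \<tau> (tail (cmod x))) * (ennreal (tail (cmod x) powr b) * \<Phi> x))
          = ennreal (A2 * (\<tau> powr - b / max \<tau> (tail (cmod x)))) * (ennreal (tail (cmod x) powr b) * \<Phi> x)"
          by (simp flip: mult.assoc)
      qed
      finally show ?thesis by (simp add: \<tau>_def)
    qed
    have "lp_power \<nu> p (projection f)
      = (\<integral>\<^sup>+z. lp_power circ p (\<lambda>v. projection f (v * z)) \<partial>\<nu>)"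
      by (rule nn_integral_circle_average(2)[symmetric]) measurable
    also have "\<dots> \<le> (\<integral>\<^sup>+z. (\<integral>\<^sup>+x. ?k z x \<partial>\<nu>) \<partial>\<nu>)"
      by (intro nn_integral_mono_AE eventually_mono[OF AE_disc] z_bound)
    also have "\<dots> = (\<integral>\<^sup>+x. (\<integral>\<^sup>+z. ?k z x \<partial>\<nu>) \<partial>\<nu>)"
      by (rule nn.Fubini'[symmetric]) measurable
    also have "\<dots> \<le> (\<integral>\<^sup>+x. ennreal (A2 * Kb) * \<Phi> x \<partial>\<nu>)"
    proof (rule nn_integral_mono_AE)
      show "AE x in \<nu>. (\<integral>\<^sup>+z. ?k z x \<partial>\<nu>)
        \<le> ennreal (A2 * Kb) * \<Phi> x"
        using AE_disc
      proof eventually_elim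
        case (elim x)
        define s where "s = tail (cmod x)"
        have s: "0 < s" using tail_pos[of "cmod x"] elim by (simp add: s_def tail_def)
        have "(\<integral>\<^sup>+z. ennreal (A2 * (tail (cmod z) powr - b / max (tail (cmod z)) s)) * (ennreal (s powr b) * \<Phi> x) \<partial>\<nu>)
          = ennreal A2 * (\<integral>\<^sup>+z. ennreal (tail (cmod z) powr - b / max (tail (cmod z)) s) \<partial>\<nu>) * (ennreal (s powr b) * \<Phi> x)"
          unfolding ennreal_mult'[OF A2] by (simp add: nn_integral_cmult nn_integral_multc)
        also have "\<dots> \<le> ennreal A2 * ennreal (Kb * s powr - b) * (ennreal (s powr b) * \<Phi> x)"
          unfolding Kb_def by (intro mult_right_mono mult_left_mono Schur_test_weight b s) auto
        also have "\<dots> = ennreal (A2 * Kb * (s powr - b * s powr b)) * \<Phi> x"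
        proof -
          have "ennreal (A2 * Kb * (s powr - b * s powr b)) = ennreal A2 * ennreal (Kb * s powr - b) * ennreal (s powr b)"
            using A2 Kb by (simp only: mult.assoc flip: ennreal_mult'[OF A2] ennreal_mult''[OF powr_ge_zero])
          then show ?thesis by (simp only: mult.assoc)
        qed
        also have "s powr - b * s powr b = 1" using s by (simp add: powr_minus)
        finally show ?case by (simp add: s_def)
      qed
    qed
    also have "\<dots> = ennreal (A2 * Kb) * (\<integral>\<^sup>+x. \<Phi> x \<partial>\<nu>)"
      by (rule nn_integral_cmult) measurable
    also have "(\<integral>\<^sup>+x. \<Phi> x \<partial>\<nu>) = lp_power \<nu> p f"
      unfolding \<Phi>_def by (rule nn_integral_circle_average(2)) measurable
    finally show ?thesis .
  qed
  then show ?thesis by blast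
qed

end

section \<open>Radial weights\<close>

text \<open>The profile is only Lebesgue measurable, and a Borel representative can be composed with
  \<open>cmod\<close> safely. Nonnegativity and vanishing off [0,1) are arranged everywhere, not
  just almost everywhere.\<close>

lemma radial_weight_borel_version:
  assumes "radial_weight \<omega>"
  obtains g where "g \<in> borel_measurable borel" "\<And>r. 0 \<le> g r" "\<And>r. r \<notin> {0..<1} \<Longrightarrow> g r = 0"
    "AE r in lborel. r \<in> {0..<1} \<longrightarrow> \<omega> r = g r"
proof -
  have "(\<lambda>r. indicator {0..<1} r *\<^sub>R \<omega> r) \<in> borel_measurable (completion lborel)"
    using assms unfolding radial_weight_def set_integrable_def by (intro borel_measurable_integrable) auto
  from completion_ex_borel_measurable_real[OF this] obtain g where
    g: "g \<in> borel_measurable lborel" "AE r in lborel. indicator {0..<1} r *\<^sub>R \<omega> r = g r" by blast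
  have [measurable]: "g \<in> borel_measurable borel" using g by simp
  show ?thesis
  proof
    show "(\<lambda>r. indicator {0..<1} r * max 0 (g r)) \<in> borel_measurable borel" by measurable
    show "AE r in lborel. r \<in> {0..<1} \<longrightarrow> \<omega> r = indicator {0..<1} r * max 0 (g r)"
      using g(2)
    proof eventually_elim
      case (elim r)
      have "r \<in> {0..<1} \<Longrightarrow> 0 \<le> \<omega> r" using assms by (simp add: radial_weight_def)
      with elim show ?case by (auto simp: max_def)
    qed
  qed auto
qed

lemma borel_version_disc:
  fixes f :: "complex \<Rightarrow> complex"
  assumes "f \<in> borel_measurable (lebesgue_on unit_disc)"
  obtains h where "h \<in> borel_measurable borel" "AE z in lborel. z \<in> unit_disc \<longrightarrow> f z = h z"
proof -
  have f: "(\<lambda>z. indicator unit_disc z *\<^sub>R f z) \<in> borel_measurable lebesgue"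
    using assms by (subst (asm) borel_measurable_restrict_space_iff) auto
  obtain a where a: "a \<in> borel_measurable lborel" "AE z in lborel. Re (indicator unit_disc z *\<^sub>R f z) = a z"
    using completion_ex_borel_measurable_real[OF measurable_compose[OF f borel_measurable_Re]] by blast
  obtain b where b: "b \<in> borel_measurable lborel" "AE z in lborel. Im (indicator unit_disc z *\<^sub>R f z) = b z"
    using completion_ex_borel_measurable_real[OF measurable_compose[OF f borel_measurable_Im]] by blast
  have [measurable]: "a \<in> borel_measurable borel" "b \<in> borel_measurable borel" using a b by simp_all
  show ?thesis
  proof
    show "(\<lambda>z. Complex (a z) (b z)) \<in> borel_measurable borel" by measurable
    show "AE z in lborel. z \<in> unit_disc \<longrightarrow> f z = Complex (a z) (b z)"
      using a(2) b(2) by eventually_elim (auto simp: complex_eq_iff)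
  qed
qed

locale borel_radial_weight =
  fixes \<omega> g :: "real \<Rightarrow> real"
  assumes \<omega>: "radial_weight \<omega>"
    and g_meas [measurable]: "g \<in> borel_measurable borel" and g_nonneg: "\<And>r. 0 \<le> g r"
    and g_outside: "\<And>r. r \<notin> {0..<1} \<Longrightarrow> g r = 0"
    and g_eq: "AE r in lborel. r \<in> {0..<1} \<longrightarrow> \<omega> r = g r"
begin

text \<open>No restriction to the disc is written because \<open>g\<close> vanishes off [0,1); 1 /
  pi is the normalisation of dA.\<close>

definition radial_measure :: "complex measure" where
  "radial_measure = density lborel (\<lambda>z. ennreal (g (cmod z) / pi))"

lemma weighted_set_integral:
  assumes [measurable]: "\<phi> \<in> borel_measurable borel"
  shows "(LINT r:{0..<1}|lebesgue. \<phi> r * \<omega> r) = (LINT r|lborel. \<phi> r * g r)"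
    and "set_integrable lebesgue {0..<1} (\<lambda>r. \<phi> r * \<omega> r) \<longleftrightarrow> integrable lborel (\<lambda>r. \<phi> r * g r)"
proof -
  have ae: "AE r in lebesgue. \<phi> r * g r = indicator {0..<1} r *\<^sub>R (\<phi> r * \<omega> r)"
    using AE_completion[OF g_eq] by eventually_elim (auto simp: g_outside split: split_indicator)
  have m1: "(\<lambda>r. \<phi> r * g r) \<in> borel_measurable lebesgue"
    by (intro measurable_completion) measurable
  have m2: "(\<lambda>r. indicator {0..<1} r *\<^sub>R (\<phi> r * \<omega> r)) \<in> borel_measurable lebesgue"
    by (rule borel_measurable_AE[OF m1 ae])
  show "(LINT r:{0..<1}|lebesgue. \<phi> r * \<omega> r) = (LINT r|lborel. \<phi> r * g r)"
    unfolding set_lebesgue_integral_def integral_cong_AE[OF m1 m2 ae, symmetric]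
    by (rule integral_completion) measurable
  show "set_integrable lebesgue {0..<1} (\<lambda>r. \<phi> r * \<omega> r) \<longleftrightarrow> integrable lborel (\<lambda>r. \<phi> r * g r)"
    unfolding set_integrable_def integrable_cong_AE[OF m1 m2 ae, symmetric]
    by (rule integrable_completion) measurable
qed

lemma integrable_g: "integrable lborel g"
  using weighted_set_integral(2)[of "\<lambda>_. 1"] \<omega> by (simp add: radial_weight_def)

lemma tail_integral_eq:
  assumes "0 \<le> r"
  shows "tail_integral \<omega> r = (LINT s|lborel. indicator {r..<1} s * g s)"
proof -
  have "tail_integral \<omega> r = (LINT s:{0..<1}|lebesgue. indicator {r..<1} s * \<omega> s)"
    unfolding tail_integral_def set_lebesgue_integral_def
    using assms by (intro Bochner_Integration.integral_cong) (auto split: split_indicator)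
  then show ?thesis by (simp add: weighted_set_integral(1))
qed

text \<open>The polar factor 2 pi r and the 1 / pi of dA combine to 2 r.\<close>

lemma nn_integral_radial_measure:
  assumes [measurable]: "h \<in> borel_measurable borel"
  shows "(\<integral>\<^sup>+z. ennreal (h (cmod z)) \<partial>radial_measure) = (\<integral>\<^sup>+r. ennreal (2 * r * h r * g r) \<partial>lborel)"
proof -
  have "(\<integral>\<^sup>+z. ennreal (h (cmod z)) \<partial>radial_measure) = (\<integral>\<^sup>+z. ennreal (g (cmod z) / pi) * ennreal (h (cmod z)) \<partial>lborel)"
    unfolding radial_measure_def by (rule nn_integral_density) measurable
  also have "\<dots> = (\<integral>\<^sup>+z. ennreal (g (cmod z) / pi) * ennreal (h (cmod z)) * indicator unit_disc z \<partial>lborel)"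
    by (intro nn_integral_cong) (auto simp: g_outside split: split_indicator)
  also have "\<dots> = (\<integral>\<^sup>+r. ennreal (g r / pi) * ennreal (h r) * ennreal (2 * pi * r) * indicator {0..<1} r \<partial>lborel)"
    by (rule nn_integral_disc_radial) measurable
  also have "\<dots> = (\<integral>\<^sup>+r. ennreal (2 * r * h r * g r) \<partial>lborel)"
  proof (rule nn_integral_cong)
    fix r :: real
    show "ennreal (g r / pi) * ennreal (h r) * ennreal (2 * pi * r) * indicator {0..<1} r = ennreal (2 * r * h r * g r)"
    proof (cases "r \<in> {0..<1}")
      case True
      have "0 \<le> g r / pi" "0 \<le> 2 * pi * r" using True g_nonneg by auto
      then have "ennreal (g r / pi) * ennreal (h r) * ennreal (2 * pi * r) = ennreal ((g r / pi) * h r * (2 * pi * r))"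
        by (simp only: ennreal_mult' ennreal_mult'')
      then show ?thesis using True by (simp add: mult_ac)
    qed (auto simp: g_outside)
  qed
  finally show ?thesis .
qed

lemma moment_eq: "(LINT z|radial_measure. cmod z ^ (2 * n)) = 2 * moment \<omega> (real (2 * n + 1))"
proof -
  have "moment \<omega> (real (2 * n + 1)) = (LINT r|lborel. r powr real (2 * n + 1) * g r)"
    unfolding moment_def by (rule weighted_set_integral(1)) measurable
  also have "\<dots> = (LINT r|lborel. r * r ^ (2 * n) * g r)"
  proof (intro Bochner_Integration.integral_cong refl)
    fix r
    show "r powr real (2 * n + 1) * g r = r * r ^ (2 * n) * g r"
    proof -
      consider "r < 0" | "r = 0" | "0 < r" by linarith
      then show ?thesis
      proof cases
        case 3
        then have "r powr real (2 * n + 1) = r * r ^ (2 * n)"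
          using powr_realpow[of r "2 * n + 1"] by simp
        then show ?thesis by simp
      qed (auto simp: g_outside)
    qed
  qed
  finally have "2 * moment \<omega> (real (2 * n + 1)) = (LINT r|lborel. 2 * r * r ^ (2 * n) * g r)"
    by (simp add: mult.assoc)
  also have "\<dots> = enn2real (\<integral>\<^sup>+r. ennreal (2 * r * r ^ (2 * n) * g r) \<partial>lborel)"
  proof (intro integral_eq_nn_integral AE_I2)
    show "0 \<le> 2 * r * r ^ (2 * n) * g r" for r
      using g_nonneg[of r] g_outside[of r] by (cases "r < 0") auto
  qed measurable
  also have "\<dots> = enn2real (\<integral>\<^sup>+z. ennreal (cmod z ^ (2 * n)) \<partial>radial_measure)"
    by (subst nn_integral_radial_measure) measurable
  also have "\<dots> = (LINT z|radial_measure. cmod z ^ (2 * n))"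
    by (intro integral_eq_nn_integral[symmetric]) (auto simp: radial_measure_def)
  finally show ?thesis by simp
qed

lemma radial_measure_tail:
  "measure radial_measure {z. r \<le> cmod z} = (LINT s|lborel. 2 * s * indicator {r..} s * g s)"
  "integrable lborel (\<lambda>s. 2 * s * indicator {r..} s * g s)"
proof -
  have meas: "emeasure radial_measure {z. r \<le> cmod z} = (\<integral>\<^sup>+s. ennreal (2 * s * indicator {r..} s * g s) \<partial>lborel)"
  proof -
    have "emeasure radial_measure {z. r \<le> cmod z} = (\<integral>\<^sup>+z. ennreal (indicator {r..} (cmod z)) \<partial>radial_measure)"
    proof -
      have "(\<lambda>z. ennreal (indicator {r..} (cmod z))) = indicator {z. r \<le> cmod z}"
        by (auto split: split_indicator)
      then show ?thesis by (simp add: radial_measure_def)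
    qed
    also have "\<dots> = (\<integral>\<^sup>+s. ennreal (2 * s * indicator {r..} s * g s) \<partial>lborel)"
      by (rule nn_integral_radial_measure) measurable
    finally show ?thesis .
  qed
  have nonneg: "0 \<le> 2 * s * indicator {r..} s * g s" for s
    using g_nonneg[of s] g_outside[of s] by (cases "s < 0") auto
  show "measure radial_measure {z. r \<le> cmod z} = (LINT s|lborel. 2 * s * indicator {r..} s * g s)"
    unfolding measure_def meas using nonneg by (intro integral_eq_nn_integral[symmetric]) auto
  show "integrable lborel (\<lambda>s. 2 * s * indicator {r..} s * g s)"
  proof (rule Bochner_Integration.integrable_bound[OF integrable_mult_right[OF integrable_g, of 2]])
    show "AE s in lborel. norm (2 * s * indicator {r..} s * g s) \<le> norm (2 * g s)"
    proof (rule AE_I2)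
      fix s
      show "norm (2 * s * indicator {r..} s * g s) \<le> norm (2 * g s)"
        using g_nonneg[of s] g_outside[of s]
        by (cases "s \<in> {0..<1}") (auto simp: abs_mult mult_left_le_one_le split: split_indicator)
    qed
  qed measurable
qed

text \<open>On [r, 1) the polar factor 2 s lies between 2 r and 2. The lower bound is void at r = 0,
  so its uses stay at radii of at least 1/2.\<close>

lemma radial_measure_tail_bounds:
  assumes r: "0 \<le> r"
  shows "measure radial_measure {z. r \<le> cmod z} \<le> 2 * tail_integral \<omega> r"
    and "2 * r * tail_integral \<omega> r \<le> measure radial_measure {z. r \<le> cmod z}"
proof -
  have int: "integrable lborel (\<lambda>s. indicator {r..<1} s * g s)"
    by (rule Bochner_Integration.integrable_bound[OF integrable_g]) (auto split: split_indicator)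
  have "2 * s * indicator {r..} s * g s \<le> 2 * (indicator {r..<1} s * g s)"
    and "2 * r * (indicator {r..<1} s * g s) \<le> 2 * s * indicator {r..} s * g s" for s
    using g_nonneg[of s] g_outside[of s] r
    by (auto split: split_indicator simp: mult_left_le_one_le mult_right_mono not_less)
  then have "(LINT s|lborel. 2 * s * indicator {r..} s * g s) \<le> (LINT s|lborel. 2 * (indicator {r..<1} s * g s))"
    and "(LINT s|lborel. 2 * r * (indicator {r..<1} s * g s)) \<le> (LINT s|lborel. 2 * s * indicator {r..} s * g s)"
    using int by (intro integral_mono radial_measure_tail(2) integrable_mult_right; simp)+
  then show "measure radial_measure {z. r \<le> cmod z} \<le> 2 * tail_integral \<omega> r"
    and "2 * r * tail_integral \<omega> r \<le> measure radial_measure {z. r \<le> cmod z}"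
    by (simp_all only: tail_integral_eq[OF r] radial_measure_tail(1) integral_mult_right_zero)
qed

lemma radial_disc_measure_D_hat:
  assumes C: "1 \<le> C" "\<forall>r\<in>{0..<1}. tail_integral \<omega> r \<le> C * tail_integral \<omega> ((1 + r) / 2)"
  shows "radial_disc_measure radial_measure (2 * C)"
proof -
  have tail_pos: "0 < tail_integral \<omega> r" if "0 \<le> r" "r < 1" for r
    using \<omega> that unfolding radial_weight_def by (auto dest!: bspec[of _ _ "of_real r"])
  have fin: "finite_measure radial_measure"
  proof (rule finite_measureI)
    have "emeasure radial_measure (space radial_measure) = (\<integral>\<^sup>+z. ennreal 1 \<partial>radial_measure)"
      by simp
    also have "\<dots> = (\<integral>\<^sup>+s. ennreal (2 * s * 1 * g s) \<partial>lborel)"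
      by (rule nn_integral_radial_measure) simp
    also have "\<dots> \<le> (\<integral>\<^sup>+s. ennreal (2 * g s) \<partial>lborel)"
    proof (intro nn_integral_mono ennreal_leI)
      fix s
      show "2 * s * 1 * g s \<le> 2 * g s"
        using g_nonneg[of s] g_outside[of s]
        by (cases "s \<in> {0..<1}") (auto simp: mult_left_le_one_le)
    qed
    also have "\<dots> < \<infinity>"
      using nn_integral_eq_integral[OF integrable_mult_right[OF integrable_g, of 2]] g_nonneg
      by (simp del: integral_mult_right_zero)
    finally show "emeasure radial_measure (space radial_measure) \<noteq> \<infinity>" by simp
  qed
  then interpret finite_measure radial_measure .
  show ?thesis
  proof
    show "sets radial_measure = sets borel" by (simp add: radial_measure_def)
    show "AE z in radial_measure. cmod z < 1"
    proof -
      have "0 < ennreal (g (cmod z) / pi) \<longrightarrow> cmod z < 1" for z :: complex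
        using g_outside[of "cmod z"] by (cases "cmod z < 1") auto
      then show ?thesis unfolding radial_measure_def by (subst AE_density) auto
    qed
    show "(\<integral>\<^sup>+z. f (u * z) \<partial>radial_measure) = (\<integral>\<^sup>+z. f z \<partial>radial_measure)"
      if [measurable]: "f \<in> borel_measurable borel" and u: "cmod u = 1" for f u
      using nn_integral_lborel_rotate[of "\<lambda>z. ennreal (g (cmod z) / pi) * f z" u] u
      unfolding radial_measure_def by (simp add: nn_integral_density norm_mult)
    fix r :: real assume r: "0 \<le> r" "r < 1"
    \<comment> \<open>Moves the radius away from 0, where the lower tail bound degenerates.\<close>
    define s where "s = max r (1 / 2)"
    have s: "0 \<le> s" "s < 1" "1 / 2 \<le> s" "r \<le> s" using r by (auto simp: s_def)
    have "0 < 2 * s * tail_integral \<omega> s" using tail_pos[of s] s by simp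
    also have "\<dots> \<le> measure radial_measure {z. s \<le> cmod z}" by (rule radial_measure_tail_bounds) (use s in auto)
    also have "\<dots> \<le> measure radial_measure {z. r \<le> cmod z}"
      using s by (intro finite_measure_mono) (auto simp: radial_measure_def)
    finally show "0 < measure radial_measure {z. r \<le> cmod z}" .
    have "measure radial_measure {z. r \<le> cmod z} \<le> 2 * tail_integral \<omega> r"
      by (rule radial_measure_tail_bounds) (use r in auto)
    also have "\<dots> \<le> 2 * C * tail_integral \<omega> ((1 + r) / 2)" using C r by simp
    also have "\<dots> \<le> 2 * C * measure radial_measure {z. (1 + r) / 2 \<le> cmod z}"
    proof (rule mult_left_mono)
      \<comment> \<open>As (1 + r) / 2 \<ge> 1/2, the polar factor is at least 1 here; so the
        passage to tails of the measure costs only the factor 2 from the upper bound.\<close>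
      have "1 * tail_integral \<omega> ((1 + r) / 2) \<le> 2 * ((1 + r) / 2) * tail_integral \<omega> ((1 + r) / 2)"
        using tail_pos[of "(1 + r) / 2"] r by (intro mult_right_mono) auto
      also have "\<dots> \<le> measure radial_measure {z. (1 + r) / 2 \<le> cmod z}"
        by (rule radial_measure_tail_bounds(2)) (use r in simp)
      finally show "tail_integral \<omega> ((1 + r) / 2) \<le> measure radial_measure {z. (1 + r) / 2 \<le> cmod z}"
        by simp
    qed (use C in auto)
    finally show "measure radial_measure {z. r \<le> cmod z} \<le> 2 * C * measure radial_measure {z. (1 + r) / 2 \<le> cmod z}" .
  qed
qed

text \<open>A null set N of radii gives a null set of the disc, since its area is the integral of 2
  pi r over the part of N in [0,1).\<close>

lemma AE_weight_eq: "AE z in lborel. z \<in> unit_disc \<longrightarrow> \<omega> (cmod z) = g (cmod z)"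
proof -
  obtain N where N: "N \<in> null_sets lborel" "\<And>r. r \<in> space lborel - N \<Longrightarrow> r \<in> {0..<1} \<longrightarrow> \<omega> r = g r"
    using AE_E3[OF g_eq] by blast
  have [measurable]: "N \<in> sets borel" using N(1) by auto
  have [measurable]: "unit_disc \<in> sets borel" by simp
  have "(\<integral>\<^sup>+z. indicator N (cmod z) * indicator unit_disc z \<partial>lborel)
    = (\<integral>\<^sup>+r. indicator N r * ennreal (2 * pi * r) * indicator {0..<1} r \<partial>lborel)"
    by (rule nn_integral_disc_radial) measurable
  also have "\<dots> = 0"
    using AE_not_in[OF N(1)] by (subst nn_integral_0_iff_AE) (auto elim!: eventually_mono)
  finally have "AE z in lborel. indicator N (cmod z) * indicator unit_disc z = (0 :: ennreal)"
    by (subst (asm) nn_integral_0_iff_AE) auto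
  then show ?thesis
    by eventually_elim (use N(2) in \<open>auto split: split_indicator_asm\<close>)
qed

text \<open>The passage from Lebesgue measure on the disc and the original weight to the Borel
  measure \<open>radial_measure\<close>. As H need only agree almost everywhere, Borel versions of f
  and \<omega> may be inserted.\<close>

lemma disc_area_integral:
  fixes H H' :: "complex \<Rightarrow> 'b::euclidean_space"
  assumes [measurable]: "H' \<in> borel_measurable borel"
    and eq: "AE z in lborel. z \<in> unit_disc \<longrightarrow> H z = g (cmod z) *\<^sub>R H' z"
  shows "integrable disc_area H \<longleftrightarrow> integrable radial_measure H'"
    and "(LINT z|disc_area. H z) = (LINT z|radial_measure. H' z)"
proof -
  have ae: "AE z in lebesgue. (g (cmod z) / pi) *\<^sub>R H' z = indicator unit_disc z *\<^sub>R ((1 / pi) *\<^sub>R H z)"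
    using AE_completion[OF eq] by eventually_elim (auto simp: g_outside split: split_indicator)
  have m1: "(\<lambda>z. (g (cmod z) / pi) *\<^sub>R H' z) \<in> borel_measurable lebesgue"
    by (intro measurable_completion) measurable
  have m2: "(\<lambda>z. indicator unit_disc z *\<^sub>R ((1 / pi) *\<^sub>R H z)) \<in> borel_measurable lebesgue"
    by (rule borel_measurable_AE[OF m1 ae])
  have "(\<lambda>z. (1 / pi) *\<^sub>R H z) \<in> borel_measurable (lebesgue_on unit_disc)"
    by (subst borel_measurable_restrict_space_iff) (simp, rule m2)
  from borel_measurable_scaleR[OF borel_measurable_const[of pi] this]
  have mH: "H \<in> borel_measurable (lebesgue_on unit_disc)" by simp
  have "integrable disc_area H \<longleftrightarrow> integrable (lebesgue_on unit_disc) (\<lambda>z. (1 / pi) *\<^sub>R H z)"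
    unfolding disc_area_def by (rule integrable_density[OF mH]) auto
  also have "\<dots> \<longleftrightarrow> integrable lebesgue (\<lambda>z. indicator unit_disc z *\<^sub>R ((1 / pi) *\<^sub>R H z))"
    by (rule integrable_restrict_space) simp
  also have "\<dots> \<longleftrightarrow> integrable lebesgue (\<lambda>z. (g (cmod z) / pi) *\<^sub>R H' z)"
    by (rule integrable_cong_AE[OF m1 m2 ae, symmetric])
  also have "\<dots> \<longleftrightarrow> integrable lborel (\<lambda>z. (g (cmod z) / pi) *\<^sub>R H' z)"
    by (rule integrable_completion) measurable
  also have "\<dots> \<longleftrightarrow> integrable radial_measure H'"
    unfolding radial_measure_def using g_nonneg by (subst integrable_density) auto
  finally show "integrable disc_area H \<longleftrightarrow> integrable radial_measure H'" .
  have "(LINT z|disc_area. H z) = (LINT z|lebesgue_on unit_disc. (1 / pi) *\<^sub>R H z)"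
    unfolding disc_area_def by (rule integral_density[OF mH]) auto
  also have "\<dots> = (LINT z|lebesgue. indicator unit_disc z *\<^sub>R ((1 / pi) *\<^sub>R H z))"
    by (rule integral_restrict_space) simp
  also have "\<dots> = (LINT z|lebesgue. (g (cmod z) / pi) *\<^sub>R H' z)"
    by (rule integral_cong_AE[OF m1 m2 ae, symmetric])
  also have "\<dots> = (LINT z|lborel. (g (cmod z) / pi) *\<^sub>R H' z)"
    by (rule integral_completion) measurable
  also have "\<dots> = (LINT z|radial_measure. H' z)"
    unfolding radial_measure_def using g_nonneg by (subst integral_density) auto
  finally show "(LINT z|disc_area. H z) = (LINT z|radial_measure. H' z)" .
qed

end

text \<open>A Bochner integral of a non-integrable function has the default value 0; the
  integrability clause excludes this, so the operator shown to be bounded is given by a genuine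
  integral at every point of the disc.\<close>

theorem theorem7:
  fixes \<omega> :: "real \<Rightarrow> real" and p :: real
  assumes "\<omega> \<in> D_hat" and "1 < p"
  shows "(\<forall>f\<in>Lp_weighted \<omega> p. \<forall>z\<in>unit_disc. integrable disc_area (bergman_integrand \<omega> f z)) \<and>
    bounded_on_Lp \<omega> p (bergman_projection \<omega>)"
proof -
  obtain C where \<omega>: "radial_weight \<omega>" and C: "1 \<le> C" "\<forall>r\<in>{0..<1}. tail_integral \<omega> r \<le> C * tail_integral \<omega> ((1 + r) / 2)"
    using assms(1) by (auto simp: D_hat_def)
  obtain g where g: "g \<in> borel_measurable borel" "\<And>r. 0 \<le> g r" "\<And>r. r \<notin> {0..<1} \<Longrightarrow> g r = 0"
    "AE r in lborel. r \<in> {0..<1} \<longrightarrow> \<omega> r = g r"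
    using radial_weight_borel_version[OF \<omega>] by blast
  note [measurable] = g(1)
  interpret borel_radial_weight \<omega> g
    using \<omega> g by unfold_locales
  define \<nu> where "\<nu> = radial_measure"
  interpret radial_disc_measure \<nu> "2 * C"
    unfolding \<nu>_def by (rule radial_disc_measure_D_hat[OF C])
  note disc_integral = disc_area_integral[folded \<nu>_def]
  have c_eq: "c n = 2 * moment \<omega> (real (2 * n + 1))" for n
    unfolding c_def unfolding \<nu>_def by (rule moment_eq)
  have kernel_eq: "cnj (bergman_kernel \<omega> z x) = kernel (z * cnj x)" if "z \<in> unit_disc" "x \<in> unit_disc" for z x
  proof -
    have lt: "cmod z * cmod x < 1"
      using that mult_strict_mono[of "cmod z" 1 "cmod x" 1] by (cases "x = 0") auto
    have "summable (\<lambda>n. (cnj z * x) ^ n / of_real (c n))"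
    proof (rule summable_comparison_test'[OF kernel_coeff_summable[OF _ lt]])
      fix n
      have "norm ((cnj z * x) ^ n / of_real (c n)) = 1 * \<bar>(cmod z * cmod x) ^ n / c n\<bar>"
        by (simp add: norm_divide norm_power norm_mult abs_mult)
      also have "\<dots> \<le> (real n + 1)\<^sup>2 * \<bar>(cmod z * cmod x) ^ n / c n\<bar>"
        by (intro mult_right_mono) auto
      finally show "norm ((cnj z * x) ^ n / of_real (c n)) \<le> \<dots>" .
    qed simp
    then have "cnj (bergman_kernel \<omega> z x) = (\<Sum>n. cnj ((cnj z * x) ^ n / of_real (c n)))"
      unfolding bergman_kernel_def c_eq[symmetric]
      by (rule bounded_linear.suminf[OF bounded_linear_cnj])
    then show ?thesis by (simp add: kernel_def)
  qed
  \<comment> \<open>f is exchanged for a Borel function h. The two projections agree at every z in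
    the disc, not only almost everywhere, because z enters through the kernel alone.\<close>
  have transfer: "\<exists>h. h \<in> borel_measurable borel \<and> integrable \<nu> h
      \<and> integrable \<nu> (\<lambda>z. cmod (h z) powr p)
      \<and> Lp_norm \<omega> p f = (LINT z|\<nu>. cmod (h z) powr p) powr (1 / p)
      \<and> (\<forall>z\<in>unit_disc. integrable disc_area (bergman_integrand \<omega> f z)
          \<and> bergman_projection \<omega> f z = projection h z)"
    if f: "f \<in> Lp_weighted \<omega> p" for f
  proof -
    have f_meas: "f \<in> borel_measurable (lebesgue_on unit_disc)"
      and f_int: "integrable disc_area (\<lambda>z. cmod (f z) powr p * \<omega> (cmod z))"
      using f by (auto simp: Lp_weighted_def)
    obtain h where h [measurable]: "h \<in> borel_measurable borel" and fh: "AE z in lborel. z \<in> unit_disc \<longrightarrow> f z = h z"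
      using borel_version_disc[OF f_meas] by blast
    have power_eq: "AE z in lborel. z \<in> unit_disc \<longrightarrow>
        cmod (f z) powr p * \<omega> (cmod z) = g (cmod z) *\<^sub>R (cmod (h z) powr p)"
      using fh AE_weight_eq by eventually_elim simp
    have "(\<lambda>z. cmod (h z) powr p) \<in> borel_measurable borel" by measurable
    note power_integral = disc_integral[OF this power_eq]
    have hp: "integrable \<nu> (\<lambda>z. cmod (h z) powr p)"
      using power_integral(1) f_int by simp
    have h_int: "integrable \<nu> h"
      using hp by (intro integrable_of_powr[OF h assms(2)]) (simp add: integrable_iff_bounded)
    have "integrable disc_area (bergman_integrand \<omega> f z) \<and> bergman_projection \<omega> f z = projection h z"
      if z: "z \<in> unit_disc" for z
    proof -
      have integrand_eq: "AE x in lborel. x \<in> unit_disc \<longrightarrow>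
          bergman_integrand \<omega> f z x = g (cmod x) *\<^sub>R (h x * kernel (z * cnj x))"
        using fh AE_weight_eq
      proof eventually_elim
        case (elim x)
        then show ?case
          using kernel_eq[OF z] by (simp add: bergman_integrand_def scaleR_conv_of_real mult_ac)
      qed
      have "(\<lambda>x. h x * kernel (z * cnj x)) \<in> borel_measurable borel" by measurable
      note integral = disc_integral[OF this integrand_eq]
      show ?thesis
        using integral integrable_projection[OF h_int, of z] z
        by (simp add: bergman_projection_def projection_def)
    qed
    then show ?thesis
      using h h_int hp power_integral(2) by (intro exI[of _ h]) (auto simp: Lp_norm_def)
  qed
  obtain A where bound: "\<And>h. h \<in> borel_measurable borel \<Longrightarrow> integrable \<nu> h \<Longrightarrow>
    lp_power \<nu> p (projection h) \<le> ennreal A * lp_power \<nu> p h"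
    using projection_bounded[OF assms(2)] by blast
  \<comment> \<open>\<open>projection_bounded\<close> does not state the sign of \<open>A\<close>,
    hence the maximum with 0.\<close>
  have main: "bergman_projection \<omega> f \<in> Lp_weighted \<omega> p \<and>
      Lp_norm \<omega> p (bergman_projection \<omega> f) \<le> max 0 A powr (1 / p) * Lp_norm \<omega> p f"
    if f: "f \<in> Lp_weighted \<omega> p" for f
  proof -
    obtain h where h [measurable]: "h \<in> borel_measurable borel" and h_int: "integrable \<nu> h"
      and hp: "integrable \<nu> (\<lambda>z. cmod (h z) powr p)"
      and norm_f: "Lp_norm \<omega> p f = (LINT z|\<nu>. cmod (h z) powr p) powr (1 / p)"
      and proj: "\<And>z. z \<in> unit_disc \<Longrightarrow> bergman_projection \<omega> f z = projection h z"
      using transfer[OF f] by blast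
    have [measurable]: "projection h \<in> borel_measurable borel" unfolding projection_def by measurable
    have power_eq: "AE z in lborel. z \<in> unit_disc \<longrightarrow>
        cmod (bergman_projection \<omega> f z) powr p * \<omega> (cmod z) = g (cmod z) *\<^sub>R (cmod (projection h z) powr p)"
      using AE_weight_eq by eventually_elim (simp add: proj)
    have "(\<lambda>z. cmod (projection h z) powr p) \<in> borel_measurable borel" by measurable
    note power_integral = disc_integral[OF this power_eq]
    have "lp_power \<nu> p (projection h) \<le> ennreal A * ennreal (LINT z|\<nu>. cmod (h z) powr p)"
      using bound[OF h h_int] nn_integral_eq_integral[OF hp] by simp
    also have "\<dots> \<le> ennreal (max 0 A) * ennreal (LINT z|\<nu>. cmod (h z) powr p)"
      by (intro mult_right_mono ennreal_leI) auto
    also have "\<dots> = ennreal (max 0 A * (LINT z|\<nu>. cmod (h z) powr p))"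
      by (simp add: ennreal_mult')
    finally have le: "lp_power \<nu> p (projection h) \<le> \<dots>" .
    have Ph: "integrable \<nu> (\<lambda>z. cmod (projection h z) powr p)"
      using le_less_trans[OF le] by (intro integrableI_bounded) auto
    have int_le: "(LINT z|\<nu>. cmod (projection h z) powr p) \<le> max 0 A * (LINT z|\<nu>. cmod (h z) powr p)"
      using le by (subst (asm) nn_integral_eq_integral[OF Ph]) (auto simp: ennreal_le_iff)
    have "projection h \<in> borel_measurable (lebesgue_on unit_disc)"
      by (intro measurable_restrict_space1 measurable_completion) measurable
    then have "bergman_projection \<omega> f \<in> borel_measurable (lebesgue_on unit_disc)"
      by (subst measurable_cong[of _ _ "projection h"]) (auto simp: space_restrict_space proj)
    moreover have "integrable disc_area (\<lambda>z. cmod (bergman_projection \<omega> f z) powr p * \<omega> (cmod z))"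
      using power_integral(1) Ph by simp
    moreover have "Lp_norm \<omega> p (bergman_projection \<omega> f) \<le> max 0 A powr (1 / p) * Lp_norm \<omega> p f"
    proof -
      have "Lp_norm \<omega> p (bergman_projection \<omega> f) = (LINT z|\<nu>. cmod (projection h z) powr p) powr (1 / p)"
        using power_integral(2) by (simp add: Lp_norm_def)
      also have "\<dots> \<le> (max 0 A * (LINT z|\<nu>. cmod (h z) powr p)) powr (1 / p)"
        using int_le assms(2) by (intro powr_mono2) auto
      also have "\<dots> = max 0 A powr (1 / p) * Lp_norm \<omega> p f"
        unfolding norm_f by (intro powr_mult)
      finally show ?thesis .
    qed
    ultimately show ?thesis by (simp add: Lp_weighted_def)
  qed
  show ?thesis
    unfolding bounded_on_Lp_def using transfer main by blast
qed

end
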